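(* Let $F$ be a field of characteristic $0$ or greater than $3$. (1) If $\varphi$ is a nondegenerate cubic form over $F$ which permits composition and which is not the norm of a cubic field extension of $F$, then Scharlau's norm principle holds for $\varphi$ for all finite separable field extensions of $F$. (2) If $\varphi=N_{F'/F}$ is the norm of a cubic field extension $F'/F$, then Scharlau's norm principle holds for $\varphi$ for every finite Galois extension of $F$, and for every field extension $K/F$ of degree either a power of $3$ or coprime to $3$.
   Context: A cubic form over $F$ is a form $\varphi:V\to F$ of degree $3$ on a finite-dimensional $F$-vector space $V$, i.e., in coordinates, a homogeneous polynomial of degree $3$ in $n=\dim V$ variables. Let $\theta:V\times V\times V\to F$ be the unique symmetric trilinear form with $\theta(v,v,v)=\varphi(v)$; $\varphi$ is nondegenerate if $v=0$ is the only vector with $\theta(v,v_2,v_3)=0$ for all $v_2,v_3\in V$. A nondegenerate form $\varphi(x_1,\dots,x_n)$ permits composition if $\varphi(x)\varphi(y)=\varphi(z)$ where $x,y$ are systems of $n$ indeterminates and each $z_l$ is a bilinear form in $x,y$ with coefficients in $F$. Two forms $(V_1,\varphi_1)$, $(V_2,\varphi_2)$ are isomorphic, $\varphi_1\cong\varphi_2$, if there is a bijective linear map $f:V_1\to V_2$ with $\varphi_2(f(v))=\varphi_1(v)$ for all $v\in V_1$; forms are considered up to isomorphism. $\varphi_K$ is the scalar extension of $\varphi$ to $V\otimes_FK$. Scharlau's norm principle holds for $\varphi$ for a finite field extension $K/F$ if for every $a\in K^\times$ with $a\varphi_K\cong\varphi_K$ one has $N_{K/F}(a)\varphi\cong\varphi$.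 *)

theory Defs
  imports
    "HOL-Library.Poly_Mapping"
    "HOL-Algebra.Algebraic_Closure_Type"
    "Jordan_Normal_Form.Determinant"
begin

section \<open>Field extensions\<close>

text \<open>
  The ground field \<open>F\<close> is a type \<open>'f\<close> of class \<^class>\<open>field\<close>. An extension \<open>K / F\<close> is a homomorphism
  \<open>h :: 'f \<Rightarrow> 'k\<close> into another field type together with a subfield \<open>K\<close> of \<open>'k\<close> that contains the
  image of \<open>h\<close>; with \<open>K = UNIV\<close> the whole type \<open>'k\<close> is the extension.
\<close>

definition field_extension :: "('f::field \<Rightarrow> 'k::field) \<Rightarrow> 'k set \<Rightarrow> bool" where
  "field_extension h K \<longleftrightarrow> field_hom h \<and> range h \<subseteq> K \<and>
     (\<forall>x\<in>K. \<forall>y\<in>K. x + y \<in> K \<and> x * y \<in> K) \<and> (\<forall>x\<in>K. - x \<in> K \<and> inverse x \<in> K)"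

definition ext_scale :: "('f::field \<Rightarrow> 'k::field) \<Rightarrow> 'f \<Rightarrow> 'k \<Rightarrow> 'k" where
  "ext_scale h c x = h c * x"

definition finite_extension :: "('f::field \<Rightarrow> 'k::field) \<Rightarrow> 'k set \<Rightarrow> bool" where
  "finite_extension h K \<longleftrightarrow> field_extension h K \<and>
     (\<exists>B. finite B \<and> module.span (ext_scale h) B = K)"

definition ext_degree :: "('f::field \<Rightarrow> 'k::field) \<Rightarrow> 'k set \<Rightarrow> nat" where
  "ext_degree h K = vector_space.dim (ext_scale h) K"

text \<open>
  Up to a unit of \<open>F[X]\<close>, an irreducible polynomial that vanishes at \<open>x\<close> is the minimal polynomial
  of \<open>x\<close> over \<open>F\<close>. The constant \<open>irreducible\<close> must be qualified, since HOL-Algebra has one of the same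
  name.
\<close>

definition separable_poly :: "'f::field poly \<Rightarrow> bool" where
  "separable_poly p \<longleftrightarrow> rsquarefree (map_poly to_ac p)"

definition separable_extension :: "('f::field \<Rightarrow> 'k::field) \<Rightarrow> 'k set \<Rightarrow> bool" where
  "separable_extension h K \<longleftrightarrow> field_extension h K \<and>
     (\<forall>x\<in>K. \<exists>p. Factorial_Ring.irreducible p \<and> poly (map_poly h p) x = 0 \<and> separable_poly p)"

definition splits_in :: "('f::field \<Rightarrow> 'k::field) \<Rightarrow> 'k set \<Rightarrow> 'f poly \<Rightarrow> bool" where
  "splits_in h K p \<longleftrightarrow>
     (\<exists>c A. set_mset A \<subseteq> K \<and> map_poly h p = Polynomial.smult c (\<Prod>r\<in>#A. [:- r, 1:]))"

definition normal_extension :: "('f::field \<Rightarrow> 'k::field) \<Rightarrow> 'k set \<Rightarrow> bool" where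
  "normal_extension h K \<longleftrightarrow> field_extension h K \<and>
     (\<forall>x\<in>K. \<exists>p. Factorial_Ring.irreducible p \<and> poly (map_poly h p) x = 0 \<and> splits_in h K p)"

definition finite_galois_extension :: "('f::field \<Rightarrow> 'k::field) \<Rightarrow> 'k set \<Rightarrow> bool" where
  "finite_galois_extension h K \<longleftrightarrow>
     finite_extension h K \<and> normal_extension h K \<and> separable_extension h K"

text \<open>
  The norm of \<open>a\<close> is the determinant of the \<open>F\<close>-linear map \<open>x \<mapsto> a x\<close> on \<open>K\<close>, taken with respect to
  some \<open>F\<close>-basis of \<open>K\<close>; the choice of the basis is immaterial. Only meaningful for finite
  extensions.
\<close>

definition is_ext_basis :: "('f::field \<Rightarrow> 'k::field) \<Rightarrow> 'k set \<Rightarrow> 'k list \<Rightarrow> bool" where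
  "is_ext_basis h K bs \<longleftrightarrow> distinct bs \<and> \<not> module.dependent (ext_scale h) (set bs) \<and>
     module.span (ext_scale h) (set bs) = K"

definition mult_matrix :: "('f::field \<Rightarrow> 'k::field) \<Rightarrow> 'k list \<Rightarrow> 'k \<Rightarrow> 'f mat" where
  "mult_matrix h bs a = mat (length bs) (length bs)
     (\<lambda>(i, j). module.representation (ext_scale h) (set bs) (a * bs ! j) (bs ! i))"

definition field_norm :: "('f::field \<Rightarrow> 'k::field) \<Rightarrow> 'k set \<Rightarrow> 'k \<Rightarrow> 'f" where
  "field_norm h K a = det (mult_matrix h (SOME bs. is_ext_basis h K bs) a)"


section \<open>Cubic forms\<close>

text \<open>
  A polynomial in the indeterminates \<open>X\<^sub>0, X\<^sub>1, \<dots>\<close> maps each monomial \<open>m\<close>, given by its exponents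
  \<open>m i\<close>, to its coefficient; the ring structure is that of \<open>HOL-Library.Poly_Mapping\<close>.
\<close>

type_synonym 'a mpoly = "(nat \<Rightarrow>\<^sub>0 nat) \<Rightarrow>\<^sub>0 'a"

definition mconst :: "'a::comm_ring_1 \<Rightarrow> 'a mpoly" where
  "mconst c = Poly_Mapping.single 0 c"

definition mvar :: "nat \<Rightarrow> 'a::comm_ring_1 mpoly" where
  "mvar i = Poly_Mapping.single (Poly_Mapping.single i 1) 1"

definition subst_mpoly ::
    "('a::comm_ring_1 \<Rightarrow> 'r::comm_ring_1) \<Rightarrow> (nat \<Rightarrow> 'r) \<Rightarrow> 'a mpoly \<Rightarrow> 'r" where
  "subst_mpoly c r p = (\<Sum>m\<in>Poly_Mapping.keys p.
     c (Poly_Mapping.lookup p m) * (\<Prod>i\<in>Poly_Mapping.keys m. r i ^ Poly_Mapping.lookup m i))"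

definition cubic_form :: "nat \<Rightarrow> 'a::comm_ring_1 mpoly \<Rightarrow> bool" where
  "cubic_form n p \<longleftrightarrow> (\<forall>m\<in>Poly_Mapping.keys p. Poly_Mapping.keys m \<subseteq> {..<n} \<and>
     (\<Sum>i\<in>Poly_Mapping.keys m. Poly_Mapping.lookup m i) = 3)"

definition form_value :: "'a::comm_ring_1 mpoly \<Rightarrow> 'a vec \<Rightarrow> 'a" where
  "form_value p v = subst_mpoly (\<lambda>c. c) (\<lambda>i. v $ i) p"

definition scalar_ext :: "('f::field \<Rightarrow> 'k::field) \<Rightarrow> 'f mpoly \<Rightarrow> 'k mpoly" where
  "scalar_ext h p = Poly_Mapping.map h p"

definition symmetric_trilinear :: "nat \<Rightarrow> ('a::field vec \<Rightarrow> 'a vec \<Rightarrow> 'a vec \<Rightarrow> 'a) \<Rightarrow> bool" where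
  "symmetric_trilinear n T \<longleftrightarrow>
     (\<forall>u\<in>carrier_vec n. \<forall>v\<in>carrier_vec n. \<forall>w\<in>carrier_vec n. T u v w = T v u w \<and> T u v w = T u w v) \<and>
     (\<forall>u\<in>carrier_vec n. \<forall>u'\<in>carrier_vec n. \<forall>v\<in>carrier_vec n. \<forall>w\<in>carrier_vec n.
        T (u + u') v w = T u v w + T u' v w) \<and>
     (\<forall>c. \<forall>u\<in>carrier_vec n. \<forall>v\<in>carrier_vec n. \<forall>w\<in>carrier_vec n.
        T (c \<cdot>\<^sub>v u) v w = c * T u v w)"

text \<open>
  For characteristic different from 2 and 3 the form \<open>T\<close> exists and is unique on \<open>carrier_vec n\<close>;
  its values elsewhere are irrelevant.
\<close>

definition nondegenerate :: "nat \<Rightarrow> 'a::field mpoly \<Rightarrow> bool" where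
  "nondegenerate n p \<longleftrightarrow> (\<exists>T. symmetric_trilinear n T \<and>
     (\<forall>v\<in>carrier_vec n. T v v v = form_value p v) \<and>
     (\<forall>v\<in>carrier_vec n.
        (\<forall>v\<^sub>2\<in>carrier_vec n. \<forall>v\<^sub>3\<in>carrier_vec n. T v v\<^sub>2 v\<^sub>3 = 0) \<longrightarrow> v = 0\<^sub>v n))"

text \<open>
  The identity \<open>p(x) p(y) = p(z)\<close> is one of polynomials in \<open>2n\<close> indeterminates: \<open>x\<close> consists of
  \<open>X\<^sub>0, \<dots>, X\<^bsub>n-1\<^esub>\<close> and \<open>y\<close> of \<open>X\<^sub>n, \<dots>, X\<^bsub>2n-1\<^esub>\<close>.
\<close>

definition permits_composition :: "nat \<Rightarrow> 'a::field mpoly \<Rightarrow> bool" where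
  "permits_composition n p \<longleftrightarrow> nondegenerate n p \<and>
     (\<exists>b :: nat \<Rightarrow> nat \<Rightarrow> nat \<Rightarrow> 'a.
        subst_mpoly mconst mvar p * subst_mpoly mconst (\<lambda>i. mvar (n + i)) p =
        subst_mpoly mconst (\<lambda>l. \<Sum>i<n. \<Sum>j<n. mconst (b l i j) * mvar i * mvar (n + j)) p)"

text \<open>
  Isomorphism over the field \<open>S\<close> of forms given by their value functions on \<open>V\<close> and \<open>W\<close>, vector
  spaces over \<open>S\<close> with scalar multiplications \<open>sV\<close> and \<open>sW\<close>.
\<close>

definition isomorphic_forms ::
    "'s set \<Rightarrow> ('s \<Rightarrow> 'v::plus \<Rightarrow> 'v) \<Rightarrow> 'v set \<Rightarrow> ('v \<Rightarrow> 's) \<Rightarrow>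
     ('s \<Rightarrow> 'w::plus \<Rightarrow> 'w) \<Rightarrow> 'w set \<Rightarrow> ('w \<Rightarrow> 's) \<Rightarrow> bool" where
  "isomorphic_forms S sV V p sW W q \<longleftrightarrow> (\<exists>f. bij_betw f V W \<and>
     (\<forall>u\<in>V. \<forall>v\<in>V. f (u + v) = f u + f v) \<and>
     (\<forall>c\<in>S. \<forall>v\<in>V. f (sV c v) = sW c (f v)) \<and>
     (\<forall>v\<in>V. q (f v) = p v))"

definition vecs_over :: "'k set \<Rightarrow> nat \<Rightarrow> 'k vec set" where
  "vecs_over K n = {v \<in> carrier_vec n. \<forall>i<n. v $ i \<in> K}"

definition similarity_factor :: "'k::field set \<Rightarrow> nat \<Rightarrow> 'k mpoly \<Rightarrow> 'k \<Rightarrow> bool" where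
  "similarity_factor K n p a \<longleftrightarrow>
     isomorphic_forms K (\<cdot>\<^sub>v) (vecs_over K n) (\<lambda>v. a * form_value p v)
                        (\<cdot>\<^sub>v) (vecs_over K n) (form_value p)"

definition scharlau_norm_principle ::
    "('f::field \<Rightarrow> 'k::field) \<Rightarrow> 'k set \<Rightarrow> nat \<Rightarrow> 'f mpoly \<Rightarrow> bool" where
  "scharlau_norm_principle h K n p \<longleftrightarrow>
     (\<forall>a\<in>K - {0}. similarity_factor K n (scalar_ext h p) a \<longrightarrow>
        similarity_factor UNIV n p (field_norm h K a))"

definition cubic_extension :: "('f::field \<Rightarrow> 'l::field) \<Rightarrow> 'l set \<Rightarrow> bool" where
  "cubic_extension j L \<longleftrightarrow> finite_extension j L \<and> ext_degree j L = 3"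

definition isomorphic_to_norm_form ::
    "('f::field \<Rightarrow> 'l::field) \<Rightarrow> 'l set \<Rightarrow> nat \<Rightarrow> 'f mpoly \<Rightarrow> bool" where
  "isomorphic_to_norm_form j L n p \<longleftrightarrow>
     isomorphic_forms UNIV (\<cdot>\<^sub>v) (carrier_vec n) (form_value p)
                           (ext_scale j) L (field_norm j L)"

text \<open>
  Every cubic extension of \<open>F\<close> is \<open>F\<close>-isomorphic to an intermediate field of the algebraic closure
  of \<open>F\<close>, so that the quantifier below covers all cubic extensions.
\<close>

definition norm_of_some_cubic_extension :: "nat \<Rightarrow> 'f::field mpoly \<Rightarrow> bool" where
  "norm_of_some_cubic_extension n p \<longleftrightarrow> (\<exists>L :: 'f alg_closure set.
     cubic_extension to_ac L \<and> isomorphic_to_norm_form to_ac L n p)"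

end

theory Submission
  imports Defs "HOL-Library.Function_Algebras" "HOL-Computational_Algebra.Computational_Algebra"
    "Jordan_Normal_Form.Char_Poly"
begin

text \<open>
  The norm principle holds for every finite extension \<open>K / F\<close> and every nondegenerate form \<open>N\<close> with a
  bilinear product such that \<open>N (x y) = N x * N y\<close>: norm forms have such a product as well. A similarity
  factor \<open>a\<close> over \<open>K\<close> is a value of \<open>N\<close> over \<open>K\<close>, and a nonzero value \<open>N y\<close> over \<open>F\<close> is a similarity
  factor, since left multiplication by \<open>y\<close> is a similitude. It is therefore enough to show that the norm
  \<open>N\<^bsub>K/F\<^esub>\<close> maps values over \<open>K\<close> to values over \<open>F\<close>.

  By Kaplansky's trick the product may be assumed to have a unit. If \<open>N\<close> is isotropic, it represents
  every element of \<open>F\<close>. If it is anisotropic, the product is associative, and for \<open>n \<ge> 2\<close> the determinant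
  of left multiplication by \<open>x\<close> is \<open>(N x)^(n / 3)\<close> over every commutative extension ring. Left
  multiplication by an element over \<open>K\<close> is a block matrix in two ways, with blocks from \<open>K\<close> or with blocks
  from the algebra. Gaussian elimination in the division algebra expresses its determinant by values of \<open>N\<close>.
\<close>

text \<open>The obstacle is that left multiplication by \<open>x\<close> has determinant
  \<open>N x ^ (n div 3)\<close>, so comparing determinants determines a norm only up to a root of
  unity; moreover elimination may meet a zero pivot. Both difficulties vanish over
  \<open>F[t]\<close> for matrices that reduce to the identity at t = 0: every pivot reduces to the
  unit, and a polynomial has at most one root of given order with constant term 1. The price is a
  relation \<open>N v = N s * g\<close> in which \<open>N s\<close> may vanish at t = 1, the point
  of interest; there a common zero is cancelled as a cube from both sides. Anisotropy acts three
  times: it forces associativity, it makes the cubic \<open>N (t e + d)\<close> irreducible for a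
  generic \<open>d\<close>, which leaves powers of \<open>N\<close> as the only candidates for the
  determinant, and it permits the cancellation above. Identities pass to other rings of scalars by
  being checked on basis vectors, whose coordinates 0 and 1 exist everywhere. This is why the
  adjoint is carried along in linearized form.\<close>

section \<open>Cubic algebras\<close>

text \<open>Polarization: the alternating sum of the values at \<open>x + y + z\<close>, at the
  partial sums and at the single vectors is \<open>6 * A x y z\<close>. It turns identities on the
  diagonal into multilinear ones.\<close>

lemma symmetric_trilinear_zero:
  fixes A :: "'v::ab_group_add \<Rightarrow> 'v \<Rightarrow> 'v \<Rightarrow> 'f::field"
  assumes add: "\<And>x x' y z. A (x + x') y z = A x y z + A x' y z"
    and sym: "\<And>x y z. A x y z = A y x z" "\<And>x y z. A x y z = A x z y"
    and V: "\<And>x y. x \<in> V \<Longrightarrow> y \<in> V \<Longrightarrow> x + y \<in> V"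
    and diag: "\<And>x. x \<in> V \<Longrightarrow> A x x x = 0"
    and char: "(2::'f) \<noteq> 0" "(3::'f) \<noteq> 0"
    and xyz: "x \<in> V" "y \<in> V" "z \<in> V"
  shows "A x y z = 0"
proof -
  have add2: "A x (y + y') z = A x y z + A x y' z" for x y y' z
    by (metis add sym(1))
  have add3: "A x y (z + z') = A x y z + A x y z'" for x y z z'
    by (metis add2 sym(2))
  have "A (x + y + z) (x + y + z) (x + y + z) - A (x + y) (x + y) (x + y)
      - A (x + z) (x + z) (x + z) - A (y + z) (y + z) (y + z) + A x x x + A y y y + A z z z
      = A x y z + A x z y + A y x z + A y z x + A z x y + A z y x"
    by (simp only: add add2 add3) (simp add: algebra_simps)
  also have "\<dots> = 2 * 3 * A x y z"
  proof -
    have "A x z y = A x y z" "A y x z = A x y z" "A y z x = A x y z" "A z x y = A x y z" "A z y x = A x y z"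
      by (metis sym)+
    then show ?thesis by simp
  qed
  finally have "2 * (3 * A x y z) = 0"
    using diag V xyz by (simp add: mult.assoc)
  then show ?thesis using char by (metis mult_eq_0_iff)
qed

text \<open>\<open>mul\<close> and \<theta> are linear on the whole type and products lie in
  \<open>V\<close> unconditionally, so that rewriting by linearity carries no membership conditions.
  Only nondegeneracy and the composition law are restricted to \<open>V\<close>.\<close>

locale cubic_composition = vector_space scale
  for scale :: "'f::field \<Rightarrow> 'v::ab_group_add \<Rightarrow> 'v" (infixr "*s" 75) +
  fixes V :: "'v set" and mul :: "'v \<Rightarrow> 'v \<Rightarrow> 'v" (infixl "\<star>" 70)
    and \<theta> :: "'v \<Rightarrow> 'v \<Rightarrow> 'v \<Rightarrow> 'f"
  assumes V: "subspace V"
    and mul_add_left: "(x + y) \<star> z = x \<star> z + y \<star> z"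
    and mul_add_right: "x \<star> (y + z) = x \<star> y + x \<star> z"
    and mul_scale_left [simp]: "(c *s x) \<star> y = c *s (x \<star> y)"
    and mul_scale_right [simp]: "x \<star> (c *s y) = c *s (x \<star> y)"
    and mul_V [simp, intro]: "x \<star> y \<in> V"
    and \<theta>_add: "\<theta> (x + x') y z = \<theta> x y z + \<theta> x' y z"
    and \<theta>_scale: "\<theta> (c *s x) y z = c * \<theta> x y z"
    and \<theta>_sym1: "\<theta> x y z = \<theta> y x z"
    and \<theta>_sym2: "\<theta> x y z = \<theta> x z y"
    and nondeg: "\<And>v. v \<in> V \<Longrightarrow> (\<And>y z. y \<in> V \<Longrightarrow> z \<in> V \<Longrightarrow> \<theta> v y z = 0) \<Longrightarrow> v = 0"
    and comp: "x \<in> V \<Longrightarrow> y \<in> V \<Longrightarrow> \<theta> (x \<star> y) (x \<star> y) (x \<star> y) = \<theta> x x x * \<theta> y y y"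
    and two [simp]: "(2::'f) \<noteq> 0"
    and three [simp]: "(3::'f) \<noteq> 0"
begin

lemma V_add [simp, intro]: "x \<in> V \<Longrightarrow> y \<in> V \<Longrightarrow> x + y \<in> V"
  and V_diff [simp, intro]: "x \<in> V \<Longrightarrow> y \<in> V \<Longrightarrow> x - y \<in> V"
  and V_neg [simp, intro]: "x \<in> V \<Longrightarrow> - x \<in> V"
  and V_scale [simp, intro]: "x \<in> V \<Longrightarrow> c *s x \<in> V"
  and V_zero [simp, intro]: "0 \<in> V"
  using V by (auto intro: subspace_add subspace_diff subspace_neg subspace_scale subspace_0)

lemma \<theta>_add2: "\<theta> x (y + y') z = \<theta> x y z + \<theta> x y' z"
  by (metis \<theta>_add \<theta>_sym1)

lemma \<theta>_add3: "\<theta> x y (z + z') = \<theta> x y z + \<theta> x y z'"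
  by (metis \<theta>_add2 \<theta>_sym2)

lemma \<theta>_scale2: "\<theta> x (c *s y) z = c * \<theta> x y z"
  by (metis \<theta>_scale \<theta>_sym1)

lemma \<theta>_scale3: "\<theta> x y (c *s z) = c * \<theta> x y z"
  by (metis \<theta>_scale2 \<theta>_sym2)

lemma \<theta>_zero [simp]: "\<theta> 0 y z = 0" "\<theta> x 0 z = 0" "\<theta> x y 0 = 0"
  using \<theta>_scale[of 0 0 y z] \<theta>_scale2[of x 0 0 z] \<theta>_scale3[of x y 0 0] by simp_all

lemma \<theta>_neg: "\<theta> (- x) y z = - \<theta> x y z" "\<theta> x (- y) z = - \<theta> x y z" "\<theta> x y (- z) = - \<theta> x y z"
  using \<theta>_scale[of "-1" x y z] \<theta>_scale2[of x "-1" y z] \<theta>_scale3[of x y "-1" z] by simp_all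

lemma \<theta>_diff: "\<theta> (x - x') y z = \<theta> x y z - \<theta> x' y z"
  "\<theta> x (y - y') z = \<theta> x y z - \<theta> x y' z" "\<theta> x y (z - z') = \<theta> x y z - \<theta> x y z'"
  using \<theta>_add[of x "- x'" y z] \<theta>_add2[of x y "- y'" z] \<theta>_add3[of x y z "- z'"] 
  by (simp_all add: \<theta>_neg)

lemmas \<theta>_linear = \<theta>_add \<theta>_add2 \<theta>_add3 \<theta>_scale \<theta>_scale2 \<theta>_scale3 \<theta>_neg \<theta>_diff

lemma \<theta>_cycle: "\<theta> x y z = \<theta> y z x"
  by (metis \<theta>_sym1 \<theta>_sym2)

lemma mul_zero [simp]: "0 \<star> x = 0" "x \<star> 0 = 0"
  using mul_scale_left[of 0 0 x] mul_scale_right[of x 0 0] by simp_all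

lemma mul_neg [simp]: "(- x) \<star> y = - (x \<star> y)" "x \<star> (- y) = - (x \<star> y)"
  using mul_scale_left[of "-1" x y] mul_scale_right[of x "-1" y] by simp_all

lemma mul_diff: "(x - y) \<star> z = x \<star> z - y \<star> z" "x \<star> (y - z) = x \<star> y - x \<star> z"
  using mul_add_left[of x "- y" z] mul_add_right[of x y "- z"] by simp_all

lemmas mul_linear = mul_add_left mul_add_right mul_diff

text \<open>The composition law polarized in the second factor: left multiplication by
  \<open>x\<close> is a similitude of the trilinear form with factor
  \<open>\<theta> x x x\<close>.\<close>

lemma composition_trilinear:
  assumes "x \<in> V" "y1 \<in> V" "y2 \<in> V" "y3 \<in> V"
  shows "\<theta> (x \<star> y1) (x \<star> y2) (x \<star> y3) = \<theta> x x x * \<theta> y1 y2 y3"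
proof -
  define A where "A y1 y2 y3 = \<theta> (x \<star> y1) (x \<star> y2) (x \<star> y3) - \<theta> x x x * \<theta> y1 y2 y3" for y1 y2 y3
  have "A y1 y2 y3 = 0"
  proof (rule symmetric_trilinear_zero[of A V])
    show "A (y + y') z w = A y z w + A y' z w" for y y' z w
      by (simp add: A_def \<theta>_linear mul_linear algebra_simps)
    show "A y z w = A z y w" "A y z w = A y w z" for y z w
      using \<theta>_sym1[of "x \<star> y" "x \<star> z" "x \<star> w"] \<theta>_sym1[of y z w]
        \<theta>_sym2[of "x \<star> y" "x \<star> z" "x \<star> w"] \<theta>_sym2[of y z w]
      unfolding A_def by argo+
    show "A y y y = 0" if "y \<in> V" for y
      using comp[of x y] that assms by (simp add: A_def)
  qed (use assms in auto)
  then have "\<theta> (x \<star> y1) (x \<star> y2) (x \<star> y3) - \<theta> x x x * \<theta> y1 y2 y3 = 0"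
    by (simp add: A_def)
  then show ?thesis by simp
qed

text \<open>Polarization in the first factor as well; the left side runs over the six orders of
  \<open>x1\<close>, \<open>x2\<close>, \<open>x3\<close>. The identities of the unital algebra come
  from instances with several arguments equal to the unit.\<close>

lemma full_linearization:
  assumes "x1 \<in> V" "x2 \<in> V" "x3 \<in> V" "y1 \<in> V" "y2 \<in> V" "y3 \<in> V"
  shows "\<theta> (x1 \<star> y1) (x2 \<star> y2) (x3 \<star> y3) + \<theta> (x1 \<star> y1) (x3 \<star> y2) (x2 \<star> y3)
    + \<theta> (x2 \<star> y1) (x1 \<star> y2) (x3 \<star> y3) + \<theta> (x2 \<star> y1) (x3 \<star> y2) (x1 \<star> y3)
    + \<theta> (x3 \<star> y1) (x1 \<star> y2) (x2 \<star> y3) + \<theta> (x3 \<star> y1) (x2 \<star> y2) (x1 \<star> y3)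
    = 6 * \<theta> x1 x2 x3 * \<theta> y1 y2 y3" (is "?B x1 x2 x3 = _ x1 x2 x3 * _")
proof -
  have "?B x1 x2 x3 - 6 * \<theta> x1 x2 x3 * \<theta> y1 y2 y3 = 0"
  proof (rule symmetric_trilinear_zero
          [where A = "\<lambda>x1 x2 x3. ?B x1 x2 x3 - 6 * \<theta> x1 x2 x3 * \<theta> y1 y2 y3" and V = V])
    show "?B (x + x') y z - 6 * \<theta> (x + x') y z * \<theta> y1 y2 y3 =
      ?B x y z - 6 * \<theta> x y z * \<theta> y1 y2 y3 + (?B x' y z - 6 * \<theta> x' y z * \<theta> y1 y2 y3)" for x x' y z
      by (simp add: \<theta>_linear mul_linear algebra_simps)
    show "?B x y z - 6 * \<theta> x y z * \<theta> y1 y2 y3 = ?B y x z - 6 * \<theta> y x z * \<theta> y1 y2 y3" for x y z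
      using \<theta>_sym1[of x y z] by (simp add: algebra_simps)
    show "?B x y z - 6 * \<theta> x y z * \<theta> y1 y2 y3 = ?B x z y - 6 * \<theta> x z y * \<theta> y1 y2 y3" for x y z
      using \<theta>_sym2[of x y z] by (simp add: algebra_simps)
    show "?B x x x - 6 * \<theta> x x x * \<theta> y1 y2 y3 = 0" if "x \<in> V" for x
      using composition_trilinear[OF that, of y1 y2 y3] assms by simp
  qed (use assms in auto)
  then show ?thesis by simp
qed

end

section \<open>Trace, adjoint and alternativity of a unital cubic composition\<close>

locale cubic_algebra = cubic_composition scale V mul \<theta>
  for scale :: "'f::field \<Rightarrow> 'v::ab_group_add \<Rightarrow> 'v" (infixr "*s" 75)
    and V and mul (infixl "\<star>" 70) and \<theta> +
  fixes e :: 'v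
  assumes e_V [simp, intro]: "e \<in> V"
    and e_left [simp]: "x \<in> V \<Longrightarrow> e \<star> x = x"
    and e_right [simp]: "x \<in> V \<Longrightarrow> x \<star> e = x"
    and \<theta>_e [simp]: "\<theta> e e e = 1"
begin

text \<open>Reversing the product leaves the trace, the norm and the adjoint unchanged, so each
  identity for left multiplication yields one for right multiplication.\<close>

lemma opposite: "cubic_algebra scale V (\<lambda>x y. y \<star> x) \<theta> e"
proof unfold_locales
  show "x \<in> V \<Longrightarrow> y \<in> V \<Longrightarrow> \<theta> (y \<star> x) (y \<star> x) (y \<star> x) = \<theta> x x x * \<theta> y y y" for x y
    using comp[of y x] by (simp add: mult.commute)
  show "\<theta> x y z = \<theta> y x z" "\<theta> x y z = \<theta> x z y" for x y z
    by (rule \<theta>_sym1 \<theta>_sym2)+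
qed (auto simp: V mul_add_left mul_add_right \<theta>_add \<theta>_scale intro: nondeg)

text \<open>\<open>T\<close>, \<open>S\<close> and \<open>N\<close> are the coefficients of the
  generic cubic: N(t e - x) = t^3 - T(x) t^2 + S(x) t - N(x). Accordingly \<open>sharp x\<close> is
  the classical adjoint, with the Cayley-Hamilton relation
  \<open>sharp x \<star> x = N x *s e\<close> proved below.\<close>

definition T :: "'v \<Rightarrow> 'f" where "T x = 3 * \<theta> e e x"
definition S :: "'v \<Rightarrow> 'f" where "S x = 3 * \<theta> e x x"
definition N :: "'v \<Rightarrow> 'f" where "N x = \<theta> x x x"
definition sharp :: "'v \<Rightarrow> 'v" where "sharp x = x \<star> x - T x *s x + S x *s e"

lemma sharp_V [simp, intro]: "x \<in> V \<Longrightarrow> sharp x \<in> V"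
  by (simp add: sharp_def)

lemma T_linear: "T (x + y) = T x + T y" "T (x - y) = T x - T y" "T (- x) = - T x"
  "T (c *s x) = c * T x" "T 0 = 0" "T e = 3"
  by (simp_all add: T_def \<theta>_linear algebra_simps)

text \<open>This is \<open>full_linearization\<close> at \<open>e, e, x\<close> against
  \<open>e, e, y\<close>. The right side is symmetric in \<open>x\<close> and \<open>y\<close>,
  hence the trace form is symmetric.\<close>

lemma T_mul:
  assumes "x \<in> V" "y \<in> V"
  shows "T (x \<star> y) = T x * T y - 6 * \<theta> e x y"
proof -
  have "2 * (2 * \<theta> e x y + \<theta> e e (x \<star> y)) = 2 * (3 * \<theta> e e x * \<theta> e e y)"
    using full_linearization[of e e x e e y] assms
      \<theta>_sym1[of x e y] \<theta>_sym2[of e y x] \<theta>_sym2[of e "x \<star> y" e] \<theta>_cycle[of "x \<star> y" e e]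
      \<theta>_sym1[of y e x]
    by (simp add: algebra_simps)
  then have "2 * \<theta> e x y + \<theta> e e (x \<star> y) = 3 * \<theta> e e x * \<theta> e e y"
    by (rule mult_left_cancel[OF two, THEN iffD1])
  then have "3 * (2 * \<theta> e x y + \<theta> e e (x \<star> y)) = 3 * (3 * \<theta> e e x * \<theta> e e y)"
    by simp
  then show ?thesis by (simp add: T_def algebra_simps)
qed

lemma T_commute: "x \<in> V \<Longrightarrow> y \<in> V \<Longrightarrow> T (x \<star> y) = T (y \<star> x)"
  using T_mul[of x y] T_mul[of y x] \<theta>_sym2[of e x y] by (simp add: mult.commute)

lemma \<theta>_left_product:
  assumes "u \<in> V" "w \<in> V" "z \<in> V"
  shows "\<theta> w u z + \<theta> (u \<star> w) e z + \<theta> (z \<star> w) e u = 3 * \<theta> e u z * \<theta> e e w"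
proof -
  have "2 * (\<theta> w u z + \<theta> (u \<star> w) e z + \<theta> (z \<star> w) e u) = 2 * (3 * \<theta> e u z * \<theta> e e w)"
    using full_linearization[of e u z w e e] assms
      \<theta>_sym2[of w u z] \<theta>_sym2[of "u \<star> w" e z] \<theta>_sym2[of "z \<star> w" e u] \<theta>_cycle[of w e e]
    by (simp add: algebra_simps)
  then show ?thesis by (rule mult_left_cancel[OF two, THEN iffD1])
qed

end

context cubic_algebra begin

lemma \<theta>_right_product:
  assumes "u \<in> V" "w \<in> V" "z \<in> V"
  shows "\<theta> w u z + \<theta> (w \<star> u) e z + \<theta> (w \<star> z) e u = 3 * \<theta> e u z * \<theta> e e w"
proof -
  interpret op: cubic_algebra scale V "\<lambda>x y. y \<star> x" \<theta> e by (rule opposite)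
  show ?thesis using op.\<theta>_left_product[OF assms] by simp
qed

lemma T_product_swap:
  assumes "u \<in> V" "w \<in> V" "z \<in> V"
  shows "T ((u \<star> w) \<star> z) + T ((z \<star> w) \<star> u)
      = 2 * T u * T w * T z - 6 * \<theta> e u w * T z - 6 * \<theta> e w z * T u - 6 * \<theta> e u z * T w + 6 * \<theta> u w z"
    (is ?left)
    and "T ((w \<star> u) \<star> z) + T ((w \<star> z) \<star> u)
      = 2 * T u * T w * T z - 6 * \<theta> e u w * T z - 6 * \<theta> e w z * T u - 6 * \<theta> e u z * T w + 6 * \<theta> u w z"
    (is ?right)
proof -
  have s: "\<theta> e z w = \<theta> e w z" "\<theta> e w u = \<theta> e u w" "\<theta> w u z = \<theta> u w z"
    "\<theta> e (u \<star> w) z = \<theta> (u \<star> w) e z" "\<theta> e (z \<star> w) u = \<theta> (z \<star> w) e u"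
    "\<theta> e (w \<star> u) z = \<theta> (w \<star> u) e z" "\<theta> e (w \<star> z) u = \<theta> (w \<star> z) e u" "T w = 3 * \<theta> e e w"
    by (auto simp: T_def intro: \<theta>_sym1 \<theta>_sym2)
  show ?left
    using \<theta>_left_product[OF assms] assms
    by (simp only: T_mul mul_V s) Groebner_Basis.algebra
  show ?right
    using \<theta>_right_product[OF assms] assms
    by (simp only: T_mul mul_V s) Groebner_Basis.algebra
qed

text \<open>Both identities of \<open>T_product_swap\<close> have the same right side, and it is
  symmetric in the three arguments. Written for \<open>u, w, z\<close> and for
  \<open>w, z, u\<close> they share the term \<open>T ((z \<star> w) \<star> u)\<close>. Together
  with \<open>T_commute\<close> this makes the trace form associative while the product is not yet
  known to be.\<close>

lemma T_cycle:
  assumes "u \<in> V" "w \<in> V" "z \<in> V"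
  shows "T ((u \<star> w) \<star> z) = T ((z \<star> u) \<star> w)"
proof -
  have s: "\<theta> w z u = \<theta> u w z" "\<theta> e w u = \<theta> e u w" "\<theta> e z u = \<theta> e u z"
    by (metis \<theta>_cycle, (rule \<theta>_sym2)+)
  have "T ((u \<star> w) \<star> z) + T ((z \<star> w) \<star> u) = T ((z \<star> w) \<star> u) + T ((z \<star> u) \<star> w)"
    unfolding T_product_swap(1)[OF assms] T_product_swap(2)[OF assms(2,3,1)] s
    by (simp add: algebra_simps)
  then show ?thesis by simp
qed

lemma T_assoc:
  assumes "u \<in> V" "w \<in> V" "z \<in> V"
  shows "T ((u \<star> w) \<star> z) = T (u \<star> (w \<star> z))"
  using T_cycle[of u w z] T_cycle[of z u w] T_commute[of u "w \<star> z"] assms by simp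

lemma S_eq: "x \<in> V \<Longrightarrow> 2 * S x = T x * T x - T (x \<star> x)"
  by (simp add: T_mul S_def)

text \<open>The right side is the derivative of \<open>N\<close> at \<open>x\<close> in direction
  \<open>y\<close>: the adjoint is the gradient of the norm for the trace form.\<close>

lemma T_sharp:
  assumes "x \<in> V" "y \<in> V"
  shows "T (sharp x \<star> y) = 3 * \<theta> x x y"
proof -
  have "2 * T ((x \<star> x) \<star> y) = 2 * (T x * T y * T x - 6 * \<theta> e x y * T x - 3 * \<theta> e x x * T y + 3 * \<theta> x x y)"
    using T_product_swap(1)[of x y x] T_cycle[of x y x] assms \<theta>_sym2[of e y x] \<theta>_sym2[of x y x]
    by (simp add: algebra_simps)
  then have "T ((x \<star> x) \<star> y) = T x * T y * T x - 6 * \<theta> e x y * T x - 3 * \<theta> e x x * T y + 3 * \<theta> x x y"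
    by (rule mult_left_cancel[OF two, THEN iffD1])
  then show ?thesis
    using assms by (simp add: sharp_def mul_linear T_linear T_mul S_def algebra_simps)
qed

text \<open>If \<open>z\<close> is orthogonal to everything, then \<open>T_sharp\<close> gives
  \<open>\<theta> z x x = 0\<close> for all \<open>x\<close>, and polarization leads to
  \<open>nondeg\<close>. From here on, elements are compared by pairing them with an arbitrary
  \<open>v\<close> under \<open>T\<close>.\<close>

lemma T_nondegenerate:
  assumes "z \<in> V" "\<And>y. y \<in> V \<Longrightarrow> T (z \<star> y) = 0"
  shows "z = 0"
proof -
  have diag: "\<theta> z x x = 0" if "x \<in> V" for x
  proof -
    have "3 * \<theta> z x x = 0"
      using T_sharp[of x z] T_commute[of "sharp x" z] assms that \<theta>_cycle[of z x x] by simp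
    then show ?thesis by simp
  qed
  show ?thesis
  proof (rule nondeg[OF assms(1)])
    fix x y assume "x \<in> V" "y \<in> V"
    then have "2 * \<theta> z x y = 0"
      using diag[of "x + y"] diag[of x] diag[of y] \<theta>_sym2[of z y x] by (simp add: \<theta>_linear)
    then show "\<theta> z x y = 0" by simp
  qed
qed

lemma eqI_T:
  assumes "x \<in> V" "y \<in> V" "\<And>v. v \<in> V \<Longrightarrow> T (x \<star> v) = T (y \<star> v)"
  shows "x = y"
  using T_nondegenerate[of "x - y"] assms by (simp add: mul_linear T_linear)

lemma sharp_mul:
  assumes "x \<in> V"
  shows "sharp x \<star> x = N x *s e"
proof (rule eqI_T)
  fix v assume v: "v \<in> V"
  have "\<theta> x x (x \<star> v) = N x * \<theta> e e v"
    using composition_trilinear[of x e e v] assms v by (simp add: N_def)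
  then show "T ((sharp x \<star> x) \<star> v) = T ((N x *s e) \<star> v)"
    using assms v by (simp add: T_assoc T_sharp T_linear) (simp add: T_def)
qed (use assms in auto)

text \<open>Up to the factor \<open>N x\<close>, left multiplication by the adjoint inverts left
  multiplication by \<open>x\<close>, still without associativity. The only unknown trilinear value
  comes from \<open>full_linearization\<close> at \<open>x, x, x \<star> w\<close> against
  \<open>e, e, v\<close>.\<close>

lemma sharp_left:
  assumes "x \<in> V" "w \<in> V"
  shows "sharp x \<star> (x \<star> w) = N x *s w"
proof (rule eqI_T)
  fix v assume v: "v \<in> V"
  have 1: "\<theta> x (x \<star> w) (x \<star> v) = N x * \<theta> e w v" "\<theta> x x (x \<star> w) = N x * \<theta> e e w"
    using composition_trilinear[of x e w v] composition_trilinear[of x e e w] assms v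
    by (simp_all add: N_def)
  have "2 * (\<theta> x x ((x \<star> w) \<star> v) + 2 * \<theta> x (x \<star> w) (x \<star> v)) = 2 * (3 * \<theta> x x (x \<star> w) * \<theta> e e v)"
    using full_linearization[of x x "x \<star> w" e e v] assms v \<theta>_sym1[of "x \<star> w" x "x \<star> v"]
    by (simp add: algebra_simps)
  then have "\<theta> x x ((x \<star> w) \<star> v) + 2 * \<theta> x (x \<star> w) (x \<star> v) = 3 * \<theta> x x (x \<star> w) * \<theta> e e v"
    by (rule mult_left_cancel[OF two, THEN iffD1])
  then have 2: "\<theta> x x ((x \<star> w) \<star> v) = 3 * (N x * \<theta> e e w) * \<theta> e e v - 2 * (N x * \<theta> e w v)"
    unfolding 1 by Groebner_Basis.algebra
  have "T ((sharp x \<star> (x \<star> w)) \<star> v) = 3 * \<theta> x x ((x \<star> w) \<star> v)"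
    using assms v by (simp add: T_assoc T_sharp)
  also have "\<dots> = N x * T (w \<star> v)"
    using assms v unfolding 2 by (simp add: T_mul) (simp add: T_def algebra_simps)
  finally show "T ((sharp x \<star> (x \<star> w)) \<star> v) = T ((N x *s w) \<star> v)"
    by (simp add: T_linear)
qed (use assms in auto)

text \<open>The quadratic part in \<open>x\<close> of \<open>sharp_left\<close>, evaluated at \<open>e + x\<close>.\<close>

lemma left_alternative:
  assumes x: "x \<in> V" and w: "w \<in> V"
  shows "x \<star> (x \<star> w) = (x \<star> x) \<star> w"
proof (rule eqI_T)
  fix v assume v: "v \<in> V"
  have t: "T (x + e) = T x + 3" "S (x + e) = S x + 2 * T x + 3" "N (x + e) = N x + S x + T x + 1"
    using \<theta>_sym1[of x e e] \<theta>_sym2[of e x e] \<theta>_cycle[of x x e] \<theta>_sym1[of x e x]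
    by (simp_all add: T_linear S_def N_def \<theta>_linear) (simp_all add: T_def algebra_simps)
  have a: "T (((x \<star> x) \<star> (x \<star> w)) \<star> v) - T x * T ((x \<star> (x \<star> w)) \<star> v) + S x * T ((x \<star> w) \<star> v)
     = N x * T (w \<star> v)"
    using arg_cong[OF sharp_left[OF x w], of "\<lambda>z. T (z \<star> v)"] x w v
    by (simp add: sharp_def mul_linear T_linear)
  have "T ((sharp (x + e) \<star> ((x + e) \<star> w)) \<star> v) = N (x + e) * T (w \<star> v)"
    using sharp_left[of "x + e" w] x w by (simp add: T_linear)
  then have "T (((x \<star> x) \<star> (x \<star> w)) \<star> v) + 2 * T ((x \<star> (x \<star> w)) \<star> v) + T ((x \<star> w) \<star> v)
      + T (((x \<star> x) \<star> w) \<star> v) + 2 * T ((x \<star> w) \<star> v) + T (w \<star> v)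
      - (T x + 3) * (T ((x \<star> (x \<star> w)) \<star> v) + 2 * T ((x \<star> w) \<star> v) + T (w \<star> v))
      + (S x + 2 * T x + 3) * (T ((x \<star> w) \<star> v) + T (w \<star> v))
     = (N x + S x + T x + 1) * T (w \<star> v)"
    unfolding sharp_def t using x w by (simp add: mul_linear T_linear algebra_simps)
  with a show "T ((x \<star> (x \<star> w)) \<star> v) = T (((x \<star> x) \<star> w) \<star> v)"
    by Groebner_Basis.algebra
qed (use assms in auto)

lemma sharp_right:
  assumes "x \<in> V" "w \<in> V"
  shows "(w \<star> x) \<star> sharp x = N x *s w"
proof -
  interpret op: cubic_algebra scale V "\<lambda>x y. y \<star> x" \<theta> e by (rule opposite)
  show ?thesis
    using op.sharp_left[OF assms]
    by (simp add: sharp_def op.sharp_def T_def op.T_def S_def op.S_def N_def op.N_def)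
qed

lemma right_alternative:
  assumes "x \<in> V" "w \<in> V"
  shows "(w \<star> x) \<star> x = w \<star> (x \<star> x)"
proof -
  interpret op: cubic_algebra scale V "\<lambda>x y. y \<star> x" \<theta> e by (rule opposite)
  show ?thesis using op.left_alternative[OF assms] .
qed

lemma mul_sharp: "x \<in> V \<Longrightarrow> x \<star> sharp x = N x *s e"
  using sharp_right[of x e] by simp

text \<open>It serves to find singular vectors: if \<open>N v = 0\<close>, the adjoint of
  \<open>v\<close> has adjoint zero.\<close>

lemma sharp_sharp:
  assumes "v \<in> V"
  shows "sharp (sharp v) = N v *s v"
proof -
  let ?z = "sharp v"
  have "?z \<star> ?z = (v \<star> v) \<star> ?z - T v *s (v \<star> ?z) + S v *s ?z"
    using assms by (subst (1) sharp_def) (simp add: mul_linear)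
  also have "(v \<star> v) \<star> ?z = N v *s v"
    using left_alternative[of v ?z] mul_sharp[of v] assms by simp
  finally have zz: "?z \<star> ?z = N v *s v - (T v * N v) *s e + S v *s ?z"
    using assms by (simp add: mul_sharp)
  have Tz: "T ?z = S v"
    using S_eq[OF assms] by (simp add: sharp_def T_linear algebra_simps) 
  have "2 * S ?z = 2 * (T v * N v)"
    using S_eq[of ?z] assms unfolding zz Tz by (simp add: T_linear Tz algebra_simps)
  then have "S ?z = T v * N v"
    by (rule mult_left_cancel[OF two, THEN iffD1])
  then show ?thesis
    by (subst sharp_def) (simp add: zz Tz algebra_simps)
qed

lemma e_nonzero: "e \<noteq> 0"
  using \<theta>_e \<theta>_zero(1)[of e e] by (metis zero_neq_one)

text \<open>A singular vector \<open>u\<close> makes \<open>N\<close> affine and non-constant along some line \<open>w + t u\<close>.\<close>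

lemma isotropic_universal:
  assumes "v \<in> V" "v \<noteq> 0" "N v = 0"
  shows "\<exists>x\<in>V. N x = c"
proof -
  \<comment> \<open>If \<open>sharp v = 0\<close>, take \<open>v\<close> itself, and otherwise take
    \<open>sharp v\<close>.\<close>
  obtain u where u: "u \<in> V" "u \<noteq> 0" "sharp u = 0"
    using assms sharp_sharp[of v] by (metis scale_zero_left sharp_V)
  have "N u = 0"
    using sharp_mul[OF u(1)] e_nonzero by (simp add: u)
  have uu: "\<theta> u u y = 0" if "y \<in> V" for y
    using T_sharp[OF u(1) that] u by (simp add: T_linear)
  obtain w where w: "w \<in> V" "\<theta> u w w \<noteq> 0"
  proof (rule ccontr)
    assume "\<not> thesis"
    then have diag: "\<theta> u x x = 0" if "x \<in> V" for x using that \<open>\<And>w. w \<in> V \<Longrightarrow> \<theta> u w w \<noteq> 0 \<Longrightarrow> thesis\<close> by blast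
    have "u = 0"
    proof (rule nondeg[OF u(1)])
      fix x y assume "x \<in> V" "y \<in> V"
      then have "2 * \<theta> u x y = 0"
        using diag[of "x + y"] diag[of x] diag[of y] \<theta>_sym2[of u y x] by (simp add: \<theta>_linear)
      then show "\<theta> u x y = 0" by simp
    qed
    with u show False by simp
  qed
  have line: "N (w + t *s u) = N w + t * (3 * \<theta> u w w)" for t
    using uu[OF w(1)] uu[OF u(1)] \<theta>_cycle[of w u u] \<theta>_cycle[of w w u] \<theta>_sym1[of w u w] \<theta>_sym2[of u w u]
    by (simp add: N_def \<theta>_linear algebra_simps)
  have "N (w + ((c - N w) / (3 * \<theta> u w w)) *s u) = c"
    unfolding line using w by simp
  then show ?thesis using u w by blast
qed

text \<open>The polarization \<open>sharp (x + y) - sharp x - sharp y\<close>; on the diagonal it is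
  twice the adjoint.\<close>

definition polar_sharp :: "'v \<Rightarrow> 'v \<Rightarrow> 'v" where
  "polar_sharp x y = x \<star> y + y \<star> x - T x *s y - T y *s x + (6 * \<theta> e x y) *s e"

lemma T_polar_sharp:
  assumes "x \<in> V" "y \<in> V" "v \<in> V"
  shows "T (polar_sharp x y \<star> v) = 6 * \<theta> x y v"
proof -
  have "polar_sharp x y = sharp (x + y) - sharp x - sharp y"
    using \<theta>_sym2[of e y x]
    by (simp add: polar_sharp_def sharp_def mul_linear T_linear S_def \<theta>_linear algebra_simps)
  then have "T (polar_sharp x y \<star> v) = 3 * \<theta> (x + y) (x + y) v - 3 * \<theta> x x v - 3 * \<theta> y y v"
    using assms by (simp add: mul_linear T_linear T_sharp)
  then show ?thesis
    using \<theta>_sym1[of y x v] by (simp add: \<theta>_linear algebra_simps)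
qed

lemma polar_sharp_V [simp, intro]: "x \<in> V \<Longrightarrow> y \<in> V \<Longrightarrow> polar_sharp x y \<in> V"
  by (simp add: polar_sharp_def)

text \<open>The full linearization of \<open>sharp x \<star> x = N x *s e\<close>. Being trilinear,
  it can be transferred to other rings of scalars by evaluation on a basis. On the diagonal it reads
  3 times \<open>polar_sharp x x \<star> x\<close> equals \<open>6 * N x\<close> times the
  unit.\<close>

lemma polar_sharp_mul:
  assumes "x \<in> V" "y \<in> V" "z \<in> V"
  shows "polar_sharp x y \<star> z + polar_sharp y z \<star> x + polar_sharp z x \<star> y = (6 * \<theta> x y z) *s e"
proof (rule eqI_T)
  fix v assume v: "v \<in> V"
  have "2 * (\<theta> x y (z \<star> v) + \<theta> y z (x \<star> v) + \<theta> z x (y \<star> v)) = 2 * (3 * \<theta> x y z * \<theta> e e v)"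
    using full_linearization[of x y z e e v] assms v
      \<theta>_sym1[of y x "z \<star> v"] \<theta>_sym1[of z y "x \<star> v"] \<theta>_sym1[of x z "y \<star> v"]
    by (simp add: algebra_simps)
  then have "\<theta> x y (z \<star> v) + \<theta> y z (x \<star> v) + \<theta> z x (y \<star> v) = 3 * \<theta> x y z * \<theta> e e v"
    by (rule mult_left_cancel[OF two, THEN iffD1])
  then have "6 * \<theta> x y (z \<star> v) + 6 * \<theta> y z (x \<star> v) + 6 * \<theta> z x (y \<star> v) = 6 * \<theta> x y z * T v"
    unfolding T_def by Groebner_Basis.algebra
  then show "T ((polar_sharp x y \<star> z + polar_sharp y z \<star> x + polar_sharp z x \<star> y) \<star> v)
      = T (((6 * \<theta> x y z) *s e) \<star> v)"
    using assms v by (simp add: mul_linear T_linear T_assoc T_polar_sharp)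
qed (use assms in auto)

end

section \<open>Associativity of anisotropic cubic algebras\<close>

context cubic_algebra begin

definition assoc :: "'v \<Rightarrow> 'v \<Rightarrow> 'v \<Rightarrow> 'v" where
  "assoc x y z = (x \<star> y) \<star> z - x \<star> (y \<star> z)"

lemma assoc_V [simp, intro]: "assoc x y z \<in> V"
  by (simp add: assoc_def)

lemma assoc_linear:
  "assoc (x + x') y z = assoc x y z + assoc x' y z" "assoc (x - x') y z = assoc x y z - assoc x' y z"
  "assoc x (y + y') z = assoc x y z + assoc x y' z" "assoc x (y - y') z = assoc x y z - assoc x y' z"
  "assoc x y (z + z') = assoc x y z + assoc x y z'" "assoc x y (z - z') = assoc x y z - assoc x y z'"
  "assoc x y (- z) = - assoc x y z" "assoc x y (c *s z) = c *s assoc x y z"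
  by (simp_all add: assoc_def mul_linear algebra_simps)

lemma assoc_same: "x \<in> V \<Longrightarrow> y \<in> V \<Longrightarrow> assoc x x y = 0" "x \<in> V \<Longrightarrow> y \<in> V \<Longrightarrow> assoc y x x = 0"
  by (simp_all add: assoc_def left_alternative right_alternative)

lemma assoc_swap:
  assumes "x \<in> V" "y \<in> V" "z \<in> V"
  shows "assoc x y z = - assoc y x z" "assoc x y z = - assoc x z y"
  using assoc_same(1)[of "x + y" z] assoc_same(1)[of x z] assoc_same(1)[of y z]
    assoc_same(2)[of "y + z" x] assoc_same(2)[of y x] assoc_same(2)[of z x] assms
  by (simp_all add: assoc_linear eq_neg_iff_add_eq_0 add.commute)

lemma assoc_cycle: "x \<in> V \<Longrightarrow> y \<in> V \<Longrightarrow> z \<in> V \<Longrightarrow> assoc x y z = assoc y z x"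
  using assoc_swap(1)[of x y z] assoc_swap(2)[of y x z] by simp

lemma Teichmueller:
  "assoc (w \<star> x) y z - assoc w (x \<star> y) z + assoc w x (y \<star> z) = w \<star> assoc x y z + assoc w x y \<star> z"
  by (simp add: assoc_def mul_linear)

text \<open>The Teichmueller identity with \<open>x\<close> repeated expresses the associator of
  \<open>x \<star> x, y, z\<close> in several ways; in an alternative algebra the two that contain
  \<open>assoc x y (z \<star> x)\<close> differ exactly by the claim.\<close>

lemma assoc_mul_left:
  assumes "x \<in> V" "y \<in> V" "z \<in> V"
  shows "assoc x (x \<star> y) z = assoc x y z \<star> x"
proof -
  have c: "assoc (x \<star> x) y z = assoc x (x \<star> y) z + x \<star> assoc x y z"
    using Teichmueller[of x x y z] assms by (simp add: assoc_same diff_eq_eq add.commute)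
  have "assoc y z (x \<star> x) = assoc y (z \<star> x) x + assoc y z x \<star> x"
    using Teichmueller[of y z x x] assms by (simp add: assoc_same diff_eq_eq algebra_simps)
  then have c': "assoc (x \<star> x) y z = assoc x y (z \<star> x) + assoc x y z \<star> x"
    using assoc_cycle[of "x \<star> x" y z] assoc_cycle[of x y "z \<star> x"] assoc_cycle[of x y z] assms by simp
  have "assoc (z \<star> x) x y - assoc z (x \<star> x) y + assoc z x (x \<star> y) = 0"
    using Teichmueller[of z x x y] assms by (simp add: assoc_same)
  moreover have "assoc z (x \<star> x) y = assoc (x \<star> x) y z"
    using assoc_cycle[of z "x \<star> x" y] assms by simp
  moreover have "assoc (z \<star> x) x y = assoc x y (z \<star> x)" "assoc z x (x \<star> y) = assoc x (x \<star> y) z"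
    using assoc_cycle[of "z \<star> x" x y] assoc_cycle[of z x "x \<star> y"] assms by simp_all
  ultimately have "assoc (x \<star> x) y z = assoc x y (z \<star> x) + assoc x (x \<star> y) z"
    by (simp add: algebra_simps)
  with c' show ?thesis by simp
qed

lemma assoc_mul_right:
  assumes "x \<in> V" "y \<in> V" "z \<in> V"
  shows "assoc x y (x \<star> z) = assoc x y z \<star> x" "assoc x y (y \<star> z) = assoc x y z \<star> y"
proof -
  show "assoc x y (x \<star> z) = assoc x y z \<star> x"
    using assoc_swap(2)[of x y "x \<star> z"] assoc_swap(2)[of x y z] assoc_mul_left[of x z y] assms by simp
  show "assoc x y (y \<star> z) = assoc x y z \<star> y"
    using assoc_cycle[of x y "y \<star> z"] assoc_cycle[of x y z] assoc_mul_left[of y z x] assms by simp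
qed

text \<open>The operator \<open>assoc x y\<close> turns left multiplication by \<open>x\<close> or
  \<open>y\<close> into right multiplication by the same element, so two applications reverse the
  order of a product. The correction terms are both \<open>assoc x y\<close> of the associator
  itself and cancel.\<close>

lemma assoc_mul_product:
  assumes xyz: "x \<in> V" "y \<in> V" "z \<in> V"
  shows "assoc x y ((x \<star> y) \<star> z) = assoc x y z \<star> (y \<star> x)"
    and "assoc x y ((y \<star> x) \<star> z) = assoc x y z \<star> (x \<star> y)"
proof -
  let ?u = "assoc x y z"
  have "assoc x y ((x \<star> y) \<star> z) = assoc x y ?u + (?u \<star> y) \<star> x"
    using xyz by (subst (2) assoc_def) (simp add: assoc_linear assoc_mul_right)
  also have "(?u \<star> y) \<star> x = ?u \<star> (y \<star> x) + assoc ?u y x"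
    by (simp add: assoc_def)
  also have "assoc ?u y x = - assoc x y ?u"
    using assoc_cycle[of ?u y x] assoc_swap(1)[of y x ?u] xyz by simp
  finally show "assoc x y ((x \<star> y) \<star> z) = ?u \<star> (y \<star> x)" by simp
  have "(y \<star> x) \<star> z = y \<star> (x \<star> z) - ?u"
    using assoc_swap(1)[of y x z] xyz by (simp add: assoc_def[of y x z] algebra_simps)
  then have "assoc x y ((y \<star> x) \<star> z) = (?u \<star> x) \<star> y - assoc x y ?u"
    using xyz by (simp add: assoc_linear assoc_mul_right)
  also have "(?u \<star> x) \<star> y = ?u \<star> (x \<star> y) + assoc ?u x y"
    by (simp add: assoc_def)
  also have "assoc ?u x y = assoc x y ?u"
    using assoc_cycle[of ?u x y] xyz by simp
  finally show "assoc x y ((y \<star> x) \<star> z) = ?u \<star> (x \<star> y)" by simp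
qed

text \<open>The operator \<open>z \<mapsto> assoc x y z\<close> turns left multiplication by the commutator \<open>w\<close> of \<open>x\<close> and \<open>y\<close>
  into right multiplication by \<open>- w\<close>. As \<open>T w = 0\<close>, the cubic equations of \<open>w\<close> and \<open>- w\<close> force \<open>N w = 0\<close>.\<close>

lemma assoc_nonzero_commute:
  assumes aniso: "\<And>v. v \<in> V \<Longrightarrow> N v = 0 \<Longrightarrow> v = 0"
    and xyz: "x \<in> V" "y \<in> V" "z \<in> V" and nz: "assoc x y z \<noteq> 0"
  shows "x \<star> y = y \<star> x"
proof -
  define w where "w = x \<star> y - y \<star> x"
  define u where "u = assoc x y z"
  have V: "w \<in> V" "u \<in> V" by (simp_all add: w_def u_def)
  have flip: "assoc x y (w \<star> a) = - (assoc x y a \<star> w)" if "a \<in> V" for a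
    using xyz that by (simp add: w_def mul_linear assoc_linear assoc_mul_product)
  have Tw: "T w = 0"
    using xyz by (simp add: w_def T_linear T_commute)
  have "w \<star> (w \<star> (w \<star> z)) = N w *s z - S w *s (w \<star> z)"
    using sharp_left[of w z] V xyz left_alternative[of w "w \<star> z"]
    by (simp add: sharp_def Tw mul_linear algebra_simps)
  \<comment> \<open>Three flips turn the cubic equation of \<open>w\<close> into one for the cube of
    right multiplication by \<open>w\<close>, with sign -1. Compared with the equation from
    \<open>sharp_right\<close>, the \<open>S\<close> terms agree and twice the \<open>N\<close> term
    is left.\<close>
  then have "assoc x y (w \<star> (w \<star> (w \<star> z))) = N w *s u + S w *s (u \<star> w)"
    using xyz by (simp add: assoc_linear flip u_def)
  then have "- (((u \<star> w) \<star> w) \<star> w) = N w *s u + S w *s (u \<star> w)"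
    using V xyz by (simp add: flip u_def)
  moreover have "((u \<star> w) \<star> w) \<star> w = N w *s u - S w *s (u \<star> w)"
    using sharp_right[of w u] V right_alternative[of w "u \<star> w"]
    by (simp add: sharp_def Tw mul_linear algebra_simps)
  ultimately have "- (N w *s u - S w *s (u \<star> w)) = N w *s u + S w *s (u \<star> w)"
    by simp
  then have "N w *s u + N w *s u = 0"
    by (simp add: neg_eq_iff_add_eq_0)
  then have "(2 * N w) *s u = 0"
    by (metis scale_left_distrib mult_2)
  then have "N w = 0"
    using nz by (simp add: u_def)
  then have "w = 0" using aniso V by blast
  then show ?thesis by (simp add: w_def)
qed

text \<open>The complement of a proper subspace spans, so a single nonzero associator makes every
  two elements commute, and commutativity forces three times an associator to vanish.\<close>

lemma anisotropic_associative:
  assumes aniso: "\<And>v. v \<in> V \<Longrightarrow> N v = 0 \<Longrightarrow> v = 0"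
    and xyz: "x \<in> V" "y \<in> V" "z \<in> V"
  shows "(x \<star> y) \<star> z = x \<star> (y \<star> z)"
proof (rule ccontr)
  assume "(x \<star> y) \<star> z \<noteq> x \<star> (y \<star> z)"
  then have nz: "assoc x y z \<noteq> 0" by (simp add: assoc_def)
  have central: "a \<star> q = q \<star> a" if "p \<in> V" "q \<in> V" "r \<in> V" "assoc p q r \<noteq> 0" "a \<in> V" for p q r a
  proof (cases "assoc a q r = 0")
    case False
    then show ?thesis by (intro assoc_nonzero_commute[OF aniso, of a q r]) (use that in auto)
  next
    case True
    then have "assoc (a + p) q r \<noteq> 0" using that by (simp add: assoc_linear)
    then have "(a + p) \<star> q = q \<star> (a + p)"
      by (intro assoc_nonzero_commute[OF aniso, of "a + p" q r]) (use that in auto)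
    moreover have "p \<star> q = q \<star> p"
      by (intro assoc_nonzero_commute[OF aniso, of p q r]) (use that in auto)
    ultimately show ?thesis by (simp add: mul_linear)
  qed
  have cyc: "assoc z x y \<noteq> 0" if "assoc x y z \<noteq> 0" "x \<in> V" for x
    using assoc_cycle[of z x y] that xyz by simp
  have comm: "a \<star> b = b \<star> a" if "a \<in> V" "b \<in> V" for a b
  proof (cases "assoc b y z = 0")
    case False
    then show ?thesis using central[of z b y a] cyc[of b] that xyz by simp
  next
    case True
    then have "assoc (b + x) y z \<noteq> 0" using nz by (simp add: assoc_linear)
    then have "a \<star> (b + x) = (b + x) \<star> a"
      using central[of z "b + x" y a] cyc[of "b + x"] that xyz by simp
    moreover have "a \<star> x = x \<star> a"
      using central[of z x y a] cyc[of x] nz that xyz by simp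
    ultimately show ?thesis by (simp add: mul_linear)
  qed
  \<comment> \<open>Under commutativity the six products cancel in pairs, for instance
    \<open>(x \<star> y) \<star> z\<close> against \<open>z \<star> (x \<star> y)\<close>. The three
    associators are equal, so a single one vanishes after division by 3.\<close>
  have "assoc x y z + assoc y z x + assoc z x y = 0"
    using comm[of x "y \<star> z"] comm[of y "z \<star> x"] comm[of z "x \<star> y"] xyz
    by (simp add: assoc_def)
  then have "assoc x y z + assoc x y z + assoc x y z = 0"
    using assoc_cycle[OF xyz] assoc_cycle[OF xyz(3,1,2)] by metis
  then have "(1 + 1 + 1) *s assoc x y z = 0"
    by (metis scale_left_distrib scale_one)
  moreover have "(1 + 1 + 1 :: 'f) \<noteq> 0"
    using three by simp
  ultimately show False using nz by simp
qed

end

section \<open>Evaluation of polynomials\<close>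

definition monom_value :: "(nat \<Rightarrow> 'r::comm_ring_1) \<Rightarrow> (nat \<Rightarrow>\<^sub>0 nat) \<Rightarrow> 'r" where
  "monom_value r m = (\<Prod>i\<in>Poly_Mapping.keys m. r i ^ Poly_Mapping.lookup m i)"

lemma monom_value_superset:
  assumes "finite A" "Poly_Mapping.keys m \<subseteq> A"
  shows "monom_value r m = (\<Prod>i\<in>A. r i ^ Poly_Mapping.lookup m i)"
  unfolding monom_value_def
  by (rule prod.mono_neutral_left) (use assms in \<open>auto simp: in_keys_iff\<close>)

lemma monom_value_add: "monom_value r (m + m') = monom_value r m * monom_value r m'"
proof -
  let ?A = "Poly_Mapping.keys m \<union> Poly_Mapping.keys m'"
  have "Poly_Mapping.keys (m + m') \<subseteq> ?A" by (rule keys_add)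
  then show ?thesis
    by (simp add: monom_value_superset[of ?A] lookup_add power_add prod.distrib)
qed

lemma monom_value_zero [simp]: "monom_value r 0 = 1"
  by (simp add: monom_value_def)

lemma monom_value_single [simp]: "monom_value r (Poly_Mapping.single i k) = r i ^ k"
  by (simp add: monom_value_def)

lemma subst_mpoly_monom_value:
  "subst_mpoly \<iota> r p = (\<Sum>m\<in>Poly_Mapping.keys p. \<iota> (Poly_Mapping.lookup p m) * monom_value r m)"
  by (simp add: subst_mpoly_def monom_value_def)

lemma monom_value_subst: "f (monom_value r m) = monom_value (\<lambda>i. f (r i)) m"
  if "comm_ring_hom f" for f
proof -
  interpret comm_ring_hom f by fact
  show ?thesis by (simp add: monom_value_def hom_prod hom_power)
qed

context comm_ring_hom begin

lemma subst_mpoly_superset: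
  assumes "finite A" "Poly_Mapping.keys p \<subseteq> A"
  shows "subst_mpoly hom r p = (\<Sum>m\<in>A. hom (Poly_Mapping.lookup p m) * monom_value r m)"
  unfolding subst_mpoly_monom_value
  by (rule sum.mono_neutral_left) (use assms in \<open>auto simp: in_keys_iff\<close>)

lemma subst_mpoly_add: "subst_mpoly hom r (p + q) = subst_mpoly hom r p + subst_mpoly hom r q"
proof -
  let ?A = "Poly_Mapping.keys p \<union> Poly_Mapping.keys q"
  have "Poly_Mapping.keys (p + q) \<subseteq> ?A" by (rule keys_add)
  then show ?thesis
    by (simp add: subst_mpoly_superset[of ?A] lookup_add hom_add distrib_right sum.distrib)
qed

lemma subst_mpoly_zero [simp]: "subst_mpoly hom r 0 = 0"
  by (simp add: subst_mpoly_def)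

lemma subst_mpoly_sum: "subst_mpoly hom r (\<Sum>i\<in>A. p i) = (\<Sum>i\<in>A. subst_mpoly hom r (p i))"
  by (induction A rule: infinite_finite_induct) (simp_all add: subst_mpoly_add)

lemma subst_mpoly_single [simp]:
  "subst_mpoly hom r (Poly_Mapping.single m c) = hom c * monom_value r m"
  by (cases "c = 0") (simp_all add: subst_mpoly_monom_value)

lemma subst_mpoly_mult: "subst_mpoly hom r (p * q) = subst_mpoly hom r p * subst_mpoly hom r q"
proof -
  have dec: "p = (\<Sum>m\<in>Poly_Mapping.keys p. Poly_Mapping.single m (Poly_Mapping.lookup p m))"
    for p :: "'a mpoly"
    by (rule poly_mapping_eqI) (simp add: lookup_sum lookup_single when_def in_keys_iff)
  have "subst_mpoly hom r (p * q) = subst_mpoly hom r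
     ((\<Sum>m\<in>Poly_Mapping.keys p. Poly_Mapping.single m (Poly_Mapping.lookup p m)) *
      (\<Sum>m\<in>Poly_Mapping.keys q. Poly_Mapping.single m (Poly_Mapping.lookup q m)))"
    using dec by metis
  also have "\<dots> = subst_mpoly hom r p * subst_mpoly hom r q"
    unfolding sum_product mult_single subst_mpoly_sum subst_mpoly_single monom_value_add hom_mult
    unfolding subst_mpoly_monom_value sum_product
    by (simp add: ac_simps)
  finally show ?thesis .
qed

lemma comm_ring_hom_subst_mpoly: "comm_ring_hom (subst_mpoly hom r)"
proof
  show "subst_mpoly hom r 1 = 1"
    by (metis hom_one monom_value_zero mult_1 single_one subst_mpoly_single)
qed (simp_all add: subst_mpoly_add subst_mpoly_mult)

lemma subst_mpoly_mvar [simp]: "subst_mpoly hom r (mvar i) = r i"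
  by (simp add: mvar_def)

lemma subst_mpoly_mconst [simp]: "subst_mpoly hom r (mconst c) = hom c"
  by (simp add: mconst_def)

end

lemma digits_inj:
  fixes f g :: "nat \<Rightarrow> nat"
  assumes "\<And>i. f i < B" "\<And>i. g i < B" "(\<Sum>i<k. f i * B ^ i) = (\<Sum>i<k. g i * B ^ i)" "i < k"
  shows "f i = g i"
  using assms
proof (induction k arbitrary: f g i)
  case (Suc k)
  have s: "(\<Sum>i<Suc k. h i * B ^ i) = h 0 + B * (\<Sum>i<k. h (Suc i) * B ^ i)" for h :: "nat \<Rightarrow> nat"
    unfolding sum.lessThan_Suc_shift by (simp add: sum_distrib_left ac_simps)
  have e: "f 0 + B * (\<Sum>i<k. f (Suc i) * B ^ i) = g 0 + B * (\<Sum>i<k. g (Suc i) * B ^ i)"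
    using Suc.prems(3) unfolding s .
  have 0: "f 0 = g 0"
    using arg_cong[OF e, of "\<lambda>x. x mod B"] Suc.prems(1)[of 0] Suc.prems(2)[of 0] by simp
  with e Suc.prems(1)[of 0] have "(\<Sum>i<k. f (Suc i) * B ^ i) = (\<Sum>i<k. g (Suc i) * B ^ i)"
    by simp
  then have "f (Suc j) = g (Suc j)" if "j < k" for j
    using Suc.IH[of "\<lambda>i. f (Suc i)" "\<lambda>i. g (Suc i)" j] Suc.prems(1,2) that by blast
  with 0 Suc.prems(4) show ?case by (cases i) auto
qed simp

text \<open>For \<open>B\<close> above every exponent, distinct monomials go to distinct powers of
  one variable, because the exponents are digits in base \<open>B\<close>. All \<open>B\<close> are
  allowed in the hypothesis since the suitable one depends on \<open>p\<close>. This reduces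
  polynomial identities in \<open>n\<close> indeterminates to one point over
  \<open>F[t]\<close>.\<close>

lemma Kronecker_substitution:
  fixes p :: "'a::comm_ring_1 mpoly"
  assumes "\<And>B. 2 \<le> B \<Longrightarrow> subst_mpoly (\<lambda>c. [:c:]) (\<lambda>i. Polynomial.monom 1 (B ^ i)) p = 0"
  shows "p = 0"
proof (rule ccontr)
  assume "p \<noteq> 0"
  let ?K = "Poly_Mapping.keys p"
  define U where "U = (\<Union>m\<in>?K. Poly_Mapping.keys m)"
  have finU: "finite U" by (simp add: U_def)
  obtain k where k: "U \<subseteq> {..<k}" using finite_nat_bounded[OF finU] by blast
  \<comment> \<open>The sum of all exponents exceeds or equals each one; the summand 2 makes the
    bound strict and meets the hypothesis on \<open>B\<close>.\<close>
  define B where "B = 2 + (\<Sum>m\<in>?K. \<Sum>i\<in>Poly_Mapping.keys m. Poly_Mapping.lookup m i)"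
  have bound: "Poly_Mapping.lookup m i < B" if m: "m \<in> ?K" for m i
  proof (cases "i \<in> Poly_Mapping.keys m")
    case True
    then have "Poly_Mapping.lookup m i \<le> (\<Sum>i\<in>Poly_Mapping.keys m. Poly_Mapping.lookup m i)"
      by (intro member_le_sum) auto
    also have "\<dots> \<le> (\<Sum>m\<in>?K. \<Sum>i\<in>Poly_Mapping.keys m. Poly_Mapping.lookup m i)"
      using m by (intro member_le_sum[of m ?K "\<lambda>m. \<Sum>i\<in>Poly_Mapping.keys m. Poly_Mapping.lookup m i"]) auto
    finally show ?thesis by (simp add: B_def)
  qed (simp add: in_keys_iff B_def)
  define w where "w m = (\<Sum>i<k. Poly_Mapping.lookup m i * B ^ i)" for m :: "nat \<Rightarrow>\<^sub>0 nat"
  have sub: "Poly_Mapping.keys m \<subseteq> {..<k}" if "m \<in> ?K" for m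
    using that k by (auto simp: U_def)
  have inj: "inj_on w ?K"
  proof (rule inj_onI)
    fix m m' assume m: "m \<in> ?K" "m' \<in> ?K" "w m = w m'"
    show "m = m'"
    proof (rule poly_mapping_eqI)
      fix i
      show "Poly_Mapping.lookup m i = Poly_Mapping.lookup m' i"
      proof (cases "i < k")
        case True
        then show ?thesis
          using digits_inj[of "Poly_Mapping.lookup m" B "Poly_Mapping.lookup m'" k i] m bound
          by (simp add: w_def)
      next
        case False
        then have "i \<notin> Poly_Mapping.keys m" "i \<notin> Poly_Mapping.keys m'"
          using sub[OF m(1)] sub[OF m(2)] by blast+
        then show ?thesis by (simp add: in_keys_iff)
      qed
    qed
  qed
  have mv: "monom_value (\<lambda>i. Polynomial.monom (1::'a) (B ^ i)) m = Polynomial.monom 1 (w m)" if "m \<in> ?K" for m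
  proof -
    have "monom_value (\<lambda>i. Polynomial.monom (1::'a) (B ^ i)) m
      = (\<Prod>i<k. Polynomial.monom 1 (B ^ i) ^ Poly_Mapping.lookup m i)"
      using sub[OF that] by (intro monom_value_superset) auto
    also have "\<dots> = (\<Prod>i<k. Polynomial.monom 1 (Poly_Mapping.lookup m i * B ^ i))"
      by (simp add: monom_power mult.commute)
    also have "\<dots> = Polynomial.monom 1 (w m)"
      unfolding w_def by (induction k) (simp_all add: mult_monom)
    finally show ?thesis .
  qed
  obtain m where m: "m \<in> ?K" using \<open>p \<noteq> 0\<close> by (metis all_not_in_conv keys_eq_empty)
  have "subst_mpoly (\<lambda>c. [:c:]) (\<lambda>i. Polynomial.monom 1 (B ^ i)) p
      = (\<Sum>m'\<in>?K. Polynomial.monom (Poly_Mapping.lookup p m') (w m'))"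
    unfolding subst_mpoly_monom_value by (rule sum.cong) (simp_all add: mv smult_monom)
  then have "(\<Sum>m'\<in>?K. Polynomial.monom (Poly_Mapping.lookup p m') (w m')) = 0"
    using assms[of B] by (simp add: B_def)
  then have "(\<Sum>m'\<in>?K. if w m' = w m then Poly_Mapping.lookup p m' else 0) = 0"
    by (drule_tac arg_cong[of _ _ "\<lambda>q. Polynomial.coeff q (w m)"]) (simp add: coeff_sum)
  also have "(\<Sum>m'\<in>?K. if w m' = w m then Poly_Mapping.lookup p m' else 0) =
      (\<Sum>m'\<in>?K. if m' = m then Poly_Mapping.lookup p m' else 0)"
    by (rule sum.cong) (use inj m in \<open>auto dest: inj_onD\<close>)
  also have "\<dots> = Poly_Mapping.lookup p m" using m by simp
  finally show False using m by (simp add: in_keys_iff)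
qed

section \<open>Extension of scalars\<close>

text \<open>Functions vanishing from \<open>n\<close> on serve as coordinate vectors: addition is
  pointwise on the whole type, and the same indices work over every ring of scalars.\<close>

definition fvecs :: "nat \<Rightarrow> (nat \<Rightarrow> 'r::comm_ring_1) set" where
  "fvecs n = {v. \<forall>i\<ge>n. v i = 0}"

definition fbasis :: "nat \<Rightarrow> nat \<Rightarrow> 'r::comm_ring_1" where
  "fbasis i = (\<lambda>k. if k = i then 1 else 0)"

definition fscale :: "'r::comm_ring_1 \<Rightarrow> (nat \<Rightarrow> 'r) \<Rightarrow> nat \<Rightarrow> 'r" where
  "fscale c v = (\<lambda>i. c * v i)"

text \<open>The structure constants stay in the ground field and enter the ring \<open>'r\<close>
  through \<iota>. Extension of scalars is then a change of \<iota> alone; \<open>trilin\<close> is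
  set up in the same way.\<close>

definition bilin :: "('f \<Rightarrow> 'r::comm_ring_1) \<Rightarrow> nat \<Rightarrow> (nat \<Rightarrow> nat \<Rightarrow> nat \<Rightarrow> 'f) \<Rightarrow>
    (nat \<Rightarrow> 'r) \<Rightarrow> (nat \<Rightarrow> 'r) \<Rightarrow> nat \<Rightarrow> 'r" where
  "bilin \<iota> n c x y = (\<lambda>l. if l < n then \<Sum>i<n. \<Sum>j<n. \<iota> (c l i j) * x i * y j else 0)"

definition trilin :: "('f \<Rightarrow> 'r::comm_ring_1) \<Rightarrow> nat \<Rightarrow> (nat \<Rightarrow> nat \<Rightarrow> nat \<Rightarrow> 'f) \<Rightarrow>
    (nat \<Rightarrow> 'r) \<Rightarrow> (nat \<Rightarrow> 'r) \<Rightarrow> (nat \<Rightarrow> 'r) \<Rightarrow> 'r" where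
  "trilin \<iota> n a x y z = (\<Sum>i<n. \<Sum>j<n. \<Sum>k<n. \<iota> (a i j k) * x i * y j * z k)"

lemma fvecs_closed [simp, intro]:
  "0 \<in> fvecs n" "x \<in> fvecs n \<Longrightarrow> y \<in> fvecs n \<Longrightarrow> x + y \<in> fvecs n"
  "x \<in> fvecs n \<Longrightarrow> y \<in> fvecs n \<Longrightarrow> x - y \<in> fvecs n"
  "x \<in> fvecs n \<Longrightarrow> fscale b x \<in> fvecs n" "i < n \<Longrightarrow> fbasis i \<in> fvecs n"
  "bilin \<iota> n c u v \<in> fvecs n"
  by (auto simp: fvecs_def fscale_def fbasis_def bilin_def)

lemma fscale_apply [simp]: "fscale c x i = c * x i"
  by (simp add: fscale_def)

lemma fvecsD: "v \<in> fvecs n \<Longrightarrow> n \<le> i \<Longrightarrow> v i = 0"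
  by (simp add: fvecs_def)

lemma linear_expand:
  fixes L :: "(nat \<Rightarrow> 'r::comm_ring_1) \<Rightarrow> 'r"
  assumes add: "\<And>x y. L (x + y) = L x + L y"
    and scale: "\<And>c x. L (fscale c x) = c * L x"
    and v: "v \<in> fvecs n"
  shows "L v = (\<Sum>i<n. v i * L (fbasis i))"
proof -
  have "L (\<lambda>i. if i < k then v i else 0) = (\<Sum>i<k. v i * L (fbasis i))" for k
  proof (induction k)
    case 0
    show ?case using scale[of 0 0] by (simp add: fscale_def zero_fun_def)
  next
    case (Suc k)
    have "(\<lambda>i. if i < Suc k then v i else 0) = (\<lambda>i. if i < k then v i else 0) + fscale (v k) (fbasis k)"
      by (auto simp: fscale_def fbasis_def less_Suc_eq)
    then show ?case using Suc by (simp add: add scale)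
  qed
  moreover have "(\<lambda>i. if i < n then v i else 0) = v"
    using v by (auto simp: fvecs_def)
  ultimately show ?thesis by metis
qed

lemma linear_eqI:
  fixes L M :: "(nat \<Rightarrow> 'r::comm_ring_1) \<Rightarrow> 'r"
  assumes "\<And>x y. L (x + y) = L x + L y" "\<And>c x. L (fscale c x) = c * L x"
    and "\<And>x y. M (x + y) = M x + M y" "\<And>c x. M (fscale c x) = c * M x"
    and "\<And>i. i < n \<Longrightarrow> L (fbasis i) = M (fbasis i)" "v \<in> fvecs n"
  shows "L v = M v"
  using assms by (simp add: linear_expand[of L v n] linear_expand[of M v n])

lemma bilin_linear:
  "bilin \<iota> n c (x + x') y = bilin \<iota> n c x y + bilin \<iota> n c x' y"
  "bilin \<iota> n c x (y + y') = bilin \<iota> n c x y + bilin \<iota> n c x y'"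
  "bilin \<iota> n c (fscale a x) y = fscale a (bilin \<iota> n c x y)"
  "bilin \<iota> n c x (fscale a y) = fscale a (bilin \<iota> n c x y)"
     apply (rule ext, simp add: bilin_def distrib_left distrib_right sum.distrib)+
   apply (simp add: fun_eq_iff bilin_def fscale_def sum_distrib_left ac_simps)+
  done

lemma trilin_linear:
  "trilin \<iota> n a (x + x') y z = trilin \<iota> n a x y z + trilin \<iota> n a x' y z"
  "trilin \<iota> n a x (y + y') z = trilin \<iota> n a x y z + trilin \<iota> n a x y' z"
  "trilin \<iota> n a x y (z + z') = trilin \<iota> n a x y z + trilin \<iota> n a x y z'"
  "trilin \<iota> n a (fscale b x) y z = b * trilin \<iota> n a x y z"
  "trilin \<iota> n a x (fscale b y) z = b * trilin \<iota> n a x y z"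
  "trilin \<iota> n a x y (fscale b z) = b * trilin \<iota> n a x y z"
       apply (simp add: trilin_def distrib_left distrib_right sum.distrib)+
    apply (simp add: trilin_def fscale_def sum_distrib_left ac_simps)+
  done

text \<open>This is what carries identities from the ground field to an arbitrary ring: on basis
  vectors both sides are images under \<iota> of values over the ground field.\<close>

lemma trilinear_eqI:
  fixes A B :: "(nat \<Rightarrow> 'r::comm_ring_1) \<Rightarrow> (nat \<Rightarrow> 'r) \<Rightarrow> (nat \<Rightarrow> 'r) \<Rightarrow> 'r"
  assumes A: "\<And>x x' y z. A (x + x') y z = A x y z + A x' y z"
    "\<And>x y y' z. A x (y + y') z = A x y z + A x y' z"
    "\<And>x y z z'. A x y (z + z') = A x y z + A x y z'"
    "\<And>b x y z. A (fscale b x) y z = b * A x y z"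
    "\<And>b x y z. A x (fscale b y) z = b * A x y z"
    "\<And>b x y z. A x y (fscale b z) = b * A x y z"
    and B: "\<And>x x' y z. B (x + x') y z = B x y z + B x' y z"
    "\<And>x y y' z. B x (y + y') z = B x y z + B x y' z"
    "\<And>x y z z'. B x y (z + z') = B x y z + B x y z'"
    "\<And>b x y z. B (fscale b x) y z = b * B x y z"
    "\<And>b x y z. B x (fscale b y) z = b * B x y z"
    "\<And>b x y z. B x y (fscale b z) = b * B x y z"
    and eq: "\<And>i j k. i < n \<Longrightarrow> j < n \<Longrightarrow> k < n \<Longrightarrow>
      A (fbasis i) (fbasis j) (fbasis k) = B (fbasis i) (fbasis j) (fbasis k)"
    and V: "x \<in> fvecs n" "y \<in> fvecs n" "z \<in> fvecs n"
  shows "A x y z = B x y z"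
proof -
  have 1: "A (fbasis i) (fbasis j) z = B (fbasis i) (fbasis j) z" if "i < n" "j < n" for i j
    by (rule linear_eqI[of "A (fbasis i) (fbasis j)" "B (fbasis i) (fbasis j)" n])
      (intro A B eq V that; assumption)+
  have 2: "A (fbasis i) y z = B (fbasis i) y z" if "i < n" for i
    by (rule linear_eqI[of "\<lambda>y. A (fbasis i) y z" "\<lambda>y. B (fbasis i) y z" n])
      (intro A B V 1 that; assumption)+
  show ?thesis
    by (rule linear_eqI[of "\<lambda>x. A x y z" "\<lambda>x. B x y z" n]) (intro A B V 2; assumption)+
qed

lemma (in comm_ring_hom) bilin_hom:
  "bilin (\<lambda>c. hom (\<iota> c)) n c (\<lambda>i. hom (x i)) (\<lambda>i. hom (y i)) = (\<lambda>l. hom (bilin \<iota> n c x y l))"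
  by (auto simp: bilin_def hom_sum hom_mult)

lemma (in comm_ring_hom) trilin_hom:
  "trilin (\<lambda>c. hom (\<iota> c)) n a (\<lambda>i. hom (x i)) (\<lambda>i. hom (y i)) (\<lambda>i. hom (z i)) = hom (trilin \<iota> n a x y z)"
  by (auto simp: trilin_def hom_sum hom_mult)

lemma (in comm_ring_hom) fbasis_hom: "(\<lambda>k. hom (fbasis i k)) = fbasis i"
  by (auto simp: fbasis_def)

lemma (in comm_ring_hom) fvecs_hom: "x \<in> fvecs n \<Longrightarrow> (\<lambda>i. hom (x i)) \<in> fvecs n"
  by (simp add: fvecs_def)

subsection \<open>Coefficients of a cubic form\<close>

definition mdegree :: "(nat \<Rightarrow>\<^sub>0 nat) \<Rightarrow> nat" where
  "mdegree m = (\<Sum>i\<in>Poly_Mapping.keys m. Poly_Mapping.lookup m i)"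

lemma mdegree_add: "mdegree (m + m') = mdegree m + mdegree m'"
  unfolding mdegree_def by (rule setsum_keys_plus_distrib) auto

lemma mdegree_eq_0: "mdegree m = 0 \<Longrightarrow> m = 0"
  by (auto simp: mdegree_def in_keys_iff intro!: poly_mapping_eqI)

lemma mdegree_Suc:
  assumes "mdegree m = Suc d"
  obtains i m' where "m = Poly_Mapping.single i 1 + m'" "mdegree m' = d"
proof -
  have "Poly_Mapping.keys m \<noteq> {}" using assms by (auto simp: mdegree_def)
  then obtain i where i: "i \<in> Poly_Mapping.keys m" by blast
  have m: "m = Poly_Mapping.single i 1 + (m - Poly_Mapping.single i 1)"
    by (rule poly_mapping_eqI) (use i in \<open>auto simp: lookup_add lookup_minus lookup_single when_def in_keys_iff\<close>)
  moreover have "mdegree (m - Poly_Mapping.single i 1) = d"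
    using assms arg_cong[OF m, of mdegree] by (simp add: mdegree_add) (simp add: mdegree_def)
  ultimately show ?thesis by (rule that)
qed

text \<open>An arbitrary factorization of a cubic monomial into three indeterminates. Placing the
  whole coefficient at one such triple gives a tensor that is not symmetric but reproduces the form
  on the diagonal without any division by 6, hence over every ring.\<close>

definition cubic_triple :: "(nat \<Rightarrow>\<^sub>0 nat) \<Rightarrow> nat \<times> nat \<times> nat" where
  "cubic_triple m = (SOME t. case t of (i, j, k) \<Rightarrow>
     m = Poly_Mapping.single i 1 + Poly_Mapping.single j 1 + Poly_Mapping.single k 1)"

definition cubic_coeff :: "'a::comm_ring_1 mpoly \<Rightarrow> nat \<Rightarrow> nat \<Rightarrow> nat \<Rightarrow> 'a" where
  "cubic_coeff p i j k =
     (\<Sum>m\<in>Poly_Mapping.keys p. if cubic_triple m = (i, j, k) then Poly_Mapping.lookup p m else 0)"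

lemma cubic_triple:
  assumes "mdegree m = 3" "cubic_triple m = (i, j, k)"
  shows "m = Poly_Mapping.single i 1 + Poly_Mapping.single j 1 + Poly_Mapping.single k 1"
proof -
  have "mdegree m = Suc (Suc (Suc 0))" using assms by simp
  then obtain i' m1 where 1: "m = Poly_Mapping.single i' 1 + m1" "mdegree m1 = Suc (Suc 0)"
    by (rule mdegree_Suc)
  from 1(2) obtain j' m2 where 2: "m1 = Poly_Mapping.single j' 1 + m2" "mdegree m2 = Suc 0"
    by (rule mdegree_Suc)
  from 2(2) obtain k' m3 where 3: "m2 = Poly_Mapping.single k' 1 + m3" "mdegree m3 = 0"
    by (rule mdegree_Suc)
  define P where "P = (\<lambda>(i, j, k). m = Poly_Mapping.single i 1 + Poly_Mapping.single j 1 + Poly_Mapping.single k 1)"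
  have m3: "m3 = 0"
    using 3(2) by (rule mdegree_eq_0)
  have "m = Poly_Mapping.single i' 1 + (Poly_Mapping.single j' 1 + (Poly_Mapping.single k' 1 + 0))"
    using 1(1) 2(1) 3(1) m3 by metis
  then have "P (i', j', k')"
    by (simp add: P_def add.assoc)
  then have "P (Eps P)"
    by (rule someI)
  then have "P (cubic_triple m)"
    by (simp add: P_def cubic_triple_def)
  then show ?thesis using assms(2) by (simp add: P_def)
qed

lemma sum_delta3:
  assumes "i0 < n" "j0 < n" "k0 < (n::nat)"
  shows "(\<Sum>i<n. \<Sum>j<n. \<Sum>k<n. if (i0, j0, k0) = (i, j, k) then g i j k else (0::'a::comm_ring_1)) = g i0 j0 k0"
proof -
  have "(\<Sum>k<n. if (i0, j0, k0) = (i, j, k) then g i j k else 0) =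
      (if j0 = j then if i0 = i then g i j k0 else 0 else 0)" for i j
    using assms by (cases "j0 = j"; cases "i0 = i") simp_all
  then have "(\<Sum>j<n. \<Sum>k<n. if (i0, j0, k0) = (i, j, k) then g i j k else 0) =
      (if i0 = i then g i j0 k0 else 0)" for i
    using assms by simp
  then show ?thesis using assms by simp
qed

lemma (in comm_ring_hom) subst_cubic_form:
  assumes "cubic_form n p"
  shows "subst_mpoly hom x p = trilin hom n (cubic_coeff p) x x x"
proof -
  let ?K = "Poly_Mapping.keys p"
  have "(\<Sum>i<n. \<Sum>j<n. \<Sum>k<n. if cubic_triple m = (i, j, k)
      then hom (Poly_Mapping.lookup p m) * (x i * x j * x k) else 0) = hom (Poly_Mapping.lookup p m) * monom_value x m"
    if m: "m \<in> ?K" for m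
  proof -
    obtain i j k where t: "cubic_triple m = (i, j, k)" by (cases "cubic_triple m") auto
    have deg: "mdegree m = 3" and sub: "Poly_Mapping.keys m \<subseteq> {..<n}"
      using assms m by (auto simp: cubic_form_def mdegree_def)
    have m_eq: "m = Poly_Mapping.single i 1 + Poly_Mapping.single j 1 + Poly_Mapping.single k 1"
      using cubic_triple[OF deg t] .
    have "i \<in> Poly_Mapping.keys m" "j \<in> Poly_Mapping.keys m" "k \<in> Poly_Mapping.keys m"
      by (simp_all add: in_keys_iff m_eq lookup_add)
    then have "i < n" "j < n" "k < n" using sub by auto
    then show ?thesis
      unfolding t by (subst sum_delta3) (simp_all add: m_eq monom_value_add)
  qed
  then have "subst_mpoly hom x p = (\<Sum>m\<in>?K. \<Sum>i<n. \<Sum>j<n. \<Sum>k<n. if cubic_triple m = (i, j, k)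
      then hom (Poly_Mapping.lookup p m) * (x i * x j * x k) else 0)"
    by (simp add: subst_mpoly_monom_value)
  also have "\<dots> = (\<Sum>i<n. \<Sum>j<n. \<Sum>k<n. \<Sum>m\<in>?K. if cubic_triple m = (i, j, k)
      then hom (Poly_Mapping.lookup p m) * (x i * x j * x k) else 0)"
    by (rule trans[OF sum.swap], rule sum.cong[OF refl], rule trans[OF sum.swap],
        rule sum.cong[OF refl], rule sum.swap)
  also have "\<dots> = trilin hom n (cubic_coeff p) x x x"
    unfolding trilin_def cubic_coeff_def
    by (intro sum.cong refl, subst hom_sum, simp only: sum_distrib_right, intro sum.cong refl)
      simp
  finally show ?thesis .
qed

section \<open>The determinant of left multiplication\<close>

text \<open>Here \<open>c\<close> holds the structure constants of the product, \<open>q\<close>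
  those of the linearized adjoint, and \<open>a\<close> the coefficients of the norm. The unit law,
  associativity and the adjoint identity are multilinear and will be moved to other rings;
  anisotropy and multiplicativity of the norm are used over the ground field.\<close>

locale division_norm_algebra =
  fixes n :: nat and c q a :: "nat \<Rightarrow> nat \<Rightarrow> nat \<Rightarrow> 'f::field" and e :: "nat \<Rightarrow> 'f"
  assumes e_V: "e \<in> fvecs n"
    and unit_left: "x \<in> fvecs n \<Longrightarrow> bilin (\<lambda>c. c) n c e x = x"
    and assoc: "x \<in> fvecs n \<Longrightarrow> y \<in> fvecs n \<Longrightarrow> z \<in> fvecs n \<Longrightarrow>
      bilin (\<lambda>c. c) n c (bilin (\<lambda>c. c) n c x y) z = bilin (\<lambda>c. c) n c x (bilin (\<lambda>c. c) n c y z)"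
    and adjoint: "x \<in> fvecs n \<Longrightarrow> y \<in> fvecs n \<Longrightarrow> z \<in> fvecs n \<Longrightarrow>
      bilin (\<lambda>c. c) n c (bilin (\<lambda>c. c) n q x y) z + bilin (\<lambda>c. c) n c (bilin (\<lambda>c. c) n q y z) x
        + bilin (\<lambda>c. c) n c (bilin (\<lambda>c. c) n q z x) y
      = fscale (trilin (\<lambda>c. c) n a x y z + trilin (\<lambda>c. c) n a x z y + trilin (\<lambda>c. c) n a y x z
        + trilin (\<lambda>c. c) n a y z x + trilin (\<lambda>c. c) n a z x y + trilin (\<lambda>c. c) n a z y x) e"
    and anisotropic: "x \<in> fvecs n \<Longrightarrow> trilin (\<lambda>c. c) n a x x x = 0 \<Longrightarrow> x = 0"
    and norm_mult: "x \<in> fvecs n \<Longrightarrow> y \<in> fvecs n \<Longrightarrow>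
      trilin (\<lambda>c. c) n a (bilin (\<lambda>c. c) n c x y) (bilin (\<lambda>c. c) n c x y) (bilin (\<lambda>c. c) n c x y)
      = trilin (\<lambda>c. c) n a x x x * trilin (\<lambda>c. c) n a y y y"
    and norm_e: "trilin (\<lambda>c. c) n a e e e = 1"
    and two: "(2::'f) \<noteq> 0" and three: "(3::'f) \<noteq> 0"
    and n2: "2 \<le> n"
begin

abbreviation "mulR \<iota> x y \<equiv> bilin \<iota> n c x y"

definition N :: "('f \<Rightarrow> 'r::comm_ring_1) \<Rightarrow> (nat \<Rightarrow> 'r) \<Rightarrow> 'r" where
  "N \<iota> x = trilin \<iota> n a x x x"

definition lmat :: "('f \<Rightarrow> 'r::comm_ring_1) \<Rightarrow> (nat \<Rightarrow> 'r) \<Rightarrow> 'r mat" where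
  "lmat \<iota> x = mat n n (\<lambda>(l, j). mulR \<iota> x (fbasis j) l)"

lemma lmat_carrier [simp]: "lmat \<iota> x \<in> carrier_mat n n" "dim_row (lmat \<iota> x) = n" "dim_col (lmat \<iota> x) = n"
  by (simp_all add: lmat_def)

lemma N_hom: "N (\<lambda>c. \<eta> (\<iota> c)) (\<lambda>i. \<eta> (x i)) = \<eta> (N \<iota> x)" if "comm_ring_hom \<eta>" for \<iota>
proof -
  interpret comm_ring_hom \<eta> by fact
  show ?thesis unfolding N_def by (rule trilin_hom)
qed

lemma lmat_hom: "lmat (\<lambda>c. \<eta> (\<iota> c)) (\<lambda>i. \<eta> (x i)) = map_mat \<eta> (lmat \<iota> x)" if "comm_ring_hom \<eta>" for \<iota>
proof -
  interpret comm_ring_hom \<eta> by fact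
  show ?thesis
    using bilin_hom[of \<iota> n c x "fbasis j" for j] by (intro eq_matI) (simp_all add: lmat_def fbasis_hom)
qed

lemma det_lmat_hom: "det (lmat (\<lambda>c. \<eta> (\<iota> c)) (\<lambda>i. \<eta> (x i))) = \<eta> (det (lmat \<iota> x))" if "comm_ring_hom \<eta>" for \<iota>
proof -
  interpret comm_ring_hom \<eta> by fact
  show ?thesis unfolding lmat_hom[OF that] by (rule hom_det)
qed

lemma N_fscale: "N \<iota> (fscale b x) = b ^ 3 * N \<iota> x"
  by (simp add: N_def trilin_linear power3_eq_cube mult.assoc)

context
  fixes \<iota> :: "'f \<Rightarrow> 'r::comm_ring_1"
  assumes hom: "comm_ring_hom \<iota>"
begin

interpretation \<iota>: comm_ring_hom \<iota> by (rule hom)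

lemma mulR_fbasis: "mulR \<iota> (fbasis i) (fbasis j) = (\<lambda>l. \<iota> (mulR (\<lambda>c. c) (fbasis i) (fbasis j) l))"
  using \<iota>.bilin_hom[of "\<lambda>c. c" n c "fbasis i" "fbasis j"] by (simp add: \<iota>.fbasis_hom)

lemma unit_R: "x \<in> fvecs n \<Longrightarrow> mulR \<iota> (\<lambda>i. \<iota> (e i)) x = x"
proof (rule ext)
  fix l assume x: "x \<in> fvecs n"
  show "mulR \<iota> (\<lambda>i. \<iota> (e i)) x l = x l"
  proof (rule linear_eqI[of "\<lambda>x. mulR \<iota> (\<lambda>i. \<iota> (e i)) x l" "\<lambda>x. x l" n])
    fix i assume "i < n"
    then show "mulR \<iota> (\<lambda>i. \<iota> (e i)) (fbasis i) l = fbasis i l"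
      using \<iota>.bilin_hom[of "\<lambda>c. c" n c e "fbasis i"] unit_left[of "fbasis i"] 
      by (simp add: \<iota>.fbasis_hom)
  qed (use x in \<open>simp_all add: bilin_linear\<close>)
qed

lemma assoc_R:
  assumes "x \<in> fvecs n" "y \<in> fvecs n" "z \<in> fvecs n"
  shows "mulR \<iota> (mulR \<iota> x y) z = mulR \<iota> x (mulR \<iota> y z)"
proof (rule ext)
  fix l
  show "mulR \<iota> (mulR \<iota> x y) z l = mulR \<iota> x (mulR \<iota> y z) l"
  proof (rule trilinear_eqI[of "\<lambda>x y z. mulR \<iota> (mulR \<iota> x y) z l" "\<lambda>x y z. mulR \<iota> x (mulR \<iota> y z) l" n])
    fix i j k assume ijk: "i < n" "j < n" "k < n"
    have "mulR \<iota> (mulR \<iota> (fbasis i) (fbasis j)) (fbasis k)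
        = (\<lambda>l. \<iota> (mulR (\<lambda>c. c) (mulR (\<lambda>c. c) (fbasis i) (fbasis j)) (fbasis k) l))"
      using \<iota>.bilin_hom[of "\<lambda>c. c" n c "mulR (\<lambda>c. c) (fbasis i) (fbasis j)" "fbasis k"]
      by (simp add: mulR_fbasis \<iota>.fbasis_hom)
    moreover have "mulR \<iota> (fbasis i) (mulR \<iota> (fbasis j) (fbasis k))
        = (\<lambda>l. \<iota> (mulR (\<lambda>c. c) (fbasis i) (mulR (\<lambda>c. c) (fbasis j) (fbasis k)) l))"
      using \<iota>.bilin_hom[of "\<lambda>c. c" n c "fbasis i" "mulR (\<lambda>c. c) (fbasis j) (fbasis k)"]
      by (simp add: mulR_fbasis \<iota>.fbasis_hom)
    ultimately show "mulR \<iota> (mulR \<iota> (fbasis i) (fbasis j)) (fbasis k) l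
        = mulR \<iota> (fbasis i) (mulR \<iota> (fbasis j) (fbasis k)) l"
      using assoc[of "fbasis i" "fbasis j" "fbasis k"] ijk by simp
  qed (use assms in \<open>simp_all add: bilin_linear\<close>)
qed

lemma lmat_mult:
  assumes "x \<in> fvecs n" "y \<in> fvecs n"
  shows "lmat \<iota> (mulR \<iota> x y) = lmat \<iota> x * lmat \<iota> y"
proof (rule eq_matI)
  fix l k assume "l < dim_row (lmat \<iota> x * lmat \<iota> y)" "k < dim_col (lmat \<iota> x * lmat \<iota> y)"
  then have lk: "l < n" "k < n" by simp_all
  have "mulR \<iota> x v l = (\<Sum>m<n. v m * mulR \<iota> x (fbasis m) l)" if "v \<in> fvecs n" for v
    by (rule linear_expand[of "\<lambda>v. mulR \<iota> x v l"]) (use that in \<open>simp_all add: bilin_linear\<close>)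
  from this[of "mulR \<iota> y (fbasis k)"]
  have "mulR \<iota> x (mulR \<iota> y (fbasis k)) l = (\<Sum>m<n. mulR \<iota> x (fbasis m) l * mulR \<iota> y (fbasis k) m)"
    by (simp add: mult.commute)
  then show "lmat \<iota> (mulR \<iota> x y) $$ (l, k) = (lmat \<iota> x * lmat \<iota> y) $$ (l, k)"
    using lk assms by (simp add: lmat_def scalar_prod_def assoc_R lessThan_atLeast0)
qed simp_all

lemma lmat_one: "lmat \<iota> (\<lambda>i. \<iota> (e i)) = 1\<^sub>m n"
  by (rule eq_matI) (auto simp: lmat_def unit_R, auto simp: fbasis_def)

lemma lmat_fscale: "lmat \<iota> (fscale b x) = b \<cdot>\<^sub>m lmat \<iota> x"
  by (rule eq_matI) (auto simp: lmat_def bilin_linear)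

lemma lmat_add: "lmat \<iota> (x + y) = lmat \<iota> x + lmat \<iota> y"
  by (rule eq_matI) (auto simp: lmat_def bilin_linear)

lemma adjoint_R:
  assumes x: "x \<in> fvecs n"
  shows "fscale 3 (mulR \<iota> (bilin \<iota> n q x x) x) = fscale (6 * N \<iota> x) (\<lambda>i. \<iota> (e i))"
proof (rule ext)
  fix l
  let ?L = "\<lambda>x y z. mulR \<iota> (bilin \<iota> n q x y) z l + mulR \<iota> (bilin \<iota> n q y z) x l + mulR \<iota> (bilin \<iota> n q z x) y l"
  let ?M = "\<lambda>x y z. (trilin \<iota> n a x y z + trilin \<iota> n a x z y + trilin \<iota> n a y x z
        + trilin \<iota> n a y z x + trilin \<iota> n a z x y + trilin \<iota> n a z y x) * \<iota> (e l)"
  have "?L x x x = ?M x x x"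
  proof (rule trilinear_eqI[of ?L ?M n])
    fix i j k assume ijk: "i < n" "j < n" "k < n"
    have 1: "mulR \<iota> (bilin \<iota> n q (fbasis i) (fbasis j)) (fbasis k) l
        = \<iota> (mulR (\<lambda>c. c) (bilin (\<lambda>c. c) n q (fbasis i) (fbasis j)) (fbasis k) l)" for i j k
      using \<iota>.bilin_hom[of "\<lambda>c. c" n q "fbasis i" "fbasis j"]
        \<iota>.bilin_hom[of "\<lambda>c. c" n c "bilin (\<lambda>c. c) n q (fbasis i) (fbasis j)" "fbasis k"]
      by (simp add: \<iota>.fbasis_hom)
    have 2: "trilin \<iota> n a (fbasis i) (fbasis j) (fbasis k) = \<iota> (trilin (\<lambda>c. c) n a (fbasis i) (fbasis j) (fbasis k))"
      for i j k
      using \<iota>.trilin_hom[of "\<lambda>c. c" n a "fbasis i" "fbasis j" "fbasis k"] by (simp add: \<iota>.fbasis_hom)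
    show "?L (fbasis i) (fbasis j) (fbasis k) = ?M (fbasis i) (fbasis j) (fbasis k)"
      using arg_cong[OF adjoint[of "fbasis i" "fbasis j" "fbasis k"], of "\<lambda>v. \<iota> (v l)"] ijk
      by (simp add: 1 2 \<iota>.hom_add \<iota>.hom_mult)
  qed (use x in \<open>simp_all add: bilin_linear trilin_linear algebra_simps\<close>)
  then show "fscale 3 (mulR \<iota> (bilin \<iota> n q x x) x) l = fscale (6 * N \<iota> x) (\<lambda>i. \<iota> (e i)) l"
    by (simp add: N_def)
qed

text \<open>Taking determinants of the adjoint identity shows that the determinant of left
  multiplication divides a power of the norm, up to powers of 3 and 6. This bounds its prime
  factors.\<close>

lemma det_lmat_adjoint:
  assumes x: "x \<in> fvecs n"
  shows "3 ^ n * (det (lmat \<iota> (bilin \<iota> n q x x)) * det (lmat \<iota> x)) = 6 ^ n * N \<iota> x ^ n"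
proof -
  have "lmat \<iota> (fscale 3 (mulR \<iota> (bilin \<iota> n q x x) x)) = lmat \<iota> (fscale (6 * N \<iota> x) (\<lambda>i. \<iota> (e i)))"
    using adjoint_R[OF x] by simp
  then have "3 \<cdot>\<^sub>m (lmat \<iota> (bilin \<iota> n q x x) * lmat \<iota> x) = (6 * N \<iota> x) \<cdot>\<^sub>m 1\<^sub>m n"
    using x by (simp add: lmat_fscale lmat_mult lmat_one)
  then have "det (3 \<cdot>\<^sub>m (lmat \<iota> (bilin \<iota> n q x x) * lmat \<iota> x)) = det ((6 * N \<iota> x) \<cdot>\<^sub>m 1\<^sub>m n)"
    by simp
  then show ?thesis
    by (simp add: det_mult[of _ n] power_mult_distrib)
qed

end

lemma comm_ring_hom_const: "comm_ring_hom (\<lambda>c::'r::comm_ring_1. [:c:])"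
  by unfold_locales (simp_all add: one_pCons)

lemma comm_ring_hom_poly: "comm_ring_hom (\<lambda>p. poly p (s::'r::comm_ring_1))"
  by unfold_locales simp_all

subsection \<open>Anisotropy over the polynomial ring\<close>

lemma N_poly_eval: "poly (N (\<lambda>c. [:c:]) y) s = N (\<lambda>c. c) (\<lambda>i. poly (y i) s)" for y :: "nat \<Rightarrow> 'f poly"
  using N_hom[OF comm_ring_hom_poly[of s], where \<iota> = "\<lambda>c. [:c:]" and x = y] by simp

text \<open>Evaluation at \<open>s\<close> yields an isotropic vector over the ground field, which
  must be zero; so every coordinate of \<open>y\<close> vanishes at \<open>s\<close>.\<close>

lemma root_imp_dvd:
  fixes y :: "nat \<Rightarrow> 'f poly"
  assumes y: "y \<in> fvecs n" and 0: "poly (N (\<lambda>c. [:c:]) y) s = 0"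
  obtains y' where "y' \<in> fvecs n" "y = fscale [:- s, 1:] y'"
proof -
  have "N (\<lambda>c. c) (\<lambda>i. poly (y i) s) = 0"
    using 0 by (simp add: N_poly_eval)
  then have "(\<lambda>i. poly (y i) s) = 0"
    using anisotropic[of "\<lambda>i. poly (y i) s"] y by (simp add: N_def fvecs_def)
  then have "poly (y i) s = 0" for i
    using fun_cong[of "\<lambda>i. poly (y i) s" 0 i] by simp
  then have "[:- s, 1:] dvd y i" for i by (simp add: poly_eq_0_iff_dvd)
  then have "y = fscale [:- s, 1:] (\<lambda>i. y i div [:- s, 1:])"
    by (intro ext) (simp only: fscale_apply dvd_mult_div_cancel)
  moreover have "(\<lambda>i. y i div [:- s, 1:]) \<in> fvecs n"
    using y by (simp add: fvecs_def)
  ultimately show ?thesis by (rule that[rotated])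
qed

definition total_degree :: "(nat \<Rightarrow> 'f poly) \<Rightarrow> nat" where
  "total_degree y = (\<Sum>i<n. degree (y i))"

lemma total_degree_less:
  assumes "y' \<in> fvecs n" "y' \<noteq> 0"
  shows "total_degree y' < total_degree (fscale [:- s, 1:] y')"
proof -
  obtain i where i: "y' i \<noteq> 0"
    using assms(2) by (auto simp: fun_eq_iff)
  then have "i < n" using fvecsD[OF assms(1)] by (meson not_le)
  have le: "degree (y' j) \<le> degree (fscale [:- s, 1:] y' j)" for j
    by (cases "y' j = 0") (simp_all add: degree_mult_eq del: mult_pCons_left)
  have "degree (y' i) < degree (fscale [:- s, 1:] y' i)"
    using i by (simp add: degree_mult_eq del: mult_pCons_left)
  then show ?thesis
    unfolding total_degree_def using \<open>i < n\<close> le by (intro sum_strict_mono_ex1) auto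
qed

text \<open>Descent at the point 0: an isotropic polynomial vector is divisible by the variable, the
  quotient is again isotropic, and the total degree drops.\<close>

lemma anisotropic_poly:
  fixes y :: "nat \<Rightarrow> 'f poly"
  assumes "y \<in> fvecs n" "N (\<lambda>c. [:c:]) y = 0"
  shows "y = 0"
  using assms
proof (induction "total_degree y" arbitrary: y rule: less_induct)
  case less
  have "poly (N (\<lambda>c. [:c:]) y) 0 = 0" using less.prems by simp
  obtain y' where y': "y' \<in> fvecs n" "y = fscale [:- 0, 1:] y'"
    by (rule root_imp_dvd[OF less.prems(1) \<open>poly _ 0 = 0\<close>])
  show ?case
  proof (rule ccontr)
    assume "y \<noteq> 0"
    have nz: "y' \<noteq> 0"
    proof
      assume "y' = 0"
      then have "y = 0" unfolding y'(2) by (intro ext) simp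
      with \<open>y \<noteq> 0\<close> show False ..
    qed
    have "[:- 0, 1:] ^ 3 * N (\<lambda>c. [:c:]) y' = 0"
      using less.prems(2) unfolding y'(2) N_fscale .
    moreover have "[:- 0, 1 :: 'f:] ^ 3 \<noteq> 0" by (intro power_not_zero) simp
    ultimately have "N (\<lambda>c. [:c:]) y' = 0" by (metis mult_eq_0_iff)
    moreover have "total_degree y' < total_degree y"
      unfolding y'(2) by (rule total_degree_less[OF y'(1) nz])
    ultimately have "y' = 0" using less.hyps y'(1) by blast
    with nz show False ..
  qed
qed

end

section \<open>The characteristic polynomial along a line through the unit\<close>

lemma irreducible_cubic:
  fixes p :: "'a::field poly"
  assumes deg: "degree p = 3" and no_root: "\<And>s. poly p s \<noteq> 0"
  shows "Factorial_Ring.irreducible p"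
proof (rule Factorial_Ring.irreducibleI)
  show "p \<noteq> 0" using deg by auto
  show "\<not> p dvd 1" using deg by (metis is_unit_iff_degree \<open>p \<noteq> 0\<close> zero_neq_numeral)
  fix f g assume fg: "p = f * g"
  have linear: False if "degree f = 1" "p = f * g" for f g
  proof -
    define \<alpha> \<beta> where "\<alpha> = Polynomial.coeff f 0" and "\<beta> = Polynomial.coeff f 1"
    have "f = [:\<alpha>, \<beta>:]"
      by (rule poly_eqI)
        (use that in \<open>auto simp: \<alpha>_def \<beta>_def coeff_pCons coeff_eq_0 split: nat.split\<close>)
    moreover have "\<beta> \<noteq> 0"
      using \<open>degree f = 1\<close> by (metis \<beta>_def coeff_0_degree_minus_1 leading_coeff_neq_0 degree_0 zero_neq_one)
    ultimately have "poly f (- \<alpha> / \<beta>) = 0" by simp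
    then have "poly p (- \<alpha> / \<beta>) = 0" using that(2) by simp
    then show False using no_root by blast
  qed
  have nz: "f \<noteq> 0" "g \<noteq> 0" using fg \<open>p \<noteq> 0\<close> by auto
  then have "degree f + degree g = 3" using deg fg degree_mult_eq by metis
  moreover have "degree f \<noteq> 1" using linear[of f g] fg by blast
  moreover have "degree g \<noteq> 1" using linear[of g f] fg by (metis mult.commute)
  ultimately have "degree f = 0 \<or> degree g = 0" by linarith
  then show "f dvd 1 \<or> g dvd 1" using nz by (simp add: is_unit_iff_degree)
qed

lemma dvd_prime_elem_power:
  fixes p x :: "'r::algebraic_semidom"
  assumes p: "prime_elem p" and "x dvd p ^ n"
  shows "\<exists>m u. is_unit u \<and> x = u * p ^ m"
  using assms(2)
proof (induction n arbitrary: x)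
  case 0
  then show ?case by (intro exI[of _ 0] exI[of _ x]) simp
next
  case (Suc n)
  from Suc.prems obtain y where y: "p ^ Suc n = x * y" ..
  then have "p dvd x * y" by (metis dvd_triv_left power_Suc)
  then consider "p dvd x" | "p dvd y" using p by (auto dest: prime_elem_dvd_multD)
  then show ?case
  proof cases
    case 1
    then obtain x' where x': "x = p * x'" ..
    then have "p ^ n = x' * y" using y prime_elem_not_zeroI p by (auto simp: mult.assoc)
    then obtain m u where "is_unit u" "x' = u * p ^ m" using Suc.IH[of x'] by auto
    then show ?thesis by (intro exI[of _ "Suc m"] exI[of _ u]) (simp add: x' ac_simps)
  next
    case 2
    then obtain y' where y': "y = p * y'" ..
    then have "p * p ^ n = p * (x * y')" using y by (simp add: ac_simps)
    then have "p ^ n = x * y'" using p by auto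
    then show ?thesis using Suc.IH[of x] by auto
  qed
qed

context division_norm_algebra begin

lemma N_generic_line:
  fixes \<iota> :: "'f \<Rightarrow> 'r::comm_ring_1"
  assumes hom: "comm_ring_hom \<iota>"
  obtains b0 b1 b2 where "N (\<lambda>c. [:\<iota> c:]) (\<lambda>i. [:d i, \<iota> (e i):]) = [:b0, b1, b2, 1:]"
proof -
  let ?E = "\<lambda>i. [:\<iota> (e i):]" and ?D = "\<lambda>i. [:d i:]"
  interpret \<iota>: comm_ring_hom \<iota> by (rule hom)
  have t: "trilin (\<lambda>c. [:\<iota> c:]) n a (\<lambda>i. [:x i:]) (\<lambda>i. [:y i:]) (\<lambda>i. [:z i:]) = [:trilin \<iota> n a x y z:]" for x y z
    using comm_ring_hom.trilin_hom[OF comm_ring_hom_const, of \<iota> n a x y z] .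
  have "trilin \<iota> n a (\<lambda>i. \<iota> (e i)) (\<lambda>i. \<iota> (e i)) (\<lambda>i. \<iota> (e i)) = 1"
    using \<iota>.trilin_hom[of "\<lambda>c. c" n a e e e] by (simp add: norm_e)
  then have E: "trilin (\<lambda>c. [:\<iota> c:]) n a ?E ?E ?E = 1"
    unfolding t by simp
  have X: "(\<lambda>i. [:d i, \<iota> (e i):]) = fscale [:0, 1:] ?E + ?D"
    by (rule ext) simp
  show ?thesis
  proof (rule that)
    show "N (\<lambda>c. [:\<iota> c:]) (\<lambda>i. [:d i, \<iota> (e i):]) = [:trilin \<iota> n a d d d,
      trilin \<iota> n a (\<lambda>i. \<iota> (e i)) d d + trilin \<iota> n a d (\<lambda>i. \<iota> (e i)) d + trilin \<iota> n a d d (\<lambda>i. \<iota> (e i)),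
      trilin \<iota> n a (\<lambda>i. \<iota> (e i)) (\<lambda>i. \<iota> (e i)) d + trilin \<iota> n a (\<lambda>i. \<iota> (e i)) d (\<lambda>i. \<iota> (e i))
        + trilin \<iota> n a d (\<lambda>i. \<iota> (e i)) (\<lambda>i. \<iota> (e i)), 1:]"
      unfolding X N_def by (simp add: trilin_linear E t)
  qed
qed

lemma lmat_generic_line:
  fixes \<iota> :: "'f \<Rightarrow> 'r::comm_ring_1"
  assumes hom: "comm_ring_hom \<iota>"
  shows "lmat (\<lambda>c. [:\<iota> c:]) (\<lambda>i. [:d i, \<iota> (e i):]) = char_poly_matrix (- lmat \<iota> d)"
proof -
  interpret \<iota>: comm_ring_hom \<iota> by (rule hom)
  have hom2: "comm_ring_hom (\<lambda>c. [:\<iota> c:])"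
    by unfold_locales (simp_all add: \<iota>.hom_add \<iota>.hom_mult)
  have X: "(\<lambda>i. [:d i, \<iota> (e i):]) = fscale [:0, 1:] (\<lambda>i. [:\<iota> (e i):]) + (\<lambda>i. [:d i:])"
    by (rule ext) simp
  have "lmat (\<lambda>c. [:\<iota> c:]) (\<lambda>i. [:d i, \<iota> (e i):]) = [:0, 1:] \<cdot>\<^sub>m 1\<^sub>m n + map_mat (\<lambda>a. [:a:]) (lmat \<iota> d)"
    unfolding X lmat_add[OF hom2] lmat_fscale[OF hom2] lmat_one[OF hom2]
    by (simp add: lmat_hom[OF comm_ring_hom_const])
  also have "\<dots> = char_poly_matrix (- lmat \<iota> d)"
    unfolding char_poly_matrix_def by (rule eq_matI) simp_all
  finally show ?thesis .
qed

text \<open>On the line \<open>d + t e\<close> the norm is a monic cubic \<open>p\<close>,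
  irreducible as it has no root, and the determinant \<chi> of left multiplication is a
  characteristic polynomial, monic of degree \<open>n\<close>. Since \<chi> divides a unit times a
  power of \<open>p\<close>, it is a power of \<open>p\<close>; the degree gives the exponent, and t
  = 0 gives the value at \<open>d\<close>.\<close>

lemma det_lmat_no_root:
  fixes \<iota> :: "'f \<Rightarrow> 'r::field"
  assumes hom: "comm_ring_hom \<iota>" and d: "d \<in> fvecs n"
    and no_root: "\<And>s. N \<iota> (fscale s (\<lambda>i. \<iota> (e i)) + d) \<noteq> 0"
  shows "n = 3 * (n div 3)" "det (lmat \<iota> d) = N \<iota> d ^ (n div 3)"
proof -
  interpret \<iota>: comm_ring_hom \<iota> by (rule hom)
  have hom2: "comm_ring_hom (\<lambda>c. [:\<iota> c:])"
    by unfold_locales (simp_all add: \<iota>.hom_add \<iota>.hom_mult)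
  define L where "L = (\<lambda>i. [:d i, \<iota> (e i):])"
  define p where "p = N (\<lambda>c. [:\<iota> c:]) L"
  define \<chi> where "\<chi> = det (lmat (\<lambda>c. [:\<iota> c:]) L)"
  have L: "L \<in> fvecs n" using d e_V by (auto simp: L_def fvecs_def)
  obtain b0 b1 b2 where "N (\<lambda>c. [:\<iota> c:]) (\<lambda>i. [:d i, \<iota> (e i):]) = [:b0, b1, b2, 1:]"
    by (rule N_generic_line[OF hom])
  then have p_eq: "p = [:b0, b1, b2, 1:]"
    by (simp only: p_def L_def)
  have evL: "(\<lambda>i. poly (L i) s) = fscale s (\<lambda>i. \<iota> (e i)) + d" for s
    by (rule ext) (simp add: L_def)
  have "poly p s = N \<iota> (fscale s (\<lambda>i. \<iota> (e i)) + d)" for s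
    unfolding p_def evL[symmetric]
    using N_hom[OF comm_ring_hom_poly[of s], where \<iota> = "\<lambda>c. [:\<iota> c:]" and x = L] by simp
  then have irr: "Factorial_Ring.irreducible p"
    using no_root by (intro irreducible_cubic) (auto simp: p_eq)
  have monic: "degree \<chi> = n" "lead_coeff \<chi> = 1"
    using degree_monic_char_poly[of "- lmat \<iota> d" n]
    unfolding \<chi>_def L_def lmat_generic_line[OF hom] char_poly_def[symmetric] by simp_all
  have "(6::'f) = 2 * 3" by simp
  then have "(6::'f) \<noteq> 0" using two three by (metis mult_eq_0_iff)
  then have "(1::'r) = \<iota> 6 * \<iota> (inverse 6)"
    by (metis \<iota>.hom_mult \<iota>.hom_one right_inverse)
  moreover have "\<iota> 6 = \<iota> (1 + 1 + 1 + 1 + 1 + 1)" by simp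
  then have "\<iota> 6 = 6" unfolding \<iota>.hom_add \<iota>.hom_one by simp
  ultimately have six: "(6::'r) \<noteq> 0" by (metis mult_zero_left zero_neq_one)
  have "3 ^ n * (det (lmat (\<lambda>c. [:\<iota> c:]) (bilin (\<lambda>c. [:\<iota> c:]) n q L L)) * \<chi>) = 6 ^ n * p ^ n"
    using det_lmat_adjoint[OF hom2 L] by (simp add: \<chi>_def p_def)
  then have "\<chi> dvd 6 ^ n * p ^ n"
    by (metis dvd_mult dvd_triv_right)
  moreover have "is_unit (6 ^ n :: 'r poly)"
  proof -
    have "is_unit [:6 :: 'r:]"
      unfolding is_unit_const_poly_iff using six by (metis dvd_field_iff)
    then have "is_unit (6 :: 'r poly)" by (simp only: numeral_poly)
    then show ?thesis by (rule is_unit_power_iff[THEN iffD2, OF disjI1])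
  qed
  ultimately have dvd: "\<chi> dvd p ^ n"
    by (metis dvd_mult_unit_iff')
  obtain m u where m: "is_unit u" "\<chi> = u * p ^ m"
    using dvd_prime_elem_power[OF field_poly_irreducible_imp_prime[OF irr] dvd] by blast
  have "lead_coeff p = 1" by (simp add: p_eq)
  then have "lead_coeff u = 1"
    using monic(2) by (simp add: m(2) lead_coeff_mult lead_coeff_power)
  moreover obtain k where "u = [:k:]" using m(1) unfolding is_unit_poly_iff by blast
  ultimately have "u = 1" by (simp add: pCons_one)
  with m have \<chi>: "\<chi> = p ^ m" by simp
  have "n = m * 3"
    using monic \<chi> degree_power_eq[of p m] by (simp add: p_eq)
  then show "n = 3 * (n div 3)" by simp
  have "poly \<chi> 0 = det (lmat \<iota> d)" "poly p 0 = N \<iota> d"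
    using det_lmat_hom[OF comm_ring_hom_poly[of 0], where \<iota> = "\<lambda>c. [:\<iota> c:]" and x = L]
      N_hom[OF comm_ring_hom_poly[of 0], where \<iota> = "\<lambda>c. [:\<iota> c:]" and x = L]
    by (simp_all add: \<chi>_def p_def L_def)
  then show "det (lmat \<iota> d) = N \<iota> d ^ (n div 3)"
    using \<chi> \<open>n = m * 3\<close> by simp
qed

end

section \<open>The generic element and the determinant over an arbitrary ring\<close>

lemma comm_ring_hom_to_fract: "comm_ring_hom (to_fract :: 'r::idom \<Rightarrow> 'r fract)"
  by unfold_locales simp_all

context division_norm_algebra begin

text \<open>The point at which \<open>Kronecker_substitution\<close> tests a polynomial
  identity.\<close>

definition generic :: "nat \<Rightarrow> nat \<Rightarrow> 'f poly" where
  "generic B i = (if i < n then Polynomial.monom 1 (B ^ i) else 0)"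

text \<open>If the generic vector were proportional to \<open>e\<close>, two of its coordinates
  would be in a constant ratio, whereas they are different powers of the variable. Two coordinates
  exist because \<open>n\<close> is at least 2.\<close>

lemma generic_not_scalar:
  assumes B: "2 \<le> B" and nz: "g \<noteq> (0::'f poly)"
  shows "fscale f (\<lambda>i. [:e i:]) + fscale g (generic B) \<noteq> 0"
proof
  assume 0: "fscale f (\<lambda>i. [:e i:]) + fscale g (generic B) = 0"
  have i: "f * [:e i:] = - (g * Polynomial.monom 1 (B ^ i))" if "i < n" for i
    using fun_cong[OF 0, of i] that by (simp add: generic_def eq_neg_iff_add_eq_0)
  have "e \<noteq> 0"
  proof
    assume "e = 0"
    then have "trilin (\<lambda>c. c) n a e e e = 0" by (simp add: trilin_def)
    with norm_e show False by simp
  qed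
  then obtain i0 where i0: "e i0 \<noteq> 0" by (auto simp: fun_eq_iff)
  then have "i0 < n" using fvecsD[OF e_V] by (meson not_le)
  obtain j where j: "j < n" "j \<noteq> i0"
    using n2 by (metis One_nat_def Suc_1 Suc_le_lessD less_le_trans lessI zero_less_Suc zero_neq_one)
  have "g * (Polynomial.monom 1 (B ^ i0) * [:e j:]) = - (f * [:e i0:]) * [:e j:]"
    using i[OF \<open>i0 < n\<close>] by (simp only: minus_minus mult.assoc)
  also have "\<dots> = - (f * [:e j:]) * [:e i0:]"
    by (simp only: ac_simps minus_mult_left)
  also have "\<dots> = g * (Polynomial.monom 1 (B ^ j) * [:e i0:])"
    using i[OF j(1)] by (simp only: minus_minus mult.assoc)
  finally have "Polynomial.monom 1 (B ^ i0) * [:e j:] = Polynomial.monom 1 (B ^ j) * [:e i0:]"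
    using nz by (metis mult_left_cancel)
  then have "Polynomial.coeff (Polynomial.monom 1 (B ^ i0) * [:e j:]) (B ^ j)
      = Polynomial.coeff (Polynomial.monom 1 (B ^ j) * [:e i0:]) (B ^ j)"
    by (rule arg_cong)
  moreover have "B ^ i0 \<noteq> B ^ j"
    using j B power_inject_exp[of B i0 j] by simp
  ultimately show False using i0 by simp
qed

lemma generic_V: "generic B \<in> fvecs n"
  by (simp add: generic_def fvecs_def)

text \<open>A root f/g of the cubic in the rational function field becomes, after clearing
  denominators, an isotropic vector \<open>f e + g generic\<close> over \<open>F[t]\<close>. It is
  zero by \<open>anisotropic_poly\<close>, contrary to \<open>generic_not_scalar\<close>. As a
  by-product, 3 divides the dimension.\<close>

lemma det_lmat_generic:
  assumes B: "2 \<le> B"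
  shows "n = 3 * (n div 3)" "det (lmat (\<lambda>c. [:c:]) (generic B)) = N (\<lambda>c. [:c:]) (generic B) ^ (n div 3)"
proof -
  let ?\<iota> = "\<lambda>c::'f. to_fract [:c:]"
  let ?d = "\<lambda>i. to_fract (generic B i)"
  interpret FF: comm_ring_hom "to_fract :: 'f poly \<Rightarrow> _" by (rule comm_ring_hom_to_fract)
  have hom: "comm_ring_hom ?\<iota>"
    by unfold_locales (simp_all add: pCons_one flip: to_fract_add to_fract_mult)
  have d: "?d \<in> fvecs n" using generic_V by (simp add: fvecs_def)
  have nr: "N ?\<iota> (fscale s (\<lambda>i. ?\<iota> (e i)) + ?d) \<noteq> 0" for s
  proof
    assume 0: "N ?\<iota> (fscale s (\<lambda>i. ?\<iota> (e i)) + ?d) = 0"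
    obtain f g where s: "s = to_fract f / to_fract g" "g \<noteq> 0"
      by (cases s) (auto simp: Fract_conv_to_fract)
    define y where "y = fscale f (\<lambda>i. [:e i:]) + fscale g (generic B)"
    have "(\<lambda>i. to_fract (y i)) = fscale (to_fract g) (fscale s (\<lambda>i. ?\<iota> (e i)) + ?d)"
    proof (rule ext)
      fix i
      have "to_fract g \<noteq> 0" using s(2) by simp
      then show "to_fract (y i) = fscale (to_fract g) (fscale s (\<lambda>i. ?\<iota> (e i)) + ?d) i"
        by (simp only: y_def plus_fun_apply fscale_apply to_fract_add to_fract_mult s(1) distrib_left) simp
    qed
    then have "to_fract (N (\<lambda>c. [:c:]) y) = 0"
      using 0 N_fscale[of ?\<iota> "to_fract g" "fscale s (\<lambda>i. ?\<iota> (e i)) + ?d"]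
        N_hom[OF comm_ring_hom_to_fract, where \<iota> = "\<lambda>c. [:c:]" and x = y]
      by simp
    then have Ny: "N (\<lambda>c. [:c:]) y = 0" by simp
    have "(\<lambda>i. [:e i:]) \<in> fvecs n"
      using fvecsD[OF e_V] by (simp add: fvecs_def)
    then have yV: "y \<in> fvecs n"
      unfolding y_def using generic_V by simp
    have "y = 0" by (rule anisotropic_poly[OF yV Ny])
    then show False using generic_not_scalar[OF B s(2), of f] by (simp only: y_def)
  qed
  show "n = 3 * (n div 3)" by (rule det_lmat_no_root[OF hom d nr])
  have "to_fract (det (lmat (\<lambda>c. [:c:]) (generic B))) = to_fract (N (\<lambda>c. [:c:]) (generic B) ^ (n div 3))"
    using det_lmat_no_root(2)[OF hom d nr]
      det_lmat_hom[OF comm_ring_hom_to_fract, where \<iota> = "\<lambda>c. [:c:]" and x = "generic B"]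
      N_hom[OF comm_ring_hom_to_fract, where \<iota> = "\<lambda>c. [:c:]" and x = "generic B"]
    by (simp only: FF.hom_power)
  then show "det (lmat (\<lambda>c. [:c:]) (generic B)) = N (\<lambda>c. [:c:]) (generic B) ^ (n div 3)"
    by (simp only: to_fract_eq_iff)
qed

lemma n_div_3: "0 < n div 3"
  using det_lmat_generic(1)[of 2] n2 by (cases "n div 3") auto

text \<open>Over the rational function field the determinant is a power of \<open>N\<close> at one generic point,
  and Kronecker substitution turns this into an identity of polynomials.\<close>

lemma det_lmat:
  fixes \<iota> :: "'f \<Rightarrow> 'r::comm_ring_1"
  assumes hom: "comm_ring_hom \<iota>" and x: "x \<in> fvecs n"
  shows "det (lmat \<iota> x) = N \<iota> x ^ (n div 3)"
proof -
  define v :: "nat \<Rightarrow> 'f mpoly" where "v i = (if i < n then mvar i else 0)" for i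
  define P where "P = det (lmat mconst v) - N mconst v ^ (n div 3)"
  have subst: "subst_mpoly \<eta> r P = det (lmat \<eta> (\<lambda>i. if i < n then r i else 0))
      - N \<eta> (\<lambda>i. if i < n then r i else 0) ^ (n div 3)" if \<eta>: "comm_ring_hom \<eta>"
    for \<eta> :: "'f \<Rightarrow> 's::comm_ring_1" and r
  proof -
    interpret \<eta>: comm_ring_hom \<eta> by (rule \<eta>)
    have s: "comm_ring_hom (subst_mpoly \<eta> r)" by (rule \<eta>.comm_ring_hom_subst_mpoly)
    interpret s: comm_ring_hom "subst_mpoly \<eta> r" by (rule s)
    have "(\<lambda>i. subst_mpoly \<eta> r (v i)) = (\<lambda>i. if i < n then r i else 0)"
      by (auto simp: v_def)
    then show ?thesis
      using det_lmat_hom[OF s, where \<iota> = mconst and x = v] N_hom[OF s, where \<iota> = mconst and x = v]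
      by (simp add: P_def s.hom_minus s.hom_power)
  qed
  have "P = 0"
  proof (rule Kronecker_substitution)
    fix B :: nat assume "2 \<le> B"
    have "(\<lambda>i. if i < n then Polynomial.monom 1 (B ^ i) else 0) = generic B"
      by (auto simp: generic_def)
    then show "subst_mpoly (\<lambda>c. [:c:]) (\<lambda>i. Polynomial.monom 1 (B ^ i)) P = 0"
      using subst[OF comm_ring_hom_const] det_lmat_generic(2)[OF \<open>2 \<le> B\<close>] by simp
  qed
  moreover have "(\<lambda>i. if i < n then x i else 0) = x"
    using x by (auto simp: fvecs_def)
  ultimately show ?thesis
    using subst[OF hom, of x] by (simp add: subst_mpoly_def)
qed

text \<open>Quotients of nonzero values of the norm are values. If the norm of \<open>s\<close>
  vanishes at \<open>t\<close>, then so does that of \<open>y\<close>, and anisotropy makes both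
  vectors divisible by the linear factor at \<open>t\<close>; its cube cancels and the degree of
  \<open>s\<close> drops.\<close>

lemma norm_descent:
  fixes y s :: "nat \<Rightarrow> 'f poly"
  assumes "y \<in> fvecs n" "s \<in> fvecs n" "s \<noteq> 0" "N (\<lambda>c. [:c:]) y = N (\<lambda>c. [:c:]) s * g"
  shows "\<exists>w\<in>fvecs n. N (\<lambda>c. c) w = poly g t"
  using assms
proof (induction "total_degree s" arbitrary: y s rule: less_induct)
  case less
  have eval: "(\<lambda>i. poly (y i) t) \<in> fvecs n" if "y \<in> fvecs n" for y :: "nat \<Rightarrow> 'f poly"
    using that by (simp add: fvecs_def)
  show ?case
  proof (cases "poly (N (\<lambda>c. [:c:]) s) t = 0")
    case False
    define \<alpha> where "\<alpha> = poly (N (\<lambda>c. [:c:]) s) t"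
    define y0 s0 where "y0 = (\<lambda>i. poly (y i) t)" and "s0 = (\<lambda>i. poly (s i) t)"
    have V: "y0 \<in> fvecs n" "s0 \<in> fvecs n"
      unfolding y0_def s0_def by (rule eval[OF less.prems(1)], rule eval[OF less.prems(2)])
    have Ns: "N (\<lambda>c. c) s0 = \<alpha>" and Ny: "N (\<lambda>c. c) y0 = \<alpha> * poly g t"
      using arg_cong[OF less.prems(4), of "\<lambda>p. poly p t"]
      by (simp_all add: N_poly_eval s0_def y0_def \<alpha>_def)
    \<comment> \<open>Division by \<alpha> is multiplication by \<alpha>^2 and by the inverse cube
      of \<alpha>: the former is the norm of the square of \<open>s0\<close>, the latter the effect
      of the scalar.\<close>
    define w where "w = fscale (inverse \<alpha>) (mulR (\<lambda>c. c) (mulR (\<lambda>c. c) s0 s0) y0)"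
    have mult: "N (\<lambda>c. c) (mulR (\<lambda>c. c) u v) = N (\<lambda>c. c) u * N (\<lambda>c. c) v" if "u \<in> fvecs n" "v \<in> fvecs n" for u v
      using norm_mult[OF that] by (simp add: N_def)
    have "N (\<lambda>c. c) w = inverse \<alpha> ^ 3 * (\<alpha> * \<alpha> * (\<alpha> * poly g t))"
      using V by (simp add: w_def N_fscale mult Ns Ny)
    also have "\<dots> = poly g t"
      using False by (simp add: \<alpha>_def[symmetric] power3_eq_cube field_simps)
    finally have "N (\<lambda>c. c) w = poly g t" .
    moreover have "w \<in> fvecs n" by (simp add: w_def)
    ultimately show ?thesis by blast
  next
    case True
    obtain s' where s': "s' \<in> fvecs n" "s = fscale [:- t, 1:] s'"
      by (rule root_imp_dvd[OF less.prems(2) True])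
    have "poly (N (\<lambda>c. [:c:]) y) t = 0"
      using True less.prems(4) by simp
    then obtain y' where y': "y' \<in> fvecs n" "y = fscale [:- t, 1:] y'"
      by (rule root_imp_dvd[OF less.prems(1)])
    have nz: "s' \<noteq> 0"
    proof
      assume "s' = 0"
      then have "s = 0" unfolding s'(2) by (intro ext) simp
      with less.prems(3) show False ..
    qed
    have cube: "[:- t, 1 :: 'f:] ^ 3 \<noteq> 0" by (intro power_not_zero) simp
    have "[:- t, 1:] ^ 3 * N (\<lambda>c. [:c:]) y' = [:- t, 1:] ^ 3 * (N (\<lambda>c. [:c:]) s' * g)"
      using less.prems(4) unfolding y'(2) s'(2) N_fscale by (simp only: mult.assoc)
    then have eq: "N (\<lambda>c. [:c:]) y' = N (\<lambda>c. [:c:]) s' * g"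
      by (rule mult_left_cancel[OF cube, THEN iffD1])
    have less_degree: "total_degree s' < total_degree s"
      unfolding s'(2) by (rule total_degree_less[OF s'(1) nz])
    show ?thesis
      by (rule less.hyps[OF less_degree y'(1) s'(1) nz eq])
  qed
qed

end

section \<open>Block matrices\<close>

definition block_mat :: "nat \<Rightarrow> nat \<Rightarrow> nat \<Rightarrow> (nat \<Rightarrow> nat \<Rightarrow> 'r mat) \<Rightarrow> 'r mat" where
  "block_mat d r c Y = mat (r * d) (c * d) (\<lambda>(i, j). Y (i div d) (j div d) $$ (i mod d, j mod d))"

lemma block_mat_carrier [simp]: "block_mat d r c Y \<in> carrier_mat (r * d) (c * d)"
  "dim_row (block_mat d r c Y) = r * d" "dim_col (block_mat d r c Y) = c * d"
  by (simp_all add: block_mat_def)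

lemma block_mat_index:
  "i < r * d \<Longrightarrow> j < c * d \<Longrightarrow>
    block_mat d r c Y $$ (i, j) = Y (i div d) (j div d) $$ (i mod d, j mod d)"
  by (simp add: block_mat_def)

lemma block_index: "i < r * d \<Longrightarrow> i div d < (r::nat)" "i < r * d \<Longrightarrow> i mod d < (d::nat)"
  by (auto simp: less_mult_imp_div_less intro!: mod_less_divisor intro: gr0I)

lemma block_mat_cong:
  assumes "\<And>i j. i < r \<Longrightarrow> j < c \<Longrightarrow> Y i j = Z i j"
  shows "block_mat d r c Y = block_mat d r c Z"
  unfolding block_mat_def by (rule cong_mat) (auto simp: assms block_index)

lemma sum_blocks: "(\<Sum>i<k * d. g i) = (\<Sum>l<k. \<Sum>b<d. g (l * d + b))" for d :: nat
proof -
  have "(\<Sum>l<k. \<Sum>b<d. g (l * d + b)) = (\<Sum>l<k. sum g {l * d..<l * d + d})"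
  proof (rule sum.cong[OF refl])
    fix l
    have "sum g {l * d..<l * d + d} = (\<Sum>b = 0..<d. g (b + l * d))"
      using sum.shift_bounds_nat_ivl[of g 0 "l * d" d] by (simp add: add.commute)
    then show "(\<Sum>b<d. g (l * d + b)) = sum g {l * d..<l * d + d}"
      by (simp add: lessThan_atLeast0 add.commute)
  qed
  also have "\<dots> = (\<Sum>i<k * d. g i)" by (rule sum.nat_group)
  finally show ?thesis by simp
qed

lemma mat_entries_eqI:
  assumes "A \<in> carrier_mat r c" "B \<in> carrier_mat r c"
    and "\<And>i j. i < r \<Longrightarrow> j < c \<Longrightarrow> A $$ (i, j) = B $$ (i, j)"
  shows "A = B"
  using assms by (intro eq_matI) auto

lemma carrier_entry:
  assumes "A \<in> carrier_mat r c" "i < r" "j < c"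
  shows "(- A) $$ (i, j) = - (A $$ (i, j) :: 'r::ab_group_add)" "(B - A) $$ (i, j) = B $$ (i, j) - A $$ (i, j)"
  using assms by auto

lemma mat_mult_index:
  assumes "A \<in> carrier_mat d d" "B \<in> carrier_mat d d" "a < d" "b < d"
  shows "(A * B) $$ (a, b) = (\<Sum>l<d. A $$ (a, l) * B $$ (l, b))"
  using assms by (simp add: scalar_prod_def lessThan_atLeast0)

text \<open>The product is described entrywise, so that the sum over block indices is taken in the
  ring of entries.\<close>

lemma block_mat_mult:
  fixes Y Z :: "nat \<Rightarrow> nat \<Rightarrow> 'r::comm_ring_1 mat"
  assumes Y: "\<And>i l. i < r \<Longrightarrow> l < k \<Longrightarrow> Y i l \<in> carrier_mat d d"
    and Z: "\<And>l j. l < k \<Longrightarrow> j < c \<Longrightarrow> Z l j \<in> carrier_mat d d"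
  shows "block_mat d r k Y * block_mat d k c Z
    = mat (r * d) (c * d) (\<lambda>(i, j). \<Sum>l<k. (Y (i div d) l * Z l (j div d)) $$ (i mod d, j mod d))"
proof (rule mat_entries_eqI[of _ "r * d" "c * d"])
  fix i j assume ij: "i < r * d" "j < c * d"
  then have d: "0 < d" by (auto intro: gr0I)
  have lb: "l * d + b < k * d" if "l < k" "b < d" for l b
  proof -
    have "Suc l * d \<le> k * d" using that by (intro mult_le_mono1) simp
    then show ?thesis using that by simp
  qed
  have "(block_mat d r k Y * block_mat d k c Z) $$ (i, j)
    = (\<Sum>m<k * d. block_mat d r k Y $$ (i, m) * block_mat d k c Z $$ (m, j))"
    using ij by (simp add: scalar_prod_def lessThan_atLeast0)
  also have "\<dots> = (\<Sum>l<k. \<Sum>b<d. Y (i div d) l $$ (i mod d, b) * Z l (j div d) $$ (b, j mod d))"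
    unfolding sum_blocks using ij d lb by (intro sum.cong refl) (simp add: block_mat_def)
  also have "\<dots> = (\<Sum>l<k. (Y (i div d) l * Z l (j div d)) $$ (i mod d, j mod d))"
  proof (rule sum.cong[OF refl])
    fix l assume "l \<in> {..<k}"
    then have l: "l < k" by simp
    have "Y (i div d) l \<in> carrier_mat d d" "Z l (j div d) \<in> carrier_mat d d"
      by (rule Y[OF block_index(1)[OF ij(1)] l], rule Z[OF l block_index(1)[OF ij(2)]])
    then show "(\<Sum>b<d. Y (i div d) l $$ (i mod d, b) * Z l (j div d) $$ (b, j mod d))
      = (Y (i div d) l * Z l (j div d)) $$ (i mod d, j mod d)"
      by (rule mat_mult_index[symmetric]) (simp_all only: mod_less_divisor[OF d])
  qed
  finally show "(block_mat d r k Y * block_mat d k c Z) $$ (i, j)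
      = mat (r * d) (c * d) (\<lambda>(i, j). \<Sum>l<k. (Y (i div d) l * Z l (j div d)) $$ (i mod d, j mod d)) $$ (i, j)"
    using ij by simp
qed (auto intro: mult_carrier_mat[of _ _ "k * d"])

lemma block_mat_Suc:
  assumes "0 < d" "Y 0 0 \<in> carrier_mat d d"
  shows "block_mat d (Suc r) (Suc c) Y = four_block_mat (Y 0 0) (block_mat d 1 c (\<lambda>i j. Y 0 (Suc j)))
    (block_mat d r 1 (\<lambda>i j. Y (Suc i) 0)) (block_mat d r c (\<lambda>i j. Y (Suc i) (Suc j)))"
proof (rule mat_entries_eqI[of _ "Suc r * d" "Suc c * d"])
  fix i j assume ij: "i < Suc r * d" "j < Suc c * d"
  have dims: "dim_row (Y 0 0) = d" "dim_col (Y 0 0) = d" using assms(2) by auto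
  have split: "k < d \<or> (\<exists>k'<s * d. k = d + k')" if "k < Suc s * d" for k s
  proof (cases "k < d")
    case False
    then have "k - d < s * d" "k = d + (k - d)" using that by simp_all
    then show ?thesis by blast
  qed simp
  note i = split[OF ij(1)] and j = split[OF ij(2)]
  have q: "(d + k) div d = Suc (k div d)" "(d + k) mod d = k mod d" for k
    using assms(1) by simp_all
  have q0: "k div d = 0" "k mod d = k" if "k < d" for k using that by simp_all
  let ?B = "block_mat d 1 c (\<lambda>i j. Y 0 (Suc j))" and ?G = "block_mat d r 1 (\<lambda>i j. Y (Suc i) 0)"
    and ?E = "block_mat d r c (\<lambda>i j. Y (Suc i) (Suc j))"
  have F: "four_block_mat (Y 0 0) ?B ?G ?E $$ (i, j) = (if i < d
      then if j < d then Y 0 0 $$ (i, j) else ?B $$ (i, j - d)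
      else if j < d then ?G $$ (i - d, j) else ?E $$ (i - d, j - d))"
    using ij by (subst index_mat_four_block) (simp_all add: dims)
  have L: "block_mat d (Suc r) (Suc c) Y $$ (i, j) = Y (i div d) (j div d) $$ (i mod d, j mod d)"
    by (rule block_mat_index[OF ij])
  show "block_mat d (Suc r) (Suc c) Y $$ (i, j) = four_block_mat (Y 0 0) ?B ?G ?E $$ (i, j)"
  proof (cases "i < d")
    case True
    note i0 = this
    show ?thesis
    proof (cases "j < d")
      case True
      show ?thesis unfolding F L by (simp only: i0 True q0 if_True)
    next
      case False
      then obtain j' where j': "j' < c * d" "j = d + j'" using j by blast
      have "?B $$ (i, j') = Y 0 (Suc (j' div d)) $$ (i mod d, j' mod d)"
        using i0 j'(1) by (subst block_mat_index) (simp_all only: mult_1 q0(1))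
      then show ?thesis unfolding F L using i0 False
        by (simp only: j'(2) q q0(1)[OF i0] if_True if_False diff_add_inverse)
    qed
  next
    case False
    note i0 = this
    then obtain i' where i': "i' < r * d" "i = d + i'" using i by blast
    show ?thesis
    proof (cases "j < d")
      case True
      have "?G $$ (i', j) = Y (Suc (i' div d)) 0 $$ (i' mod d, j mod d)"
        using True i'(1) by (subst block_mat_index) (simp_all only: mult_1 q0(1))
      then show ?thesis unfolding F L using i0 True
        by (simp only: i'(2) q q0(1)[OF True] if_True if_False diff_add_inverse)
    next
      case False
      then obtain j' where j': "j' < c * d" "j = d + j'" using j by blast
      have "?E $$ (i', j') = Y (Suc (i' div d)) (Suc (j' div d)) $$ (i' mod d, j' mod d)"
        by (rule block_mat_index[OF i'(1) j'(1)])
      then show ?thesis unfolding F L using i0 False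
        by (simp only: i'(2) j'(2) q if_False diff_add_inverse)
    qed
  qed
next
  show "four_block_mat (Y 0 0) (block_mat d 1 c (\<lambda>i j. Y 0 (Suc j))) (block_mat d r 1 (\<lambda>i j. Y (Suc i) 0))
      (block_mat d r c (\<lambda>i j. Y (Suc i) (Suc j))) \<in> carrier_mat (Suc r * d) (Suc c * d)"
    unfolding mult_Suc by (rule four_block_carrier_mat[OF assms(2) block_mat_carrier(1)])
qed (rule block_mat_carrier(1))

abbreviation block_diag :: "nat \<Rightarrow> nat \<Rightarrow> 'r::zero mat \<Rightarrow> 'r mat" where
  "block_diag d m D \<equiv> block_mat d m m (\<lambda>i j. if i = j then D else 0\<^sub>m d d)"

lemma det_block_diag:
  fixes D :: "'r::idom mat"
  assumes d: "0 < d" and D: "D \<in> carrier_mat d d"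
  shows "det (block_diag d m D) = det D ^ m"
proof (induction m)
  case 0
  show ?case unfolding power_0 by (rule det_dim_zero) (simp add: block_mat_def)
next
  case (Suc m)
  have z: "block_mat d 1 m (\<lambda>i j. 0\<^sub>m d d) = 0\<^sub>m d (m * d)" "block_mat d m 1 (\<lambda>i j. 0\<^sub>m d d) = 0\<^sub>m (m * d) d"
    using d by (auto intro!: eq_matI simp: block_mat_def)
  have "block_diag d (Suc m) D = four_block_mat D (0\<^sub>m d (m * d)) (0\<^sub>m (m * d) d) (block_diag d m D)"
    using D d by (subst block_mat_Suc) (simp_all add: z[unfolded One_nat_def])
  also have "det \<dots> = det D * det (block_diag d m D)"
    by (rule det_four_block_mat_lower_left_zero) (use D in auto)
  finally show ?case using Suc by simp
qed

text \<open>Division-free elimination of the first block column, with \<open>P'\<close> in the role of an adjugate of the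
  pivot \<open>Y 0 0\<close>.\<close>

lemma det_block_elimination:
  fixes Y :: "nat \<Rightarrow> nat \<Rightarrow> 'r::idom mat"
  assumes d: "0 < d" and Y: "\<And>i j. i \<le> m \<Longrightarrow> j \<le> m \<Longrightarrow> Y i j \<in> carrier_mat d d"
    and P': "P' \<in> carrier_mat d d" and D: "P' * Y 0 0 = D"
    and comm: "\<And>i. i \<le> m \<Longrightarrow> D * Y i 0 = Y i 0 * D"
  shows "det D ^ m * det (block_mat d (Suc m) (Suc m) Y) = det (Y 0 0) *
    det (block_mat d m m (\<lambda>i j. D * Y (Suc i) (Suc j) - Y (Suc i) 0 * P' * Y 0 (Suc j)))"
proof -
  \<comment> \<open>The multiplier \<open>?L\<close> is block lower triangular with determinant
    \<open>det D ^ m\<close>. Its column \<open>?C\<close> clears the first block column, because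
    \<open>Y (Suc i) 0 * P' * Y 0 0\<close> equals \<open>Y (Suc i) 0 * D\<close> and
    \<open>D\<close> commutes with these blocks.\<close>
  let ?C = "block_mat d m 1 (\<lambda>i j. - (Y (Suc i) 0 * P'))"
  let ?L = "four_block_mat (1\<^sub>m d) (0\<^sub>m d (m * d)) ?C (block_diag d m D)"
  let ?R = "block_mat d m m (\<lambda>i j. D * Y (Suc i) (Suc j) - Y (Suc i) 0 * P' * Y 0 (Suc j))"
  let ?B = "block_mat d 1 m (\<lambda>i j. Y 0 (Suc j))"
  let ?G = "block_mat d m 1 (\<lambda>i j. Y (Suc i) 0)"
  let ?E = "block_mat d m m (\<lambda>i j. Y (Suc i) (Suc j))"
  have Dc: "D \<in> carrier_mat d d" using D P' Y[of 0 0] by auto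
  have Y0: "Y 0 0 \<in> carrier_mat d d" using Y by simp
  have carr: "?C \<in> carrier_mat (m * d) d" "?B \<in> carrier_mat d (m * d)" "?G \<in> carrier_mat (m * d) d"
    using block_mat_carrier(1)[of d m 1] block_mat_carrier(1)[of d 1 m] by (metis mult_1)+
  have YP: "Y (Suc i) 0 * P' \<in> carrier_mat d d" if "i < m" for i
    using mult_carrier_mat[OF Y[of "Suc i" 0] P'] that by simp
  have DY: "D * Y i j \<in> carrier_mat d d" if "i \<le> m" "j \<le> m" for i j
    by (rule mult_carrier_mat[OF Dc Y[OF that]])
  have Y00: "Y 0 0 = block_mat d 1 1 (\<lambda>i j. Y 0 0)"
    using Y0 by (intro eq_matI) (auto simp: block_mat_def)
  have diag: "block_diag d m D * block_mat d m c Z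
      = block_mat d m c (\<lambda>i j. D * Z i j)" if Z: "\<And>i j. i < m \<Longrightarrow> j < c \<Longrightarrow> Z i j \<in> carrier_mat d d" for c Z
  proof -
    have "block_diag d m D * block_mat d m c Z = mat (m * d) (c * d) (\<lambda>(i, j). \<Sum>l<m.
        ((if i div d = l then D else 0\<^sub>m d d) * Z l (j div d)) $$ (i mod d, j mod d))"
      by (rule block_mat_mult) (use Dc Z in auto)
    also have "\<dots> = block_mat d m c (\<lambda>i j. D * Z i j)"
      unfolding block_mat_def[of d m c]
    proof (rule cong_mat)
      fix i j assume ij: "i < m * d" "j < c * d"
      have "((if i div d = l then D else 0\<^sub>m d d) * Z l (j div d)) $$ (i mod d, j mod d)
        = (if i div d = l then (D * Z l (j div d)) $$ (i mod d, j mod d) else 0)" if "l < m" for l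
        using Z[OF that block_index(1)[OF ij(2)]] block_index(2)[OF ij(1)] block_index(2)[OF ij(2)]
        by (simp add: left_mult_zero_mat)
      then show "(case (i, j) of (i, j) \<Rightarrow> \<Sum>l<m. ((if i div d = l then D else 0\<^sub>m d d) * Z l (j div d)) $$ (i mod d, j mod d))
        = (case (i, j) of (i, j) \<Rightarrow> (D * Z (i div d) (j div d)) $$ (i mod d, j mod d))"
        using block_index(1)[OF ij(1)] by simp
    qed simp_all
    finally show ?thesis .
  qed
  have one: "block_mat d m 1 U * block_mat d 1 c Z = block_mat d m c (\<lambda>i j. U i 0 * Z 0 j)"
    if "\<And>i. i < m \<Longrightarrow> U i 0 \<in> carrier_mat d d" "\<And>j. j < c \<Longrightarrow> Z 0 j \<in> carrier_mat d d"
    for U Z :: "nat \<Rightarrow> nat \<Rightarrow> 'r mat" and c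
    by (subst block_mat_mult) (use that in \<open>auto simp: block_mat_def\<close>)
  have low: "?C * Y 0 0 + block_diag d m D * ?G = 0\<^sub>m (m * d) d"
  proof -
    have "?C * Y 0 0 = block_mat d m 1 (\<lambda>i j. - (Y (Suc i) 0 * P') * Y 0 0)"
    proof -
      have "?C * block_mat d 1 1 (\<lambda>i j. Y 0 0) = block_mat d m 1 (\<lambda>i j. - (Y (Suc i) 0 * P') * Y 0 0)"
        by (rule one) (auto simp: Y YP DY)
      then show ?thesis by (simp only: Y00[symmetric])
    qed
    moreover have "- (Y (Suc i) 0 * P') * Y 0 0 = - (D * Y (Suc i) 0)" if "i < m" for i
    proof -
      have Yi: "Y (Suc i) 0 \<in> carrier_mat d d" using Y that by simp
      have "- (Y (Suc i) 0 * P') * Y 0 0 = - (Y (Suc i) 0 * P' * Y 0 0)"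
        using Yi P' Y0 by (intro uminus_mult_left_mat) auto
      also have "Y (Suc i) 0 * P' * Y 0 0 = Y (Suc i) 0 * D"
        using Yi P' Y0 D by (simp add: assoc_mult_mat[of _ d d _ d _ d])
      finally show ?thesis using comm[of "Suc i"] that by simp
    qed
    ultimately have C: "?C * Y 0 0 = block_mat d m 1 (\<lambda>i j. - (D * Y (Suc i) 0))"
      by (simp cong: block_mat_cong)
    have G: "block_diag d m D * ?G = block_mat d m 1 (\<lambda>i j. D * Y (Suc i) 0)"
      by (rule diag) (auto simp: Y YP DY)
    show ?thesis unfolding C G
    proof (rule mat_entries_eqI[of _ "m * d" d])
      fix i j assume ij: "i < m * d" "j < d"
      then have "Suc (i div d) \<le> m" using block_index(1)[OF ij(1)] by simp
      then have "(- (D * Y (Suc (i div d)) 0)) $$ (i mod d, j) = - ((D * Y (Suc (i div d)) 0) $$ (i mod d, j))"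
        by (rule carrier_entry(1)[OF DY[OF _ le0] block_index(2)[OF ij(1)] ij(2)])
      then show "(block_mat d m 1 (\<lambda>i j. - (D * Y (Suc i) 0)) +
          block_mat d m 1 (\<lambda>i j. D * Y (Suc i) 0)) $$ (i, j) = 0\<^sub>m (m * d) d $$ (i, j)"
        using ij by (simp add: block_mat_def del: index_uminus_mat index_mult_mat)
    qed auto
  qed
  have right: "?C * ?B + block_diag d m D * ?E = ?R"
  proof -
    have CB: "?C * ?B = block_mat d m m (\<lambda>i j. - (Y (Suc i) 0 * P') * Y 0 (Suc j))"
      by (rule one) (auto simp: Y YP DY)
    have DE: "block_diag d m D * ?E = block_mat d m m (\<lambda>i j. D * Y (Suc i) (Suc j))"
      by (rule diag) (auto simp: Y YP DY)
    show ?thesis unfolding CB DE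
    proof (rule mat_entries_eqI[of _ "m * d" "m * d"])
      fix i j assume ij: "i < m * d" "j < m * d"
      have c: "Y (Suc (i div d)) 0 \<in> carrier_mat d d" "Y 0 (Suc (j div d)) \<in> carrier_mat d d"
        "Y (Suc (i div d)) (Suc (j div d)) \<in> carrier_mat d d"
        using Y[of "Suc (i div d)" 0] Y[of 0 "Suc (j div d)"] Y[of "Suc (i div d)" "Suc (j div d)"]
          block_index(1)[OF ij(1)] block_index(1)[OF ij(2)] by simp_all
      have "- (Y (Suc (i div d)) 0 * P') * Y 0 (Suc (j div d)) = - (Y (Suc (i div d)) 0 * P' * Y 0 (Suc (j div d)))"
        using c P' by (intro uminus_mult_left_mat) auto
      moreover have "Y (Suc (i div d)) 0 * P' * Y 0 (Suc (j div d)) \<in> carrier_mat d d"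
        "D * Y (Suc (i div d)) (Suc (j div d)) \<in> carrier_mat d d"
        using c P' Dc by (auto intro!: mult_carrier_mat)
      ultimately have e: "(- (Y (Suc (i div d)) 0 * P') * Y 0 (Suc (j div d))) $$ (i mod d, j mod d)
          = - ((Y (Suc (i div d)) 0 * P' * Y 0 (Suc (j div d))) $$ (i mod d, j mod d))"
        "(D * Y (Suc (i div d)) (Suc (j div d)) - Y (Suc (i div d)) 0 * P' * Y 0 (Suc (j div d))) $$ (i mod d, j mod d)
          = (D * Y (Suc (i div d)) (Suc (j div d))) $$ (i mod d, j mod d)
            - (Y (Suc (i div d)) 0 * P' * Y 0 (Suc (j div d))) $$ (i mod d, j mod d)"
        using carrier_entry[OF _ block_index(2)[OF ij(1)] block_index(2)[OF ij(2)]] by metis+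
      show "(block_mat d m m (\<lambda>i j. - (Y (Suc i) 0 * P') * Y 0 (Suc j)) +
          block_mat d m m (\<lambda>i j. D * Y (Suc i) (Suc j))) $$ (i, j) = ?R $$ (i, j)"
        using ij by (simp add: block_mat_def e del: index_uminus_mat index_mult_mat index_minus_mat)
    qed auto
  qed
  have "?L * block_mat d (Suc m) (Suc m) Y = four_block_mat (1\<^sub>m d) (0\<^sub>m d (m * d)) ?C (block_diag d m D) *
      four_block_mat (Y 0 0) ?B ?G ?E"
    using d Y0 by (simp add: block_mat_Suc)
  also have "\<dots> = four_block_mat (1\<^sub>m d * Y 0 0 + 0\<^sub>m d (m * d) * ?G) (1\<^sub>m d * ?B + 0\<^sub>m d (m * d) * ?E)
      (?C * Y 0 0 + block_diag d m D * ?G) (?C * ?B + block_diag d m D * ?E)"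
    by (rule mult_four_block_mat) (use Y0 carr in auto)
  also have "\<dots> = four_block_mat (Y 0 0) ?B (0\<^sub>m (m * d) d) ?R"
    unfolding low right
    using Y0 carr by (simp add: left_mult_zero_mat[of _ "m * d"])
  finally have "det (?L * block_mat d (Suc m) (Suc m) Y) = det (four_block_mat (Y 0 0) ?B (0\<^sub>m (m * d) d) ?R)"
    by simp
  also have "\<dots> = det (Y 0 0) * det ?R"
    by (rule det_four_block_mat_lower_left_zero) (use Y0 carr in auto)
  also have "det (?L * block_mat d (Suc m) (Suc m) Y) = det ?L * det (block_mat d (Suc m) (Suc m) Y)"
    by (rule det_mult[OF _ block_mat_carrier(1)])
      (unfold mult_Suc, rule four_block_carrier_mat[OF one_carrier_mat block_mat_carrier(1)])
  also have "det ?L = det (1\<^sub>m d) * det (block_diag d m D)"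
    by (rule det_four_block_mat_upper_right_zero) (use carr in auto)
  also have "\<dots> = det D ^ m"
    using det_block_diag[OF d Dc] by simp
  finally show ?thesis .
qed

lemma det_permute_both:
  fixes A :: "'r::comm_ring_1 mat"
  assumes A: "A \<in> carrier_mat k k" and p: "p permutes {0..<k}"
  shows "det (mat k k (\<lambda>(i, j). A $$ (p i, p j))) = det A"
proof -
  have lt: "p i < k" if "i < k" for i using permutes_in_image[OF p, of i] that by simp
  let ?B = "mat k k (\<lambda>(i, j). A $$ (p i, j))"
  have "transpose_mat (mat k k (\<lambda>(i, j). A $$ (p i, p j))) = mat k k (\<lambda>(i, j). transpose_mat ?B $$ (p i, j))"
    by (rule eq_matI) (auto simp: lt)
  then have "det (transpose_mat (mat k k (\<lambda>(i, j). A $$ (p i, p j)))) = signof p * det (transpose_mat ?B)"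
    using det_permute_rows[of "transpose_mat ?B" k p] p by simp
  then have "det (mat k k (\<lambda>(i, j). A $$ (p i, p j))) = signof p * det ?B"
    by (simp add: det_transpose[of _ k])
  also have "det ?B = signof p * det A"
    by (rule det_permute_rows[OF A p])
  also have "signof p * (signof p * det A) = det A"
    by (cases "evenperm p") (simp_all add: sign_def)
  finally show ?thesis .
qed

text \<open>Exchanging inner and outer indices permutes rows and columns by the same permutation,
  whose sign enters twice.\<close>

lemma det_block_swap:
  fixes F :: "nat \<Rightarrow> nat \<Rightarrow> nat \<Rightarrow> nat \<Rightarrow> 'r::comm_ring_1"
  shows "det (block_mat d m m (\<lambda>p q. mat d d (\<lambda>(a, b). F p q a b)))
       = det (block_mat m d d (\<lambda>a b. mat m m (\<lambda>(p, q). F p q a b)))"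
proof -
  \<comment> \<open>The position with outer index p and inner index a goes from
    \<open>p * d + a\<close> to \<open>a * m + p\<close>; positions outside the range are fixed, as
    \<open>permutes\<close> demands.\<close>
  define \<pi> where "\<pi> i = (if i < m * d then (i mod d) * m + i div d else i)" for i
  have lt: "(i mod d) * m + i div d < d * m" if "i < m * d" for i
  proof -
    have "i div d < m" "i mod d < d" using block_index[OF that] by simp_all
    then have "(i mod d) * m + i div d < Suc (i mod d) * m" "Suc (i mod d) * m \<le> d * m"
      by (simp, intro mult_le_mono1, simp)
    then show ?thesis by (rule less_le_trans)
  qed
  have dm: "((i mod d) * m + i div d) div m = i mod d" "((i mod d) * m + i div d) mod m = i div d"
    if "i < m * d" for i
    using block_index(1)[OF that] by simp_all
  have "inj_on \<pi> {0..<m * d}"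
  proof (rule inj_onI)
    fix i j assume ij: "i \<in> {0..<m * d}" "j \<in> {0..<m * d}" "\<pi> i = \<pi> j"
    then have e: "(i mod d) * m + i div d = (j mod d) * m + j div d" by (simp add: \<pi>_def)
    have "i mod d = j mod d" "i div d = j div d"
      using dm[of i] dm[of j] ij e by (metis atLeastLessThan_iff)+
    then show "i = j" by (metis div_mult_mod_eq)
  qed
  moreover have "\<pi> ` {0..<m * d} \<subseteq> {0..<m * d}"
    using lt by (auto simp: \<pi>_def mult.commute)
  ultimately have "bij_betw \<pi> {0..<m * d} {0..<m * d}"
    unfolding bij_betw_def using endo_inj_surj[of "{0..<m * d}" \<pi>] by blast
  then have perm: "\<pi> permutes {0..<m * d}"
    by (rule bij_imp_permutes) (simp add: \<pi>_def)
  let ?A = "block_mat m d d (\<lambda>a b. mat m m (\<lambda>(p, q). F p q a b))"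
  have A: "?A \<in> carrier_mat (m * d) (m * d)"
    using block_mat_carrier(1)[of m d d] by (simp only: mult.commute)
  have "block_mat d m m (\<lambda>p q. mat d d (\<lambda>(a, b). F p q a b)) = mat (m * d) (m * d) (\<lambda>(i, j). ?A $$ (\<pi> i, \<pi> j))"
  proof (rule mat_entries_eqI[of _ "m * d" "m * d"])
    fix i j assume ij: "i < m * d" "j < m * d"
    note b = block_index[OF ij(1)] block_index[OF ij(2)]
    have "?A $$ (\<pi> i, \<pi> j) = F (i div d) (j div d) (i mod d) (j mod d)"
      using ij b unfolding \<pi>_def by (subst block_mat_index) (simp_all add: lt dm)
    then show "block_mat d m m (\<lambda>p q. mat d d (\<lambda>(a, b). F p q a b)) $$ (i, j)
        = mat (m * d) (m * d) (\<lambda>(i, j). ?A $$ (\<pi> i, \<pi> j)) $$ (i, j)"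
      using ij b by (simp add: block_mat_index)
  qed simp_all
  then show ?thesis using det_permute_both[OF A perm] by simp
qed

text \<open>Elimination runs in a ring (the set \<open>A\<close>) but is read off in two matrix representations. The
  predicate \<open>U\<close> stands for "reduces to one" and \<open>Z\<close> for "reduces to zero"; it keeps all pivots nonzero.\<close>

locale elimination =
  fixes A :: "'a set" and U Z :: "'a \<Rightarrow> bool"
    and mul sub :: "'a \<Rightarrow> 'a \<Rightarrow> 'a" and one :: 'a
    and \<rho> :: "'a \<Rightarrow> 's::idom mat" and \<sigma> :: "'a \<Rightarrow> 't::idom mat" and d d' :: nat
  assumes d: "0 < d" "0 < d'"
    and \<rho>: "x \<in> A \<Longrightarrow> \<rho> x \<in> carrier_mat d d" and \<sigma>: "x \<in> A \<Longrightarrow> \<sigma> x \<in> carrier_mat d' d'"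
    and mul: "x \<in> A \<Longrightarrow> y \<in> A \<Longrightarrow> mul x y \<in> A"
      "x \<in> A \<Longrightarrow> y \<in> A \<Longrightarrow> \<rho> (mul x y) = \<rho> x * \<rho> y" "x \<in> A \<Longrightarrow> y \<in> A \<Longrightarrow> \<sigma> (mul x y) = \<sigma> x * \<sigma> y"
    and sub: "x \<in> A \<Longrightarrow> y \<in> A \<Longrightarrow> sub x y \<in> A"
      "x \<in> A \<Longrightarrow> y \<in> A \<Longrightarrow> \<rho> (sub x y) = \<rho> x - \<rho> y" "x \<in> A \<Longrightarrow> y \<in> A \<Longrightarrow> \<sigma> (sub x y) = \<sigma> x - \<sigma> y"
    and one: "one \<in> A" "\<rho> one = 1\<^sub>m d" "\<sigma> one = 1\<^sub>m d'" "U one"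
    and U_mul: "x \<in> A \<Longrightarrow> y \<in> A \<Longrightarrow> U x \<Longrightarrow> U y \<Longrightarrow> U (mul x y)"
    and Z_mul: "x \<in> A \<Longrightarrow> y \<in> A \<Longrightarrow> Z x \<or> Z y \<Longrightarrow> Z (mul x y)"
    and U_sub: "x \<in> A \<Longrightarrow> y \<in> A \<Longrightarrow> U x \<Longrightarrow> Z y \<Longrightarrow> U (sub x y)"
    and Z_sub: "x \<in> A \<Longrightarrow> y \<in> A \<Longrightarrow> Z x \<Longrightarrow> Z y \<Longrightarrow> Z (sub x y)"
    and pivot: "p \<in> A \<Longrightarrow> U p \<Longrightarrow> \<exists>p'\<in>A. \<exists>\<delta>\<in>A. U \<delta> \<and> \<rho> p' * \<rho> p = \<rho> \<delta> \<and> \<sigma> p' * \<sigma> p = \<sigma> \<delta> \<and>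
      (\<forall>x\<in>A. \<rho> \<delta> * \<rho> x = \<rho> x * \<rho> \<delta> \<and> \<sigma> \<delta> * \<sigma> x = \<sigma> x * \<sigma> \<delta>)"
begin

definition pow :: "'a \<Rightarrow> nat \<Rightarrow> 'a" where
  "pow x k = (mul x ^^ k) one"

lemma pow:
  assumes "x \<in> A" "U x"
  shows "pow x k \<in> A \<and> U (pow x k) \<and> det (\<rho> (pow x k)) = det (\<rho> x) ^ k \<and> det (\<sigma> (pow x k)) = det (\<sigma> x) ^ k"
proof (induction k)
  case 0
  show ?case by (simp add: pow_def one)
next
  case (Suc k)
  have "pow x (Suc k) = mul x (pow x k)" by (simp add: pow_def)
  then show ?case
    using Suc assms by (simp add: mul U_mul det_mult[OF \<rho> \<rho>] det_mult[OF \<sigma> \<sigma>])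
qed

text \<open>What matters is that one pair \<open>s\<close>, \<open>v\<close> serves both
  representations: a relation read off in the second can be transported to the first.\<close>

lemma eliminate:
  assumes "\<And>i j. i < m \<Longrightarrow> j < m \<Longrightarrow> y i j \<in> A" "\<And>i. i < m \<Longrightarrow> U (y i i)"
    and "\<And>i j. i < m \<Longrightarrow> j < m \<Longrightarrow> i \<noteq> j \<Longrightarrow> Z (y i j)"
  shows "\<exists>s\<in>A. \<exists>v\<in>A. U s \<and> U v \<and>
    det (\<rho> s) * det (block_mat d m m (\<lambda>i j. \<rho> (y i j))) = det (\<rho> v) \<and>
    det (\<sigma> s) * det (block_mat d' m m (\<lambda>i j. \<sigma> (y i j))) = det (\<sigma> v)"
  using assms
proof (induction m arbitrary: y)
  case 0
  have "det (block_mat d 0 0 (\<lambda>i j. \<rho> (y i j))) = 1" "det (block_mat d' 0 0 (\<lambda>i j. \<sigma> (y i j))) = 1"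
    by (rule det_dim_zero; simp add: block_mat_def)+
  then show ?case using one by (intro bexI[of _ one]) auto
next
  case (Suc m)
  have yA: "y i j \<in> A" if "i \<le> m" "j \<le> m" for i j using Suc.prems(1)[of i j] that by simp
  have p: "y 0 0 \<in> A" "U (y 0 0)" using yA Suc.prems(2) by simp_all
  from pivot[OF p] obtain p' \<delta> where p': "p' \<in> A" and \<delta>: "\<delta> \<in> A" "U \<delta>"
    and eq: "\<rho> p' * \<rho> (y 0 0) = \<rho> \<delta>" "\<sigma> p' * \<sigma> (y 0 0) = \<sigma> \<delta>"
    and comm: "\<And>x. x \<in> A \<Longrightarrow> \<rho> \<delta> * \<rho> x = \<rho> x * \<rho> \<delta>" "\<And>x. x \<in> A \<Longrightarrow> \<sigma> \<delta> * \<sigma> x = \<sigma> x * \<sigma> \<delta>"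
    by blast
  \<comment> \<open>The Schur complement of the pivot, multiplied by \<delta> to avoid division. It
    again has diagonal entries reducing to one and other entries reducing to zero, since the
    subtracted product contains an off-diagonal factor.\<close>
  define z where "z i j = sub (mul \<delta> (y (Suc i) (Suc j))) (mul (mul (y (Suc i) 0) p') (y 0 (Suc j)))" for i j
  have in_A: "mul \<delta> (y (Suc i) (Suc j)) \<in> A" "mul (y (Suc i) 0) p' \<in> A"
    "mul (mul (y (Suc i) 0) p') (y 0 (Suc j)) \<in> A" if "i < m" "j < m" for i j
    using that p' \<delta> by (simp_all add: mul yA)
  have zA: "z i j \<in> A" if "i < m" "j < m" for i j
    unfolding z_def using in_A that by (intro sub) auto
  have zero: "Z (mul (mul (y (Suc i) 0) p') (y 0 (Suc j)))" if "i < m" "j < m" for i j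
    using that p' Suc.prems(3)[of 0 "Suc j"] by (intro Z_mul disjI2) (simp_all add: mul yA)
  have zU: "U (z i i)" if "i < m" for i
    unfolding z_def using that \<delta> in_A[OF that that] zero[OF that that] Suc.prems(2)[of "Suc i"]
    by (intro U_sub U_mul) (simp_all add: yA)
  have zZ: "Z (z i j)" if "i < m" "j < m" "i \<noteq> j" for i j
    unfolding z_def
  proof (rule Z_sub)
    show "Z (mul \<delta> (y (Suc i) (Suc j)))"
      using that \<delta> Suc.prems(3)[of "Suc i" "Suc j"] by (intro Z_mul disjI2) (simp_all add: yA)
  qed (use in_A[OF that(1,2)] zero[OF that(1,2)] in auto)
  have "\<exists>s\<in>A. \<exists>v\<in>A. U s \<and> U v \<and>
    det (\<rho> s) * det (block_mat d m m (\<lambda>i j. \<rho> (z i j))) = det (\<rho> v) \<and>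
    det (\<sigma> s) * det (block_mat d' m m (\<lambda>i j. \<sigma> (z i j))) = det (\<sigma> v)"
    by (rule Suc.IH[of z]) (auto intro: zA zU zZ)
  then obtain s v where s: "s \<in> A" "U s" and v: "v \<in> A" "U v"
    and IH: "det (\<rho> s) * det (block_mat d m m (\<lambda>i j. \<rho> (z i j))) = det (\<rho> v)"
      "det (\<sigma> s) * det (block_mat d' m m (\<lambda>i j. \<sigma> (z i j))) = det (\<sigma> v)"
    by blast
  have \<rho>z: "block_mat d m m (\<lambda>i j. \<rho> (z i j)) = block_mat d m m (\<lambda>i j. \<rho> \<delta> * \<rho> (y (Suc i) (Suc j))
      - \<rho> (y (Suc i) 0) * \<rho> p' * \<rho> (y 0 (Suc j)))"
    by (rule block_mat_cong) (use in_A p' \<delta> in \<open>simp add: z_def sub(2) mul yA\<close>)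
  have \<sigma>z: "block_mat d' m m (\<lambda>i j. \<sigma> (z i j)) = block_mat d' m m (\<lambda>i j. \<sigma> \<delta> * \<sigma> (y (Suc i) (Suc j))
      - \<sigma> (y (Suc i) 0) * \<sigma> p' * \<sigma> (y 0 (Suc j)))"
    by (rule block_mat_cong) (use in_A p' \<delta> in \<open>simp add: z_def sub(3) mul yA\<close>)
  have E\<rho>: "det (\<rho> \<delta>) ^ m * det (block_mat d (Suc m) (Suc m) (\<lambda>i j. \<rho> (y i j)))
      = det (\<rho> (y 0 0)) * det (block_mat d m m (\<lambda>i j. \<rho> (z i j)))"
    unfolding \<rho>z using d(1) \<rho>[OF yA] \<rho>[OF p'] eq(1) comm(1)[OF yA]
    by (intro det_block_elimination[where Y = "\<lambda>i j. \<rho> (y i j)"]) auto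
  have E\<sigma>: "det (\<sigma> \<delta>) ^ m * det (block_mat d' (Suc m) (Suc m) (\<lambda>i j. \<sigma> (y i j)))
      = det (\<sigma> (y 0 0)) * det (block_mat d' m m (\<lambda>i j. \<sigma> (z i j)))"
    unfolding \<sigma>z using d(2) \<sigma>[OF yA] \<sigma>[OF p'] eq(2) comm(2)[OF yA]
    by (intro det_block_elimination[where Y = "\<lambda>i j. \<sigma> (y i j)"]) auto
  note pw = pow[OF \<delta>, of m]
  define s' v' where "s' = mul s (pow \<delta> m)" and "v' = mul v (y 0 0)"
  have AU: "s' \<in> A" "v' \<in> A" "U s'" "U v'"
    using pw s v p by (simp_all add: s'_def v'_def mul U_mul)
  have dets: "det (\<rho> s') = det (\<rho> s) * det (\<rho> \<delta>) ^ m" "det (\<rho> v') = det (\<rho> v) * det (\<rho> (y 0 0))"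
    "det (\<sigma> s') = det (\<sigma> s) * det (\<sigma> \<delta>) ^ m" "det (\<sigma> v') = det (\<sigma> v) * det (\<sigma> (y 0 0))"
    using pw s v p by (simp_all add: s'_def v'_def mul det_mult[OF \<rho> \<rho>] det_mult[OF \<sigma> \<sigma>])
  have "det (\<rho> s') * det (block_mat d (Suc m) (Suc m) (\<lambda>i j. \<rho> (y i j))) = det (\<rho> v')"
  proof -
    have "det (\<rho> s') * det (block_mat d (Suc m) (Suc m) (\<lambda>i j. \<rho> (y i j)))
        = det (\<rho> s) * (det (\<rho> (y 0 0)) * det (block_mat d m m (\<lambda>i j. \<rho> (z i j))))"
      by (simp only: dets mult.assoc E\<rho>)
    also have "\<dots> = det (\<rho> v')"
      by (simp only: dets IH(1)[symmetric] ac_simps)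
    finally show ?thesis .
  qed
  moreover have "det (\<sigma> s') * det (block_mat d' (Suc m) (Suc m) (\<lambda>i j. \<sigma> (y i j))) = det (\<sigma> v')"
  proof -
    have "det (\<sigma> s') * det (block_mat d' (Suc m) (Suc m) (\<lambda>i j. \<sigma> (y i j)))
        = det (\<sigma> s) * (det (\<sigma> (y 0 0)) * det (block_mat d' m m (\<lambda>i j. \<sigma> (z i j))))"
      by (simp only: dets mult.assoc E\<sigma>)
    also have "\<dots> = det (\<sigma> v')"
      by (simp only: dets IH(2)[symmetric] ac_simps)
    finally show ?thesis .
  qed
  ultimately show ?case using AU by blast
qed

end

text \<open>In the factorization of \<open>f ^ r - g ^ r\<close> the cofactor of
  \<open>f - g\<close> has constant term \<open>r\<close>, so it is nonzero unless the
  characteristic divides \<open>r\<close>. In that case the Frobenius map is injective and lowers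
  the exponent.\<close>

lemma poly_power_eq_imp_eq:
  fixes f g :: "'f::field poly"
  assumes "f ^ r = g ^ r" "0 < r" "poly f 0 = 1" "poly g 0 = 1"
  shows "f = g"
  using assms
proof (induction r arbitrary: f g rule: less_induct)
  case (less r)
  show ?case
  proof (cases "of_nat r = (0::'f)")
    case False
    have "(f - g) * (\<Sum>i<r. g ^ (r - Suc i) * f ^ i) = 0"
      using power_diff_sumr2[of f r g] less.prems(1) by (metis diff_self)
    moreover have "poly (\<Sum>i<r. g ^ (r - Suc i) * f ^ i) 0 = of_nat r"
      using less.prems(3,4) by (simp add: poly_sum)
    then have "(\<Sum>i<r. g ^ (r - Suc i) * f ^ i) \<noteq> 0" using False by auto
    ultimately have "f - g = 0" by (metis mult_eq_0_iff)
    then show ?thesis by simp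
  next
    case True
    define p where "p = CHAR('f)"
    have "p dvd r" using True by (simp add: p_def of_nat_eq_0_iff_char_dvd)
    then obtain k where k: "r = p * k" by blast
    have "0 < p" using k less.prems(2) by (cases "p = 0") auto
    then have p: "prime p" unfolding p_def by (rule prime_CHAR_semidom)
    then have "prime CHAR('f poly)" by (simp add: p_def)
    then have "((f ^ k - g ^ k) + g ^ k) ^ p = (f ^ k - g ^ k) ^ p + (g ^ k) ^ p"
      by (rule freshmans_dream) (simp add: p_def)
    then have "(f ^ k - g ^ k) ^ p = 0"
      using less.prems(1) by (simp add: k mult.commute flip: power_mult)
    then have "f ^ k = g ^ k" by (metis power_eq_0_iff eq_iff_diff_eq_0)
    moreover have "k < r" "0 < k" using k p less.prems(2) prime_gt_1_nat[OF p] by auto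
    ultimately show ?thesis using less.IH less.prems by blast
  qed
qed

section \<open>The regular representation of a finite extension\<close>

lemma vector_space_ext_scale: "field_extension h K \<Longrightarrow> vector_space (ext_scale h)"
proof -
  assume "field_extension h K"
  then interpret field_hom h by (simp add: field_extension_def)
  show ?thesis
    by unfold_locales (simp_all add: ext_scale_def hom_add hom_mult algebra_simps)
qed

lemma ext_basis_exists:
  assumes "finite_extension h K"
  shows "\<exists>bs. is_ext_basis h K bs"
proof -
  have fe: "field_extension h K" using assms by (simp add: finite_extension_def)
  interpret vector_space "ext_scale h" by (rule vector_space_ext_scale[OF fe])
  obtain S where S: "finite S" "span S = K" using assms by (auto simp: finite_extension_def)
  obtain B where B: "B \<subseteq> K" "independent B" "K \<subseteq> span B"
    using maximal_independent_subset[of K] by blast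
  have "finite B" using independent_span_bound[OF S(1) B(2)] B(1) S(2) by blast
  then obtain bs where bs: "set bs = B" "distinct bs" using finite_distinct_list by blast
  have "span B \<subseteq> K" using span_mono[OF B(1)] span_span[of S] unfolding S(2) by simp
  then have "is_ext_basis h K bs" using bs B by (auto simp: is_ext_basis_def)
  then show ?thesis ..
qed

locale ext_basis =
  fixes h :: "'f::field \<Rightarrow> 'k::field" and K :: "'k set" and bs :: "'k list"
  assumes field_extension: "field_extension h K" and basis: "is_ext_basis h K bs"
begin

sublocale h: field_hom h
  using field_extension by (simp add: field_extension_def)

sublocale V: vector_space "ext_scale h"
  by (rule vector_space_ext_scale[OF field_extension])

abbreviation "m \<equiv> length bs"
abbreviation "\<rho> \<equiv> mult_matrix h bs"

lemma K_closed [simp]: "h c \<in> K" "0 \<in> K" "1 \<in> K" "x \<in> K \<Longrightarrow> y \<in> K \<Longrightarrow> x + y \<in> K"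
  "x \<in> K \<Longrightarrow> y \<in> K \<Longrightarrow> x * y \<in> K" "x \<in> K \<Longrightarrow> - x \<in> K" "x \<in> K \<Longrightarrow> y \<in> K \<Longrightarrow> x - y \<in> K"
proof -
  have r: "range h \<subseteq> K" and c: "\<And>x y. x \<in> K \<Longrightarrow> y \<in> K \<Longrightarrow> x + y \<in> K \<and> x * y \<in> K" "\<And>x. x \<in> K \<Longrightarrow> - x \<in> K"
    using field_extension by (auto simp: field_extension_def)
  show h: "h c \<in> K" for c using r by blast
  show "0 \<in> K" "1 \<in> K" using h[of 0] h[of 1] by simp_all
  show "x \<in> K \<Longrightarrow> y \<in> K \<Longrightarrow> x + y \<in> K" "x \<in> K \<Longrightarrow> y \<in> K \<Longrightarrow> x * y \<in> K" "x \<in> K \<Longrightarrow> - x \<in> K"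
    using c by auto
  show "x \<in> K \<Longrightarrow> y \<in> K \<Longrightarrow> x - y \<in> K" using c(1)[of x "- y"] c(2)[of y] by simp
qed

lemma K_sum: "(\<And>i. i \<in> I \<Longrightarrow> f i \<in> K) \<Longrightarrow> (\<Sum>i\<in>I. f i) \<in> K"
  by (induction I rule: infinite_finite_induct) auto

lemma bs_K: "i < m \<Longrightarrow> bs ! i \<in> K"
  using basis V.span_base[of "bs ! i" "set bs"] by (auto simp: is_ext_basis_def)

lemma sum_bs: "(\<Sum>b\<in>set bs. f b) = (\<Sum>i<m. f (bs ! i))"
  using basis by (intro sum.reindex_bij_betw[symmetric] bij_betw_nth) (auto simp: is_ext_basis_def)

lemma combination_unique:
  assumes "(\<Sum>i<m. h (u i) * bs ! i) = (\<Sum>i<m. h (w i) * bs ! i)" "i < m"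
  shows "u i = w i"
proof -
  have d: "distinct bs" "V.independent (set bs)" using basis by (simp_all add: is_ext_basis_def)
  define f where "f b = u (THE i. i < m \<and> bs ! i = b) - w (THE i. i < m \<and> bs ! i = b)" for b
  have f: "f (bs ! i) = u i - w i" if "i < m" for i
  proof -
    have "(THE j. j < m \<and> bs ! j = bs ! i) = i"
      using d(1) that by (intro the_equality) (auto simp: nth_eq_iff_index_eq)
    then show ?thesis by (simp add: f_def)
  qed
  have "(\<Sum>b\<in>set bs. ext_scale h (f b) b) = (\<Sum>i<m. h (u i) * bs ! i) - (\<Sum>i<m. h (w i) * bs ! i)"
    unfolding sum_bs sum_subtractf[symmetric]
    by (intro sum.cong) (simp_all add: ext_scale_def f h.hom_minus left_diff_distrib)
  then have "(\<Sum>b\<in>set bs. ext_scale h (f b) b) = 0" using assms(1) by simp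
  then have "f (bs ! i) = 0"
    using V.independentD[OF d(2), of "set bs" f "bs ! i"] assms(2) by simp
  then show ?thesis using f[OF assms(2)] by simp
qed

lemma \<rho>_carrier [simp]: "\<rho> a \<in> carrier_mat m m" "dim_row (\<rho> a) = m" "dim_col (\<rho> a) = m"
  by (simp_all add: mult_matrix_def)

lemma \<rho>_column:
  assumes "a \<in> K" "j < m"
  shows "a * bs ! j = (\<Sum>i<m. h (\<rho> a $$ (i, j)) * bs ! i)"
proof -
  have d: "V.independent (set bs)" "V.span (set bs) = K" using basis by (simp_all add: is_ext_basis_def)
  have "a * bs ! j \<in> V.span (set bs)" using assms bs_K d by simp
  then have "(\<Sum>b\<in>set bs. ext_scale h (V.representation (set bs) (a * bs ! j) b) b) = a * bs ! j"
    using V.sum_representation_eq[OF d(1), of "a * bs ! j" "set bs"] by simp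
  then have "a * bs ! j = (\<Sum>i<m. ext_scale h (V.representation (set bs) (a * bs ! j) (bs ! i)) (bs ! i))"
    by (simp add: sum_bs)
  also have "\<dots> = (\<Sum>i<m. h (\<rho> a $$ (i, j)) * bs ! i)"
    using assms by (intro sum.cong) (simp_all add: mult_matrix_def ext_scale_def)
  finally show ?thesis .
qed

lemma \<rho>_eqI:
  assumes "a \<in> K" "i < m" "j < m" "a * bs ! j = (\<Sum>i<m. h (f i) * bs ! i)"
  shows "\<rho> a $$ (i, j) = f i"
  by (rule combination_unique[of "\<lambda>i. \<rho> a $$ (i, j)" f i]) (use \<rho>_column[OF assms(1,3)] assms in simp_all)

lemma \<rho>_add:
  assumes "a \<in> K" "b \<in> K" "i < m" "j < m"
  shows "\<rho> (a + b) $$ (i, j) = \<rho> a $$ (i, j) + \<rho> b $$ (i, j)"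
  by (rule \<rho>_eqI)
    (use assms in \<open>simp_all add: distrib_right \<rho>_column h.hom_add sum.distrib\<close>)

lemma \<rho>_scalar:
  assumes "i < m" "j < m"
  shows "\<rho> (h c) $$ (i, j) = (if i = j then c else 0)"
proof (rule \<rho>_eqI)
  have "(\<Sum>i<m. h (if i = j then c else 0) * bs ! i) = (\<Sum>i<m. if i = j then h c * bs ! j else 0)"
    by (rule sum.cong) auto
  then show "h c * bs ! j = (\<Sum>i<m. h (if i = j then c else 0) * bs ! i)" using assms by simp
qed (use assms in auto)

lemma \<rho>_mult:
  assumes "a \<in> K" "b \<in> K"
  shows "\<rho> (a * b) = \<rho> a * \<rho> b"
proof (rule mat_entries_eqI[of _ m m])
  fix i j assume ij: "i < m" "j < m"
  have "\<rho> (a * b) $$ (i, j) = (\<Sum>k<m. \<rho> a $$ (i, k) * \<rho> b $$ (k, j))"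
  proof (rule \<rho>_eqI)
    have "a * b * bs ! j = (\<Sum>k<m. h (\<rho> b $$ (k, j)) * (a * bs ! k))"
      using assms ij by (simp add: mult.assoc \<rho>_column[of b j] sum_distrib_left ac_simps)
    also have "\<dots> = (\<Sum>k<m. h (\<rho> b $$ (k, j)) * (\<Sum>i<m. h (\<rho> a $$ (i, k)) * bs ! i))"
      using assms by (intro sum.cong) (simp_all add: \<rho>_column)
    also have "\<dots> = (\<Sum>i<m. h (\<Sum>k<m. \<rho> a $$ (i, k) * \<rho> b $$ (k, j)) * bs ! i)"
      unfolding sum_distrib_left
      by (subst sum.swap) (simp add: h.hom_sum h.hom_mult sum_distrib_left sum_distrib_right ac_simps)
    finally show "a * b * bs ! j = (\<Sum>i<m. h (\<Sum>k<m. \<rho> a $$ (i, k) * \<rho> b $$ (k, j)) * bs ! i)" .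
  qed (use assms ij in auto)
  then show "\<rho> (a * b) $$ (i, j) = (\<rho> a * \<rho> b) $$ (i, j)"
    by (simp only: mat_mult_index[OF \<rho>_carrier(1) \<rho>_carrier(1) ij])
qed (auto intro: mult_carrier_mat[of _ _ m])

lemma \<rho>_zero: "i < m \<Longrightarrow> j < m \<Longrightarrow> \<rho> 0 $$ (i, j) = 0"
  using \<rho>_scalar[of i j 0] by simp

lemma \<rho>_one: "\<rho> 1 = 1\<^sub>m m"
  by (rule eq_matI) (use \<rho>_scalar[of _ _ 1] in auto)

lemma \<rho>_sum:
  assumes "\<And>x. x \<in> I \<Longrightarrow> f x \<in> K" "i < m" "j < m"
  shows "\<rho> (\<Sum>x\<in>I. f x) $$ (i, j) = (\<Sum>x\<in>I. \<rho> (f x) $$ (i, j))"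
  using assms(1) by (induction I rule: infinite_finite_induct) (simp_all add: \<rho>_zero \<rho>_add K_sum assms(2,3))

lemma m_pos: "0 < m"
proof (rule ccontr)
  assume "\<not> 0 < m"
  then have "K = {0}" using basis by (simp add: is_ext_basis_def)
  then show False using K_closed(3) by simp
qed

section \<open>Polynomials over the extension and their regular representation\<close>

definition KX :: "'k poly set" where
  "KX = {P. \<forall>k. Polynomial.coeff P k \<in> K}"

lemma KX_closed: "0 \<in> KX" "1 \<in> KX" "P \<in> KX \<Longrightarrow> Q \<in> KX \<Longrightarrow> P + Q \<in> KX"
  "P \<in> KX \<Longrightarrow> Q \<in> KX \<Longrightarrow> P - Q \<in> KX" "P \<in> KX \<Longrightarrow> Q \<in> KX \<Longrightarrow> P * Q \<in> KX" "[:h c:] \<in> KX"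
  by (auto simp: KX_def coeff_mult coeff_pCons intro!: K_sum split: nat.split)

lemma KX_sum: "(\<And>i. i \<in> I \<Longrightarrow> f i \<in> KX) \<Longrightarrow> (\<Sum>i\<in>I. f i) \<in> KX"
  by (induction I rule: infinite_finite_induct) (auto simp: KX_closed)

text \<open>The regular representation of \<open>K[t]\<close> over \<open>F[t]\<close> in the basis
  \<open>bs\<close>, applied to each coefficient; its determinant is the norm of a polynomial,
  itself a polynomial over \<open>F\<close>.\<close>

definition \<rho>X :: "'k poly \<Rightarrow> 'f poly mat" where
  "\<rho>X P = mat m m (\<lambda>(i, j). map_poly (\<lambda>a. \<rho> a $$ (i, j)) P)"

lemma \<rho>X_carrier [simp]: "\<rho>X P \<in> carrier_mat m m" "dim_row (\<rho>X P) = m" "dim_col (\<rho>X P) = m"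
  by (simp_all add: \<rho>X_def)

lemma coeff_\<rho>X:
  "i < m \<Longrightarrow> j < m \<Longrightarrow> Polynomial.coeff (\<rho>X P $$ (i, j)) k = \<rho> (Polynomial.coeff P k) $$ (i, j)"
  by (simp add: \<rho>X_def coeff_map_poly \<rho>_zero)

lemma \<rho>X_add:
  assumes "P \<in> KX" "Q \<in> KX" "i < m" "j < m"
  shows "\<rho>X (P + Q) $$ (i, j) = \<rho>X P $$ (i, j) + \<rho>X Q $$ (i, j)"
  by (rule poly_eqI) (use assms in \<open>simp add: coeff_\<rho>X \<rho>_add KX_def\<close>)

lemma \<rho>X_zero: "i < m \<Longrightarrow> j < m \<Longrightarrow> \<rho>X 0 $$ (i, j) = 0"
  by (rule poly_eqI) (simp add: coeff_\<rho>X \<rho>_zero)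

lemma \<rho>X_minus:
  assumes "P \<in> KX" "Q \<in> KX"
  shows "\<rho>X (P - Q) = \<rho>X P - \<rho>X Q"
proof (rule mat_entries_eqI[of _ m m])
  fix i j assume ij: "i < m" "j < m"
  have "\<rho>X P $$ (i, j) = \<rho>X (P - Q) $$ (i, j) + \<rho>X Q $$ (i, j)"
    using \<rho>X_add[of "P - Q" Q i j] assms ij by (simp add: KX_closed)
  then show "\<rho>X (P - Q) $$ (i, j) = (\<rho>X P - \<rho>X Q) $$ (i, j)" using ij by simp
qed (auto intro: minus_carrier_mat)

lemma \<rho>X_sum:
  assumes "\<And>x. x \<in> I \<Longrightarrow> f x \<in> KX" "i < m" "j < m"
  shows "\<rho>X (\<Sum>x\<in>I. f x) $$ (i, j) = (\<Sum>x\<in>I. \<rho>X (f x) $$ (i, j))"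
  using assms(1) by (induction I rule: infinite_finite_induct) (simp_all add: \<rho>X_zero \<rho>X_add KX_sum assms(2,3))

lemma \<rho>X_mult:
  assumes "P \<in> KX" "Q \<in> KX"
  shows "\<rho>X (P * Q) = \<rho>X P * \<rho>X Q"
proof (rule mat_entries_eqI[of _ m m])
  fix i j assume ij: "i < m" "j < m"
  have PQ: "Polynomial.coeff P l \<in> K" "Polynomial.coeff Q l \<in> K" for l using assms by (auto simp: KX_def)
  have "\<rho>X (P * Q) $$ (i, j) = (\<Sum>l<m. \<rho>X P $$ (i, l) * \<rho>X Q $$ (l, j))"
  proof (rule poly_eqI)
    fix k
    have "Polynomial.coeff (\<rho>X (P * Q) $$ (i, j)) k
        = (\<Sum>u\<le>k. \<Sum>l<m. \<rho> (Polynomial.coeff P u) $$ (i, l) * \<rho> (Polynomial.coeff Q (k - u)) $$ (l, j))"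
      using ij PQ by (simp add: coeff_\<rho>X coeff_mult \<rho>_sum \<rho>_mult mat_mult_index[of _ m] del: index_mult_mat)
    also have "\<dots> = Polynomial.coeff (\<Sum>l<m. \<rho>X P $$ (i, l) * \<rho>X Q $$ (l, j)) k"
      unfolding coeff_sum by (subst sum.swap) (simp add: coeff_mult coeff_\<rho>X ij)
    finally show "Polynomial.coeff (\<rho>X (P * Q) $$ (i, j)) k
        = Polynomial.coeff (\<Sum>l<m. \<rho>X P $$ (i, l) * \<rho>X Q $$ (l, j)) k" .
  qed
  then show "\<rho>X (P * Q) $$ (i, j) = (\<rho>X P * \<rho>X Q) $$ (i, j)"
    by (simp only: mat_mult_index[OF \<rho>X_carrier(1) \<rho>X_carrier(1) ij])
qed (auto intro: mult_carrier_mat[of _ _ m])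

lemma \<rho>X_const: "i < m \<Longrightarrow> j < m \<Longrightarrow> \<rho>X [:h c:] $$ (i, j) = (if i = j then [:c:] else 0)"
  by (rule poly_eqI) (simp add: coeff_\<rho>X coeff_pCons \<rho>_zero \<rho>_scalar split: nat.split)

lemma \<rho>X_one: "\<rho>X 1 = 1\<^sub>m m"
  by (rule eq_matI) (use \<rho>X_const[of _ _ 1] in \<open>auto simp: pCons_one\<close>)

text \<open>Specializing the variable at a point of the ground field commutes with the regular
  representation. The norm of a polynomial therefore interpolates the norms of its values at such
  points.\<close>

lemma \<rho>X_eval:
  assumes "P \<in> KX"
  shows "map_mat (\<lambda>p. poly p c) (\<rho>X P) = \<rho> (poly P (h c))"
proof (rule mat_entries_eqI[of _ m m])
  fix i j assume ij: "i < m" "j < m"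
  have "poly P (h c) \<in> K \<and> poly (\<rho>X P $$ (i, j)) c = \<rho> (poly P (h c)) $$ (i, j)"
    using assms
  proof (induction P)
    case 0
    show ?case using ij by (simp add: \<rho>X_zero \<rho>_zero)
  next
    case (pCons a P)
    have aP: "a \<in> K" "P \<in> KX"
    proof -
      have "Polynomial.coeff (pCons a P) k \<in> K" for k using pCons.prems by (auto simp: KX_def)
      from this[of 0] this[of "Suc k" for k] show "a \<in> K" "P \<in> KX" by (auto simp: KX_def)
    qed
    have "\<rho>X (pCons a P) $$ (i, j) = pCons (\<rho> a $$ (i, j)) (\<rho>X P $$ (i, j))"
      by (rule poly_eqI) (use ij in \<open>simp add: coeff_\<rho>X coeff_pCons split: nat.split\<close>)
    moreover have "\<rho> (h c * poly P (h c)) $$ (i, j) = c * \<rho> (poly P (h c)) $$ (i, j)"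
    proof -
      have "\<rho> (h c * poly P (h c)) $$ (i, j) = (\<Sum>l<m. \<rho> (h c) $$ (i, l) * \<rho> (poly P (h c)) $$ (l, j))"
        using pCons.IH[OF aP(2)] ij by (simp add: \<rho>_mult mat_mult_index[of _ m] del: index_mult_mat)
      also have "\<dots> = (\<Sum>l<m. if l = i then c * \<rho> (poly P (h c)) $$ (i, j) else 0)"
        using ij by (intro sum.cong) (auto simp: \<rho>_scalar)
      finally show ?thesis using ij by simp
    qed
    ultimately show ?case
      using pCons.IH[OF aP(2)] aP ij by (simp add: \<rho>_add)
  qed
  then show "map_mat (\<lambda>p. poly p c) (\<rho>X P) $$ (i, j) = \<rho> (poly P (h c)) $$ (i, j)" using ij by simp
qed simp_all

lemma det_\<rho>X_eval: "P \<in> KX \<Longrightarrow> poly (det (\<rho>X P)) c = det (\<rho> (poly P (h c)))"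
proof -
  assume P: "P \<in> KX"
  have "comm_ring_hom (\<lambda>p::'f poly. poly p c)" by unfold_locales simp_all
  from comm_ring_hom.hom_det[OF this, of "\<rho>X P"] show ?thesis
    using \<rho>X_eval[OF P, of c] by simp
qed

end

section \<open>Norms of values of the form\<close>

lemma det_mat_one: "det (mat 1 1 (\<lambda>_. x)) = (x :: 'r::comm_ring_1)"
  by (simp add: det_single)

text \<open>Transitivity of determinants: replacing entries by their regular matrices takes the norm
  of the determinant. In the representation by 1 by 1 matrices elimination says
  \<open>v = s * det M\<close>; multiplicativity of \<open>\<rho>X\<close> carries this to the block
  matrix, and the determinant of \<open>\<rho>X s\<close> can be cancelled because it is 1 at t =
  0.\<close>

lemma (in ext_basis) det_regular_blocks:
  fixes M :: "'k poly mat"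
  assumes M: "M \<in> carrier_mat n n" "\<And>a b. a < n \<Longrightarrow> b < n \<Longrightarrow> M $$ (a, b) \<in> KX" "det M \<in> KX"
    and unital: "\<And>a b. a < n \<Longrightarrow> b < n \<Longrightarrow> poly (M $$ (a, b)) 0 = (if a = b then 1 else 0)"
  shows "det (block_mat m n n (\<lambda>a b. \<rho>X (M $$ (a, b)))) = det (\<rho>X (det M))"
proof -
  let ?\<sigma> = "\<lambda>P :: 'k poly. mat 1 1 (\<lambda>_. P)"
  interpret elimination KX "\<lambda>P. poly P 0 = 1" "\<lambda>P. poly P 0 = 0" "(*)" "(-)" 1 \<rho>X ?\<sigma> m 1
  proof
    fix p assume p: "p \<in> KX" "poly p 0 = 1"
    show "\<exists>p'\<in>KX. \<exists>\<delta>\<in>KX. poly \<delta> 0 = 1 \<and> \<rho>X p' * \<rho>X p = \<rho>X \<delta> \<and> ?\<sigma> p' * ?\<sigma> p = ?\<sigma> \<delta> \<and>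
      (\<forall>x\<in>KX. \<rho>X \<delta> * \<rho>X x = \<rho>X x * \<rho>X \<delta> \<and> ?\<sigma> \<delta> * ?\<sigma> x = ?\<sigma> x * ?\<sigma> \<delta>)"
    \<comment> \<open>In a commutative ring the pivot itself is central, so it takes the role of
      \<delta> and its adjugate may be chosen as 1.\<close>
    proof (rule bexI[of _ 1], rule bexI[of _ p], intro conjI ballI)
      fix x assume "x \<in> KX"
      then show "\<rho>X p * \<rho>X x = \<rho>X x * \<rho>X p"
        using p by (metis \<rho>X_mult mult.commute)
      show "?\<sigma> p * ?\<sigma> x = ?\<sigma> x * ?\<sigma> p" by (rule eq_matI) (auto simp: scalar_prod_def)
    next
      show "\<rho>X 1 * \<rho>X p = \<rho>X p" by (simp add: \<rho>X_one)
      show "?\<sigma> 1 * ?\<sigma> p = ?\<sigma> p" by (rule eq_matI) (auto simp: scalar_prod_def)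
    qed (use p KX_closed in auto)
  qed (use m_pos in \<open>auto simp: KX_closed \<rho>X_mult \<rho>X_minus \<rho>X_one scalar_prod_def intro!: eq_matI\<close>)
  have "\<exists>s\<in>KX. \<exists>v\<in>KX. poly s 0 = 1 \<and> poly v 0 = 1 \<and>
      det (\<rho>X s) * det (block_mat m n n (\<lambda>a b. \<rho>X (M $$ (a, b)))) = det (\<rho>X v) \<and>
      det (?\<sigma> s) * det (block_mat 1 n n (\<lambda>a b. ?\<sigma> (M $$ (a, b)))) = det (?\<sigma> v)"
    by (rule eliminate[of n "\<lambda>a b. M $$ (a, b)"]) (use M(2) unital in auto)
  then obtain s v where sv: "s \<in> KX" "v \<in> KX" "poly s 0 = 1"
    and \<rho>: "det (\<rho>X s) * det (block_mat m n n (\<lambda>a b. \<rho>X (M $$ (a, b)))) = det (\<rho>X v)"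
    and \<sigma>: "det (?\<sigma> s) * det (block_mat 1 n n (\<lambda>a b. ?\<sigma> (M $$ (a, b)))) = det (?\<sigma> v)"
    by blast
  have "block_mat 1 n n (\<lambda>a b. ?\<sigma> (M $$ (a, b))) = M"
    by (rule mat_entries_eqI[of _ n n]) (use M(1) in \<open>auto simp: block_mat_def\<close>)
  then have "v = s * det M" using \<sigma> by (simp only: det_mat_one)
  then have "det (\<rho>X v) = det (\<rho>X s) * det (\<rho>X (det M))"
    using sv M(3) by (simp add: \<rho>X_mult det_mult[of _ m])
  moreover have "det (\<rho>X s) \<noteq> 0"
  proof
    assume "det (\<rho>X s) = 0"
    then have "det (\<rho> (poly s (h 0))) = 0" using det_\<rho>X_eval[OF sv(1), of 0] by simp
    then show False using sv(3) by (simp add: \<rho>_one)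
  qed
  ultimately show ?thesis using \<rho> by (metis mult_left_cancel)
qed

lemma (in ext_basis) det_\<rho>X_power:
  assumes "P \<in> KX"
  shows "P ^ k \<in> KX \<and> det (\<rho>X (P ^ k)) = det (\<rho>X P) ^ k"
  using assms by (induction k) (simp_all add: KX_closed \<rho>X_one \<rho>X_mult det_mult[of _ m])

context division_norm_algebra begin

lemma N_e: "N (\<lambda>c. c) e = 1"
  by (simp add: N_def norm_e)

lemma det_algebra_blocks:
  fixes y :: "nat \<Rightarrow> nat \<Rightarrow> nat \<Rightarrow> 'f poly"
  assumes y: "\<And>p q. p < m \<Longrightarrow> q < m \<Longrightarrow> y p q \<in> fvecs n"
    and unital: "\<And>p q. p < m \<Longrightarrow> q < m \<Longrightarrow> (\<lambda>i. poly (y p q i) 0) = (if p = q then e else 0)"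
  obtains s v where "s \<in> fvecs n" "v \<in> fvecs n" "(\<lambda>i. poly (s i) 0) = e" "(\<lambda>i. poly (v i) 0) = e"
    "det (lmat (\<lambda>c. [:c:]) s) * det (block_mat n m m (\<lambda>p q. lmat (\<lambda>c. [:c:]) (y p q)))
      = det (lmat (\<lambda>c. [:c:]) v)"
proof -
  let ?\<iota> = "\<lambda>c::'f. [:c:]" and ?e = "\<lambda>i. [:e i:]"
  let ?ev = "\<lambda>y :: nat \<Rightarrow> 'f poly. (\<lambda>i. poly (y i) 0)"
  have hom: "comm_ring_hom ?\<iota>" by (rule comm_ring_hom_const)
  have eV: "?e \<in> fvecs n" using fvecsD[OF e_V] by (simp add: fvecs_def)
  have ev_mul: "?ev (mulR ?\<iota> x y) = mulR (\<lambda>c. c) (?ev x) (?ev y)" for x y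
    using comm_ring_hom.bilin_hom[OF comm_ring_hom_poly[of 0], of ?\<iota> n c x y] by simp
  have mul0: "mulR (\<lambda>c. c) 0 x = 0" "mulR (\<lambda>c. c) x 0 = 0" for x
    by (auto simp: bilin_def)
  have minus: "lmat ?\<iota> (x - y) = lmat ?\<iota> x - lmat ?\<iota> y" for x y
  proof -
    have "lmat ?\<iota> x = lmat ?\<iota> (x - y) + lmat ?\<iota> y"
      using lmat_add[OF hom, of "x - y" y] by simp
    then show ?thesis by (intro eq_matI) auto
  qed
  interpret elimination "fvecs n" "\<lambda>y. ?ev y = e" "\<lambda>y. ?ev y = 0" "mulR ?\<iota>" "(-)" ?e
    "lmat ?\<iota>" "lmat ?\<iota>" n n
  proof
    fix p :: "nat \<Rightarrow> 'f poly" assume p: "p \<in> fvecs n" "?ev p = e"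
    \<comment> \<open>The adjoint of the pivot: \<open>q\<close> is the polarized adjoint and gives
      twice the adjoint on the diagonal. The product \<delta> with the pivot is a multiple of the
      unit, hence central.\<close>
    define p' where "p' = fscale [:inverse 2:] (bilin ?\<iota> n q p p)"
    define \<delta> where "\<delta> = fscale (N ?\<iota> p) ?e"
    have const: "[:b:] * [:b':] = [:b * b':]" for b b' :: 'f by simp
    have three_poly: "(3 :: 'f poly) = [:3:]" and six_poly: "(6 :: 'f poly) = [:6:]" and six: "(6 :: 'f) = 2 * 3"
      by (rule numeral_poly, rule numeral_poly, simp)
    have inv: "inverse (b * b') * b' = inverse b" if "b' \<noteq> 0" for b b' :: 'f
      using that by (simp add: field_simps)
    have inv1: "inverse (2 * 3) * 2 * 3 = (1 :: 'f)"
      unfolding mult.assoc using two three by (intro left_inverse) (simp only: mult_eq_0_iff simp_thms)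
    let ?s = "[:inverse (2 * 3 :: 'f):]"
    have "fscale ?s (fscale 3 (mulR ?\<iota> (bilin ?\<iota> n q p p) p)) = fscale ?s (fscale (6 * N ?\<iota> p) ?e)"
      using adjoint_R[OF hom p(1)] by (simp only:)
    moreover have "fscale ?s (fscale 3 u) = fscale [:inverse 2:] u" for u :: "nat \<Rightarrow> 'f poly"
      by (intro ext) (simp only: fscale_apply mult.assoc[symmetric] three_poly const inv[OF three])
    moreover have "fscale ?s (fscale (6 * b) u) = fscale b u" for b and u :: "nat \<Rightarrow> 'f poly"
      by (intro ext) (simp only: fscale_apply mult.assoc[symmetric] six_poly six const inv1 pCons_one mult_1_left)
    ultimately have "mulR ?\<iota> p' p = \<delta>"
      by (simp only: p'_def \<delta>_def bilin_linear)
    moreover have V: "p' \<in> fvecs n" "\<delta> \<in> fvecs n"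
      using eV by (simp_all add: p'_def \<delta>_def)
    ultimately have prod: "lmat ?\<iota> p' * lmat ?\<iota> p = lmat ?\<iota> \<delta>"
      using lmat_mult[OF hom V(1) p(1)] by simp
    have \<delta>: "lmat ?\<iota> \<delta> = N ?\<iota> p \<cdot>\<^sub>m 1\<^sub>m n"
      unfolding \<delta>_def lmat_fscale[OF hom] lmat_one[OF hom] ..
    have comm: "lmat ?\<iota> \<delta> * lmat ?\<iota> x = lmat ?\<iota> x * lmat ?\<iota> \<delta>" for x
      unfolding \<delta> using mult_smult_distrib[OF lmat_carrier(1)[of ?\<iota> x] one_carrier_mat]
        mult_smult_assoc_mat[OF one_carrier_mat lmat_carrier(1)[of ?\<iota> x]]
      by simp
    have "poly (N ?\<iota> p) 0 = 1"
      unfolding N_poly_eval p(2) by (rule N_e)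
    then have "?ev \<delta> = e" by (intro ext) (simp add: \<delta>_def)
    then show "\<exists>p'\<in>fvecs n. \<exists>\<delta>\<in>fvecs n. ?ev \<delta> = e \<and> lmat ?\<iota> p' * lmat ?\<iota> p = lmat ?\<iota> \<delta> \<and>
        lmat ?\<iota> p' * lmat ?\<iota> p = lmat ?\<iota> \<delta> \<and>
        (\<forall>x\<in>fvecs n. lmat ?\<iota> \<delta> * lmat ?\<iota> x = lmat ?\<iota> x * lmat ?\<iota> \<delta> \<and>
          lmat ?\<iota> \<delta> * lmat ?\<iota> x = lmat ?\<iota> x * lmat ?\<iota> \<delta>)"
      using V prod comm by blast
  next
    fix x y :: "nat \<Rightarrow> 'f poly"
    show "?ev x = e \<Longrightarrow> ?ev y = e \<Longrightarrow> ?ev (mulR ?\<iota> x y) = e"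
      unfolding ev_mul using unit_left[OF e_V] by simp
    show "?ev x = 0 \<or> ?ev y = 0 \<Longrightarrow> ?ev (mulR ?\<iota> x y) = 0"
      unfolding ev_mul using mul0 by auto
    show "?ev x = e \<Longrightarrow> ?ev y = 0 \<Longrightarrow> ?ev (x - y) = e" "?ev x = 0 \<Longrightarrow> ?ev y = 0 \<Longrightarrow> ?ev (x - y) = 0"
      by (auto simp: fun_eq_iff)
  qed (use n2 eV in \<open>auto simp: lmat_mult[OF hom] lmat_one[OF hom] minus\<close>)
  have "\<exists>s\<in>fvecs n. \<exists>v\<in>fvecs n. ?ev s = e \<and> ?ev v = e \<and>
      det (lmat ?\<iota> s) * det (block_mat n m m (\<lambda>p q. lmat ?\<iota> (y p q))) = det (lmat ?\<iota> v) \<and>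
      det (lmat ?\<iota> s) * det (block_mat n m m (\<lambda>p q. lmat ?\<iota> (y p q))) = det (lmat ?\<iota> v)"
    by (rule eliminate[of m y]) (use y unital in auto)
  then show ?thesis using that by blast
qed

text \<open>Left multiplication by \<open>x\<close> on the tensor product of the algebra with \<open>K\<close>, read as a matrix with
  blocks in \<open>K\<close> and as a matrix with blocks in the algebra. To compare the two determinants exactly, and
  not only up to roots of unity, \<open>x\<close> is joined to the unit \<open>e\<close> by the line \<open>e + t (x - e)\<close>.\<close>

theorem field_norm_value:
  fixes h :: "'f \<Rightarrow> 'k::field"
  assumes fin: "finite_extension h K" and x: "x \<in> fvecs n" "\<And>i. x i \<in> K"
  shows "\<exists>w\<in>fvecs n. N (\<lambda>c. c) w = field_norm h K (N h x)"
proof -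
  define bs where "bs = (SOME bs. is_ext_basis h K bs)"
  have basis: "is_ext_basis h K bs"
    unfolding bs_def by (rule someI_ex[OF ext_basis_exists[OF fin]])
  interpret B: ext_basis h K bs
    using fin basis by (intro ext_basis.intro) (simp_all add: finite_extension_def)
  let ?\<kappa> = "\<lambda>c. [:h c:]" and ?\<iota> = "\<lambda>c::'f. [:c:]" and ?m = "length bs"
  have hom: "comm_ring_hom ?\<kappa>"
    by unfold_locales (simp_all add: B.h.hom_add B.h.hom_mult)
  define xt where "xt i = [:h (e i), x i - h (e i):]" for i
  have xtV: "xt \<in> fvecs n" using fvecsD[OF e_V] fvecsD[OF x(1)] by (simp add: xt_def fvecs_def)
  have xtK: "xt i \<in> B.KX" for i
    using x(2) by (auto simp: xt_def B.KX_def coeff_pCons split: nat.split)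
  have xt0: "(\<lambda>i. poly (xt i) 0) = (\<lambda>i. h (e i))" and xt1: "(\<lambda>i. poly (xt i) 1) = x"
    by (simp_all add: xt_def)
  define P where "P = N ?\<kappa> xt"
  have PK: "P \<in> B.KX"
    unfolding P_def N_def trilin_def by (intro B.KX_sum B.KX_closed xtK)
  have P_eval: "poly P s = N h (\<lambda>i. poly (xt i) s)" for s
    using N_hom[OF comm_ring_hom_poly[of s], where \<iota> = ?\<kappa> and x = xt] by (simp add: P_def)
  have P0: "poly P 0 = 1"
  proof -
    have "N h (\<lambda>i. h (e i)) = h (N (\<lambda>c. c) e)"
      using N_hom[OF B.h.comm_ring_hom_axioms, where \<iota> = "\<lambda>c. c" and x = e] by simp
    then show ?thesis by (simp add: P_eval xt0 N_e)
  qed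
  \<comment> \<open>The norm of the value along the line, as a polynomial: \<open>g\<close> is 1 at
    t = 0 and the norm in question at t = 1.\<close>
  define g where "g = det (B.\<rho>X P)"
  have g0: "poly g 0 = 1"
    using B.det_\<rho>X_eval[OF PK, of 0] P0 by (simp add: g_def B.\<rho>_one)
  have g1: "poly g 1 = field_norm h K (N h x)"
    using B.det_\<rho>X_eval[OF PK, of 1] by (simp add: g_def P_eval xt1 field_norm_def bs_def)
  let ?M = "lmat ?\<kappa> xt"
  have detM: "det ?M = P ^ (n div 3)"
    unfolding P_def by (rule det_lmat[OF hom xtV])
  have entry: "?M $$ (i, j) = (\<Sum>k<n. \<Sum>l<n. [:h (c i k l):] * xt k * fbasis j l)" if "i < n" "j < n" for i j
    using that by (simp add: lmat_def bilin_def)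
  have fbK: "(fbasis j l :: 'k poly) \<in> B.KX" for j l
    using B.KX_closed(1,2) by (simp add: fbasis_def)
  have ME: "?M $$ (i, j) \<in> B.KX" if "i < n" "j < n" for i j
    unfolding entry[OF that] by (intro B.KX_sum B.KX_closed xtK fbK)
  have M0: "poly (?M $$ (i, j)) 0 = (if i = j then 1 else 0)" if "i < n" "j < n" for i j
  proof -
    have "map_mat (\<lambda>p. poly p 0) ?M = lmat h (\<lambda>i. h (e i))"
      using lmat_hom[OF comm_ring_hom_poly[of 0], where \<iota> = ?\<kappa> and x = xt] by (simp add: xt0)
    also have "\<dots> = 1\<^sub>m n" by (rule lmat_one[OF B.h.comm_ring_hom_axioms])
    finally have "map_mat (\<lambda>p. poly p 0) ?M $$ (i, j) = 1\<^sub>m n $$ (i, j)" by simp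
    then show ?thesis using that by simp
  qed
  have "det (block_mat ?m n n (\<lambda>a b. B.\<rho>X (?M $$ (a, b)))) = det (B.\<rho>X (det ?M))"
    by (rule B.det_regular_blocks) (use ME M0 B.det_\<rho>X_power[OF PK] in \<open>auto simp: detM\<close>)
  then have K_side: "det (block_mat ?m n n (\<lambda>a b. B.\<rho>X (?M $$ (a, b)))) = g ^ (n div 3)"
    using B.det_\<rho>X_power[OF PK] by (simp add: detM g_def)
  \<comment> \<open>Regrouping the tensor product: the regular matrices of the coordinates of
    \<open>xt\<close> form one matrix whose entries \<open>y p q\<close> are vectors of the algebra
    over \<open>F[t]\<close>. At t = 0 it is the identity matrix with \<open>e\<close> on the
    diagonal.\<close>
  define y where "y p q i = B.\<rho>X (xt i) $$ (p, q)" for p q i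
  have yV: "y p q \<in> fvecs n" if "p < ?m" "q < ?m" for p q
    using fvecsD[OF xtV] that by (simp add: fvecs_def y_def B.\<rho>X_zero)
  have y0: "(\<lambda>i. poly (y p q i) 0) = (if p = q then e else 0)" if "p < ?m" "q < ?m" for p q
  proof (rule ext)
    fix i
    have "poly (y p q i) 0 = map_mat (\<lambda>p. poly p 0) (B.\<rho>X (xt i)) $$ (p, q)"
      using that by (simp add: y_def)
    also have "\<dots> = B.\<rho> (h (e i)) $$ (p, q)"
      unfolding B.\<rho>X_eval[OF xtK] by (simp add: xt_def)
    finally show "poly (y p q i) 0 = (if p = q then e else 0) i"
      using that by (simp add: B.\<rho>_scalar)
  qed
  obtain s v where sv: "s \<in> fvecs n" "v \<in> fvecs n" "(\<lambda>i. poly (s i) 0) = e" "(\<lambda>i. poly (v i) 0) = e"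
    and E: "det (lmat ?\<iota> s) * det (block_mat n ?m ?m (\<lambda>p q. lmat ?\<iota> (y p q))) = det (lmat ?\<iota> v)"
    by (rule det_algebra_blocks[of ?m y]) (use yV y0 in blast)+
  define F where "F p q a b = mulR ?\<iota> (y p q) (fbasis b) a" for p q a b
  have "block_mat n ?m ?m (\<lambda>p q. lmat ?\<iota> (y p q)) = block_mat n ?m ?m (\<lambda>p q. mat n n (\<lambda>(a, b). F p q a b))"
    by (simp add: lmat_def F_def)
  also have "det \<dots> = det (block_mat ?m n n (\<lambda>a b. mat ?m ?m (\<lambda>(p, q). F p q a b)))"
    by (rule det_block_swap)
  also have "block_mat ?m n n (\<lambda>a b. mat ?m ?m (\<lambda>(p, q). F p q a b)) = block_mat ?m n n (\<lambda>a b. B.\<rho>X (?M $$ (a, b)))"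
  proof (rule block_mat_cong, rule mat_entries_eqI[of _ ?m ?m])
    fix i j p q assume ij: "i < n" "j < n" and pq: "p < ?m" "q < ?m"
    \<comment> \<open>The structure constants come from \<open>F\<close>, so \<open>\<rho>X\<close>
      sends them to scalar matrices.\<close>
    have entry_term: "B.\<rho>X ([:h (c i k l):] * xt k * fbasis j l) $$ (p, q) = [:c i k l:] * y p q k * fbasis j l" for k l
    proof (cases "l = j")
      case True
      have "B.\<rho>X ([:h (c i k l):] * xt k) $$ (p, q) = (\<Sum>r<?m. B.\<rho>X [:h (c i k l):] $$ (p, r) * B.\<rho>X (xt k) $$ (r, q))"
        unfolding B.\<rho>X_mult[OF B.KX_closed(6) xtK]
        by (rule mat_mult_index[OF B.\<rho>X_carrier(1) B.\<rho>X_carrier(1) pq])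
      also have "\<dots> = (\<Sum>r<?m. if r = p then [:c i k l:] * y p q k else 0)"
        using pq by (intro sum.cong) (auto simp: B.\<rho>X_const y_def simp del: mult_pCons_left)
      finally show ?thesis using True pq by (simp add: fbasis_def del: mult_pCons_left)
    qed (use pq in \<open>simp add: fbasis_def B.\<rho>X_zero\<close>)
    have "B.\<rho>X (?M $$ (i, j)) $$ (p, q)
        = (\<Sum>k<n. B.\<rho>X (\<Sum>l<n. [:h (c i k l):] * xt k * fbasis j l) $$ (p, q))"
      unfolding entry[OF ij] by (rule B.\<rho>X_sum[OF _ pq]) (intro B.KX_sum B.KX_closed xtK fbK)
    also have "\<dots> = (\<Sum>k<n. \<Sum>l<n. [:c i k l:] * y p q k * fbasis j l)"
    proof (rule sum.cong[OF refl])
      fix k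
      have "B.\<rho>X (\<Sum>l<n. [:h (c i k l):] * xt k * fbasis j l) $$ (p, q)
          = (\<Sum>l<n. B.\<rho>X ([:h (c i k l):] * xt k * fbasis j l) $$ (p, q))"
        by (rule B.\<rho>X_sum[OF _ pq]) (intro B.KX_closed xtK fbK)
      then show "B.\<rho>X (\<Sum>l<n. [:h (c i k l):] * xt k * fbasis j l) $$ (p, q)
          = (\<Sum>l<n. [:c i k l:] * y p q k * fbasis j l)"
        by (simp only: entry_term)
    qed
    finally have "B.\<rho>X (?M $$ (i, j)) $$ (p, q) = (\<Sum>k<n. \<Sum>l<n. [:c i k l:] * y p q k * fbasis j l)" .
    then show "mat ?m ?m (\<lambda>(p, q). F p q i j) $$ (p, q) = B.\<rho>X (?M $$ (i, j)) $$ (p, q)"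
      using ij pq by (simp add: F_def bilin_def)
  qed simp_all
  finally have "det (block_mat n ?m ?m (\<lambda>p q. lmat ?\<iota> (y p q))) = g ^ (n div 3)"
    using K_side by simp
  \<comment> \<open>Blocks from \<open>K\<close> gave \<open>g ^ (n div 3)\<close> for the common
    determinant, and blocks from the algebra give the quotient of
    \<open>det (lmat ?\<iota> v)\<close> by \<open>det (lmat ?\<iota> s)\<close>. All norms involved
    are 1 at t = 0, so the exponent can be removed.\<close>
  then have pow: "N ?\<iota> v ^ (n div 3) = (N ?\<iota> s * g) ^ (n div 3)"
    using E sv by (simp add: det_lmat[OF comm_ring_hom_const] power_mult_distrib)
  have v0: "poly (N ?\<iota> v) 0 = 1" and s0: "poly (N ?\<iota> s) 0 = 1"
    unfolding N_poly_eval sv(3,4) by (rule N_e)+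
  have "poly (N ?\<iota> s * g) 0 = 1"
    using s0 g0 by (simp only: poly_mult mult_1_left)
  then have eq: "N ?\<iota> v = N ?\<iota> s * g"
    by (rule poly_power_eq_imp_eq[OF pow n_div_3 v0])
  have "s \<noteq> 0"
  proof
    assume "s = 0"
    then have "poly (N ?\<iota> s) 0 = 0" by (simp add: N_def trilin_def)
    with s0 show False by simp
  qed
  \<comment> \<open>Plain evaluation at t = 1 could hit a zero of the norm of \<open>s\<close>; the
    descent cancels it first.\<close>
  from norm_descent[OF sv(2,1) this eq, of 1] show ?thesis by (simp only: g1)
qed

end

section \<open>Coordinates\<close>

definition unvec :: "nat \<Rightarrow> 'r::comm_ring_1 vec \<Rightarrow> nat \<Rightarrow> 'r" where
  "unvec n v = (\<lambda>i. if i < n then v $ i else 0)"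

lemma unvec_fvecs [simp]: "unvec n v \<in> fvecs n"
  by (simp add: unvec_def fvecs_def)

lemma vec_unvec [simp]: "v \<in> carrier_vec n \<Longrightarrow> vec n (unvec n v) = v"
  by (intro eq_vecI) (auto simp: unvec_def)

lemma unvec_vec [simp]: "x \<in> fvecs n \<Longrightarrow> unvec n (vec n x) = x"
  by (rule ext) (simp add: unvec_def fvecs_def)

lemma unvec_add:
  assumes "u \<in> carrier_vec n" "v \<in> carrier_vec n"
  shows "unvec n (u + v) = unvec n u + unvec n v"
proof (rule ext)
  fix i
  have "dim_vec v = n" using assms(2) by (rule carrier_vecD)
  then show "unvec n (u + v) i = (unvec n u + unvec n v) i"
    by (cases "i < n") (simp_all only: unvec_def plus_fun_apply index_add_vec if_True if_False add_0_left)
qed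

lemma unvec_smult:
  assumes "v \<in> carrier_vec n"
  shows "unvec n (b \<cdot>\<^sub>v v) = fscale b (unvec n v)"
proof (rule ext)
  fix i
  have "dim_vec v = n" using assms by (rule carrier_vecD)
  then show "unvec n (b \<cdot>\<^sub>v v) i = fscale b (unvec n v) i"
    by (cases "i < n") (simp_all only: unvec_def fscale_apply index_smult_vec if_True if_False mult_zero_right)
qed

lemma unvec_zero: "unvec n (0\<^sub>v n) = 0"
  by (rule ext) (simp add: unvec_def)

lemma vec_zero_fun: "vec n 0 = 0\<^sub>v n"
  by (rule eq_vecI) simp_all

lemma vec_add: "vec n (x + y) = vec n x + vec n (y :: nat \<Rightarrow> 'r::comm_ring_1)"
  by (intro eq_vecI) auto

lemma vec_fscale: "vec n (fscale b x) = b \<cdot>\<^sub>v vec n x"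
  by (intro eq_vecI) auto

lemma trilin_cong:
  assumes "\<And>i. i < n \<Longrightarrow> x i = x' i" "\<And>i. i < n \<Longrightarrow> y i = y' i" "\<And>i. i < n \<Longrightarrow> z i = z' i"
  shows "trilin \<iota> n a x y z = trilin \<iota> n a x' y' z'"
  unfolding trilin_def by (intro sum.cong refl) (simp add: assms)

lemma form_value_trilin:
  assumes "cubic_form n \<phi>"
  shows "form_value \<phi> v = trilin (\<lambda>c. c) n (cubic_coeff \<phi>) (unvec n v) (unvec n v) (unvec n v)"
proof -
  have "comm_ring_hom (\<lambda>c::'a. c)" by unfold_locales simp_all
  from comm_ring_hom.subst_cubic_form[OF this assms]
  have "form_value \<phi> v = trilin (\<lambda>c. c) n (cubic_coeff \<phi>) (\<lambda>i. v $ i) (\<lambda>i. v $ i) (\<lambda>i. v $ i)"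
    by (simp add: form_value_def)
  also have "\<dots> = trilin (\<lambda>c. c) n (cubic_coeff \<phi>) (unvec n v) (unvec n v) (unvec n v)"
    by (rule trilin_cong) (simp_all add: unvec_def)
  finally show ?thesis .
qed

lemma form_value_scalar_ext:
  fixes h :: "'f::field \<Rightarrow> 'k::field"
  assumes "cubic_form n \<phi>" "field_hom h"
  shows "form_value (scalar_ext h \<phi>) v = trilin h n (cubic_coeff \<phi>) (unvec n v) (unvec n v) (unvec n v)"
proof -
  interpret h: field_hom h by fact
  have id: "comm_ring_hom (\<lambda>c::'k. c)" by unfold_locales simp_all
  have lookup: "Poly_Mapping.lookup (scalar_ext h \<phi>) m = h (Poly_Mapping.lookup \<phi> m)" for m
    by (simp add: scalar_ext_def map.rep_eq when_def)
  then have keys: "Poly_Mapping.keys (scalar_ext h \<phi>) \<subseteq> Poly_Mapping.keys \<phi>"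
    by (auto simp: in_keys_iff)
  have "form_value (scalar_ext h \<phi>) v = subst_mpoly h (\<lambda>i. v $ i) \<phi>"
    unfolding form_value_def
    using comm_ring_hom.subst_mpoly_superset[OF id finite_keys keys] lookup
    by (simp add: subst_mpoly_monom_value)
  also have "\<dots> = trilin h n (cubic_coeff \<phi>) (\<lambda>i. v $ i) (\<lambda>i. v $ i) (\<lambda>i. v $ i)"
    by (rule h.subst_cubic_form[OF assms(1)])
  also have "\<dots> = trilin h n (cubic_coeff \<phi>) (unvec n v) (unvec n v) (unvec n v)"
    by (rule trilin_cong) (simp_all add: unvec_def)
  finally show ?thesis .
qed

lemma injective_linear_inverse:
  fixes f :: "(nat \<Rightarrow> 'f::field) \<Rightarrow> nat \<Rightarrow> 'f"
  assumes add: "\<And>x y. f (x + y) = f x + f y" and scale: "\<And>b x. f (fscale b x) = fscale b (f x)"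
    and V: "\<And>x. f x \<in> fvecs n" and inj: "\<And>x. x \<in> fvecs n \<Longrightarrow> f x = 0 \<Longrightarrow> x = 0"
  shows "\<exists>g. (\<forall>x y. g (x + y) = g x + g y) \<and> (\<forall>b x. g (fscale b x) = fscale b (g x)) \<and>
    (\<forall>x. g x \<in> fvecs n) \<and> (\<forall>x\<in>fvecs n. f (g x) = x \<and> g (f x) = x)"
proof -
  define M where "M = mat n n (\<lambda>(i, j). f (fbasis j) i)"
  have M: "M \<in> carrier_mat n n" by (simp add: M_def)
  have fM: "vec n (f x) = M *\<^sub>v vec n x" if "x \<in> fvecs n" for x
  proof (rule eq_vecI)
    fix i assume i: "i < dim_vec (M *\<^sub>v vec n x)"
    have "f x i = (\<Sum>j<n. x j * f (fbasis j) i)"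
      by (rule linear_expand[of "\<lambda>x. f x i"]) (use that in \<open>simp_all add: add scale\<close>)
    then show "vec n (f x) $ i = (M *\<^sub>v vec n x) $ i"
      using i by (simp add: M_def scalar_prod_def lessThan_atLeast0 mult.commute)
  qed (simp add: M_def)
  have "det M \<noteq> 0"
  proof
    assume "det M = 0"
    then obtain v where v: "v \<in> carrier_vec n" "v \<noteq> 0\<^sub>v n" "M *\<^sub>v v = 0\<^sub>v n"
      using det_0_iff_vec_prod_zero_field[OF M] by blast
    have "vec n (f (unvec n v)) = 0\<^sub>v n" using fM[of "unvec n v"] v by simp
    then have "f (unvec n v) = 0"
      using unvec_vec[OF V[of "unvec n v"]] by (simp only: unvec_zero)
    then have "unvec n v = 0" by (rule inj[OF unvec_fvecs])
    then have "vec n (unvec n v) = 0\<^sub>v n" by (simp only: vec_zero_fun)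
    then show False using v by simp
  qed
  then have "M \<in> Units (ring_mat TYPE('f) n ())" by (rule det_non_zero_imp_unit[OF M])
  then obtain M' where M': "M' \<in> carrier_mat n n" "M * M' = 1\<^sub>m n" "M' * M = 1\<^sub>m n"
    by (auto simp: Units_def ring_mat_def)
  define g where "g x = unvec n (M' *\<^sub>v vec n x)" for x
  have c: "M' *\<^sub>v vec n x \<in> carrier_vec n" for x using M' by simp
  have eqI: "x = y" if "vec n x = vec n y" "x \<in> fvecs n" "y \<in> fvecs n" for x y :: "nat \<Rightarrow> 'f"
    using arg_cong[OF that(1), of "unvec n"] unvec_vec[OF that(2)] unvec_vec[OF that(3)]
    by (simp only:)
  show ?thesis
  proof (intro exI[of _ g] conjI allI ballI)
    show "g (x + y) = g x + g y" for x y
      unfolding g_def vec_add using M'(1) by (simp add: mult_add_distrib_mat_vec[of _ n n] unvec_add c)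
    show "g (fscale b x) = fscale b (g x)" for b x
      unfolding g_def vec_fscale using M'(1) by (simp add: mult_mat_vec[of _ n n] unvec_smult c)
    show gV: "g x \<in> fvecs n" for x by (simp add: g_def)
    show "f (g x) = x" if x: "x \<in> fvecs n" for x
    proof (rule eqI)
      have "vec n (f (g x)) = M *\<^sub>v (M' *\<^sub>v vec n x)"
        using fM[OF gV[of x]] c by (simp add: g_def)
      also have "\<dots> = (M * M') *\<^sub>v vec n x"
        using M M'(1) by (simp add: assoc_mult_mat_vec[of _ n n _ n])
      finally show "vec n (f (g x)) = vec n x" by (simp add: M'(2))
    qed (use V x in auto)
    show "g (f x) = x" if x: "x \<in> fvecs n" for x
    proof (rule eqI)
      have "vec n (g (f x)) = M' *\<^sub>v (M *\<^sub>v vec n x)"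
        using fM[OF x] c[of "f x"] by (simp add: g_def)
      also have "\<dots> = (M' * M) *\<^sub>v vec n x"
        using M M'(1) by (simp add: assoc_mult_mat_vec[of _ n n _ n])
      finally show "vec n (g (f x)) = vec n x" by (simp add: M'(3))
    qed (use gV x in auto)
  qed
qed

lemma bilin_of_basis:
  fixes mul :: "(nat \<Rightarrow> 'f::comm_ring_1) \<Rightarrow> (nat \<Rightarrow> 'f) \<Rightarrow> nat \<Rightarrow> 'f"
  assumes "\<And>x x' y. mul (x + x') y = mul x y + mul x' y" "\<And>x y y'. mul x (y + y') = mul x y + mul x y'"
    and "\<And>b x y. mul (fscale b x) y = fscale b (mul x y)" "\<And>b x y. mul x (fscale b y) = fscale b (mul x y)"
    and V: "\<And>x y. x \<in> fvecs n \<Longrightarrow> y \<in> fvecs n \<Longrightarrow> mul x y \<in> fvecs n" and xy: "x \<in> fvecs n" "y \<in> fvecs n"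
  shows "bilin (\<lambda>c. c) n (\<lambda>l i j. mul (fbasis i) (fbasis j) l) x y = mul x y"
proof (rule ext)
  fix l
  show "bilin (\<lambda>c. c) n (\<lambda>l i j. mul (fbasis i) (fbasis j) l) x y l = mul x y l"
  proof (cases "l < n")
    case True
    have "mul x y l = (\<Sum>i<n. x i * mul (fbasis i) y l)"
      by (rule linear_expand[of "\<lambda>x. mul x y l"]) (simp_all add: assms)
    also have "\<dots> = (\<Sum>i<n. x i * (\<Sum>j<n. y j * mul (fbasis i) (fbasis j) l))"
      by (intro sum.cong refl arg_cong[of _ _ "(*) _"] linear_expand[of "\<lambda>y. mul (fbasis _) y l"])
        (simp_all add: assms)
    finally show ?thesis
      using True by (simp add: bilin_def sum_distrib_left ac_simps)
  next
    case False
    then show ?thesis using fvecsD[OF V[OF xy], of l] by (simp add: bilin_def)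
  qed
qed

lemma vector_space_fscale: "vector_space (fscale :: 'f::field \<Rightarrow> (nat \<Rightarrow> 'f) \<Rightarrow> nat \<Rightarrow> 'f)"
  by unfold_locales (auto simp: fun_eq_iff algebra_simps)

section \<open>A composition for a cubic form in coordinates\<close>

locale cubic_form_composition =
  fixes n :: nat and \<phi> :: "'f::field mpoly"
    and mul :: "(nat \<Rightarrow> 'f) \<Rightarrow> (nat \<Rightarrow> 'f) \<Rightarrow> nat \<Rightarrow> 'f" and \<theta> :: "(nat \<Rightarrow> 'f) \<Rightarrow> (nat \<Rightarrow> 'f) \<Rightarrow> (nat \<Rightarrow> 'f) \<Rightarrow> 'f"
  assumes cubic: "cubic_form n \<phi>"
    and composition: "cubic_composition fscale (fvecs n) mul \<theta>"
    and \<theta>: "x \<in> fvecs n \<Longrightarrow> \<theta> x x x = trilin (\<lambda>c. c) n (cubic_coeff \<phi>) x x x"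
begin

sublocale C: cubic_composition fscale "fvecs n" mul \<theta>
  by (rule composition)

abbreviation "nrm x \<equiv> trilin (\<lambda>c. c) n (cubic_coeff \<phi>) x x x"

lemma norm_mul: "x \<in> fvecs n \<Longrightarrow> y \<in> fvecs n \<Longrightarrow> nrm (mul x y) = nrm x * nrm y"
  using C.comp[of x y] \<theta>[of x] \<theta>[of y] \<theta>[OF C.mul_V[of x y]] by simp

lemma norm_fscale: "nrm (fscale b x) = b ^ 3 * nrm x"
  by (simp add: trilin_linear power3_eq_cube mult.assoc)

lemma ex_norm_one:
  assumes "0 < n"
  obtains e where "e \<in> fvecs n" "nrm e = 1"
proof -
  obtain e0 where e0: "e0 \<in> fvecs n" "nrm e0 \<noteq> 0"
  proof (rule ccontr)
    assume "\<not> thesis"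
    then have null: "nrm x = 0" if "x \<in> fvecs n" for x
      using that \<open>\<And>e0. e0 \<in> fvecs n \<Longrightarrow> nrm e0 \<noteq> 0 \<Longrightarrow> thesis\<close> by blast
    have "\<theta> x y z = 0" if "x \<in> fvecs n" "y \<in> fvecs n" "z \<in> fvecs n" for x y z
      by (rule symmetric_trilinear_zero[of \<theta> "fvecs n", OF C.\<theta>_add C.\<theta>_sym1 C.\<theta>_sym2 _ _ C.two C.three that])
        (simp_all only: fvecs_closed \<theta> null)
    then have "(fbasis 0 :: nat \<Rightarrow> 'f) = 0"
      using assms by (intro C.nondeg) auto
    then have "fbasis 0 0 = (0 :: 'f)" by simp
    then show False by (simp add: fbasis_def)
  qed
  show ?thesis
  proof
    \<comment> \<open>The triple product has norm \<open>nrm e0 ^ 3\<close>, and the scalar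
      contributes the inverse of this cube.\<close>
    show "fscale (inverse (nrm e0)) (mul e0 (mul e0 e0)) \<in> fvecs n" by simp
    have "nrm (fscale (inverse (nrm e0)) (mul e0 (mul e0 e0)))
        = inverse (nrm e0) ^ 3 * (nrm e0 * (nrm e0 * nrm e0))"
      using e0(1) by (simp only: norm_fscale norm_mul C.mul_V)
    also have "\<dots> = 1" using e0(2) by (simp add: power3_eq_cube field_simps)
    finally show "nrm (fscale (inverse (nrm e0)) (mul e0 (mul e0 e0))) = 1" .
  qed
qed

text \<open>Multiplication by \<open>e\<close> scales \<theta> by \<open>nrm e\<close>, so its
  kernel lies in the radical of \<theta>, which is zero.\<close>

lemma mul_inverse:
  assumes e: "e \<in> fvecs n" "nrm e \<noteq> 0"
  shows "\<exists>g. (\<forall>x y. g (x + y) = g x + g y) \<and> (\<forall>b x. g (fscale b x) = fscale b (g x)) \<and>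
    (\<forall>x. g x \<in> fvecs n) \<and> (\<forall>x\<in>fvecs n. mul e (g x) = x \<and> g (mul e x) = x)"
proof -
  have inj: "x = 0" if x: "x \<in> fvecs n" "mul e x = 0" for x
  proof (rule C.nondeg[OF x(1)])
    fix y z :: "nat \<Rightarrow> 'f" assume "y \<in> fvecs n" "z \<in> fvecs n"
    then have "\<theta> e e e * \<theta> x y z = 0"
      using C.composition_trilinear[OF e(1) x(1), of y z] x(2) by simp
    then show "\<theta> x y z = 0" using e \<theta> by simp
  qed
  show ?thesis
    by (rule injective_linear_inverse[of "mul e" n])
      (rule C.mul_add_right C.mul_scale_right C.mul_V inj; assumption?)+
qed

lemma opposite: "cubic_form_composition n \<phi> (\<lambda>x y. mul y x) \<theta>"
proof (intro cubic_form_composition.intro cubic \<theta>)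
  show "cubic_composition fscale (fvecs n) (\<lambda>x y. mul y x) \<theta>"
  proof unfold_locales
    show "x \<in> fvecs n \<Longrightarrow> y \<in> fvecs n \<Longrightarrow>
        \<theta> (mul y x) (mul y x) (mul y x) = \<theta> x x x * \<theta> y y y" for x y
      using C.comp[of y x] by (simp add: mult.commute)
    show "\<theta> x y z = \<theta> y x z" "\<theta> x y z = \<theta> x z y" for x y z
      by (rule C.\<theta>_sym1 C.\<theta>_sym2)+
  qed (auto simp: C.V C.mul_add_left C.mul_add_right C.\<theta>_add C.\<theta>_scale intro: C.nondeg)
qed

text \<open>Kaplansky's trick: an isotope of the composition has a unit.\<close>

lemma unital_isotope:
  assumes "0 < n"
  obtains mul' e where "cubic_algebra fscale (fvecs n) mul' \<theta> e"
proof -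
  interpret op: cubic_form_composition n \<phi> "\<lambda>x y. mul y x" \<theta> by (rule opposite)
  obtain e where e: "e \<in> fvecs n" "nrm e = 1" by (rule ex_norm_one[OF assms])
  then have nz: "nrm e \<noteq> 0" by simp
  obtain l where "(\<forall>x y. l (x + y) = l x + l y) \<and> (\<forall>b x. l (fscale b x) = fscale b (l x)) \<and>
    (\<forall>x. l x \<in> fvecs n) \<and> (\<forall>x\<in>fvecs n. mul e (l x) = x \<and> l (mul e x) = x)"
    using mul_inverse[OF e(1) nz] ..
  then have l: "\<And>x y. l (x + y) = l x + l y" "\<And>b x. l (fscale b x) = fscale b (l x)"
    "\<And>x. l x \<in> fvecs n" "\<And>x. x \<in> fvecs n \<Longrightarrow> mul e (l x) = x" "\<And>x. x \<in> fvecs n \<Longrightarrow> l (mul e x) = x"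
    by simp_all
  obtain r where "(\<forall>x y. r (x + y) = r x + r y) \<and> (\<forall>b x. r (fscale b x) = fscale b (r x)) \<and>
    (\<forall>x. r x \<in> fvecs n) \<and> (\<forall>x\<in>fvecs n. mul (r x) e = x \<and> r (mul x e) = x)"
    using op.mul_inverse[OF e(1) nz] ..
  then have r: "\<And>x y. r (x + y) = r x + r y" "\<And>b x. r (fscale b x) = fscale b (r x)"
    "\<And>x. r x \<in> fvecs n" "\<And>x. x \<in> fvecs n \<Longrightarrow> mul (r x) e = x" "\<And>x. x \<in> fvecs n \<Longrightarrow> r (mul x e) = x"
    by simp_all
  have nl: "nrm (l x) = nrm x" if "x \<in> fvecs n" for x
    using norm_mul[OF e(1) l(3)[of x]] l(4)[OF that] e(2) by simp
  have nr: "nrm (r x) = nrm x" if "x \<in> fvecs n" for x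
    using norm_mul[OF r(3)[of x] e(1)] r(4)[OF that] e(2) by simp
  \<comment> \<open>Here \<open>l\<close> and \<open>r\<close> invert left and right multiplication
    by \<open>e\<close>, and they preserve the norm because \<open>nrm e = 1\<close>. The unit is
    \<open>mul e e\<close>, since both \<open>r\<close> and \<open>l\<close> send it back to
    \<open>e\<close>.\<close>
  have "cubic_algebra fscale (fvecs n) (\<lambda>x y. mul (r x) (l y)) \<theta> (mul e e)"
  proof unfold_locales
    show "\<theta> x y z = \<theta> y x z" "\<theta> x y z = \<theta> x z y" for x y z
      by (rule C.\<theta>_sym1 C.\<theta>_sym2)+
    show "\<theta> (mul (r x) (l y)) (mul (r x) (l y)) (mul (r x) (l y)) = \<theta> x x x * \<theta> y y y"
      if "x \<in> fvecs n" "y \<in> fvecs n" for x y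
      using that by (simp add: \<theta> norm_mul l(3) r(3) nl nr)
    show "\<theta> (mul e e) (mul e e) (mul e e) = 1"
      using e by (simp add: \<theta> norm_mul)
    show "mul (r (mul e e)) (l x) = x" "mul (r x) (l (mul e e)) = x" if "x \<in> fvecs n" for x
      using that e l(4,5) r(4,5) by simp_all
  qed (auto simp: C.V C.mul_add_left C.mul_add_right C.\<theta>_add C.\<theta>_scale l(1,2) r(1,2) intro: C.nondeg)
  then show ?thesis by (rule that)
qed

lemma represented_imp_similarity_factor:
  assumes y: "y \<in> fvecs n" "nrm y = b" and b: "b \<noteq> 0"
  shows "similarity_factor UNIV n \<phi> b"
proof -
  have nz: "nrm y \<noteq> 0" using y b by simp
  obtain g where "\<forall>x. g x \<in> fvecs n" "\<forall>x\<in>fvecs n. mul y (g x) = x \<and> g (mul y x) = x"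
    using mul_inverse[OF y(1) nz] by blast
  then have g: "\<And>x. g x \<in> fvecs n" "\<And>x. x \<in> fvecs n \<Longrightarrow> mul y (g x) = x"
    "\<And>x. x \<in> fvecs n \<Longrightarrow> g (mul y x) = x"
    by simp_all
  define f where "f v = vec n (mul y (unvec n v))" for v
  have UNIV: "vecs_over (UNIV :: 'f set) n = carrier_vec n" by (auto simp: vecs_over_def)
  have "bij_betw f (carrier_vec n) (carrier_vec n)"
    by (rule bij_betw_byWitness[of _ "\<lambda>v. vec n (g (unvec n v))"]) (auto simp: f_def g)
  moreover have "f (u + v) = f u + f v" if "u \<in> carrier_vec n" "v \<in> carrier_vec n" for u v
    using that by (simp add: f_def unvec_add C.mul_add_right vec_add)
  moreover have "f (a \<cdot>\<^sub>v v) = a \<cdot>\<^sub>v f v" if "v \<in> carrier_vec n" for a v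
    using that by (simp add: f_def unvec_smult vec_fscale)
  moreover have "form_value \<phi> (f v) = b * form_value \<phi> v" for v
    using y by (simp add: form_value_trilin[OF cubic] f_def norm_mul)
  ultimately show ?thesis
    unfolding similarity_factor_def isomorphic_forms_def UNIV by (intro exI[of _ f]) blast
qed

end

section \<open>The norm principle\<close>

lemma
  assumes fin: "finite_extension h K"
  shows field_norm_mult: "x \<in> K \<Longrightarrow> y \<in> K \<Longrightarrow> field_norm h K (x * y) = field_norm h K x * field_norm h K y"
    and field_norm_nonzero: "x \<in> K \<Longrightarrow> x \<noteq> 0 \<Longrightarrow> field_norm h K x \<noteq> 0"
proof -
  define bs where "bs = (SOME bs. is_ext_basis h K bs)"
  have basis: "is_ext_basis h K bs"
    unfolding bs_def by (rule someI_ex[OF ext_basis_exists[OF fin]])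
  interpret B: ext_basis h K bs
    using fin basis by (intro ext_basis.intro) (simp_all add: finite_extension_def)
  have norm: "field_norm h K x = det (B.\<rho> x)" for x
    by (simp add: field_norm_def bs_def)
  show mult: "field_norm h K (x * y) = field_norm h K x * field_norm h K y" if "x \<in> K" "y \<in> K" for x y
    using that by (simp add: norm B.\<rho>_mult det_mult[of _ B.m])
  show "field_norm h K x \<noteq> 0" if x: "x \<in> K" "x \<noteq> 0"
  proof -
    have "inverse x \<in> K" using B.field_extension x(1) by (simp add: field_extension_def)
    then have "field_norm h K x * field_norm h K (inverse x) = field_norm h K 1"
      using mult[of x "inverse x"] x by simp
    then show ?thesis by (auto simp: norm B.\<rho>_one)
  qed
qed

lemma (in cubic_algebra) polar_sharp_linear:
  "polar_sharp (x + x') y = polar_sharp x y + polar_sharp x' y"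
  "polar_sharp x (y + y') = polar_sharp x y + polar_sharp x y'"
  "polar_sharp (c *s x) y = c *s polar_sharp x y"
  "polar_sharp x (c *s y) = c *s polar_sharp x y"
  by (simp_all add: polar_sharp_def mul_linear T_linear \<theta>_linear algebra_simps)

context cubic_form_composition begin

text \<open>Both sides are symmetric trilinear with the same diagonal; the right side symmetrizes
  the tensor \<open>cubic_coeff \<phi>\<close>.\<close>

lemma \<theta>_permutations:
  assumes "x \<in> fvecs n" "y \<in> fvecs n" "z \<in> fvecs n"
  defines "a \<equiv> cubic_coeff \<phi>"
  shows "6 * \<theta> x y z = trilin (\<lambda>c. c) n a x y z + trilin (\<lambda>c. c) n a x z y + trilin (\<lambda>c. c) n a y x z
    + trilin (\<lambda>c. c) n a y z x + trilin (\<lambda>c. c) n a z x y + trilin (\<lambda>c. c) n a z y x"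
proof -
  define P where "P x y z = trilin (\<lambda>c. c) n a x y z + trilin (\<lambda>c. c) n a x z y + trilin (\<lambda>c. c) n a y x z
    + trilin (\<lambda>c. c) n a y z x + trilin (\<lambda>c. c) n a z x y + trilin (\<lambda>c. c) n a z y x" for x y z
  have "6 * \<theta> x y z - P x y z = 0"
  proof (rule symmetric_trilinear_zero[of "\<lambda>x y z. 6 * \<theta> x y z - P x y z" "fvecs n"])
    show "6 * \<theta> (x + x') y z - P (x + x') y z = 6 * \<theta> x y z - P x y z + (6 * \<theta> x' y z - P x' y z)" for x x' y z
      unfolding P_def trilin_linear C.\<theta>_add by (simp add: algebra_simps)
    show "6 * \<theta> x y z - P x y z = 6 * \<theta> y x z - P y x z" for x y z
      using C.\<theta>_sym1[of x y z] by (simp add: P_def)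
    show "6 * \<theta> x y z - P x y z = 6 * \<theta> x z y - P x z y" for x y z
      using C.\<theta>_sym2[of x y z] by (simp add: P_def)
    show "6 * \<theta> x x x - P x x x = 0" if "x \<in> fvecs n" for x
      using \<theta>[OF that] by (simp add: P_def a_def)
  qed (use assms(1-3) in auto)
  then show ?thesis by (simp add: P_def)
qed

lemma extension_norm_value:
  fixes h :: "'f \<Rightarrow> 'k::field"
  assumes fin: "finite_extension h K" and x: "x \<in> fvecs n" "\<And>i. x i \<in> K" and n: "0 < n"
  shows "\<exists>y\<in>fvecs n. nrm y = field_norm h K (trilin h n (cubic_coeff \<phi>) x x x)"
proof -
  obtain mul' e where A: "cubic_algebra fscale (fvecs n) mul' \<theta> e" by (rule unital_isotope[OF n])
  interpret A: cubic_algebra fscale "fvecs n" mul' \<theta> e by (rule A)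
  have N: "A.N v = nrm v" if "v \<in> fvecs n" for v
    using \<theta>[OF that] by (simp add: A.N_def)
  have e: "nrm e = 1" using \<theta>[OF A.e_V] A.\<theta>_e by simp
  have iso: ?thesis if v: "v \<in> fvecs n" "v \<noteq> 0" "nrm v = 0" for v
    using A.isotropic_universal[OF v(1,2)] N v by auto
  show ?thesis
  proof (cases "\<exists>v\<in>fvecs n. v \<noteq> 0 \<and> nrm v = 0")
    case True
    then show ?thesis using iso by blast
  next
    case False
    then have aniso: "v = 0" if "v \<in> fvecs n" "nrm v = 0" for v using that by blast
    interpret h: field_hom h using fin by (simp add: finite_extension_def field_extension_def)
    show ?thesis
    proof (cases "n = 1")
      case True
      \<comment> \<open>In dimension 1 every vector is a multiple of \<open>e\<close>, so there is
        no generic non-scalar element. The form is \<alpha> times a cube with \<alpha> the inverse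
        cube of \<open>e 0\<close>; a value over \<open>K\<close> is thus a cube of some
        \<open>b\<close>, and its norm is the value at the norm of \<open>b\<close> times
        \<open>e\<close>.\<close>
      define \<alpha> where "\<alpha> = cubic_coeff \<phi> 0 0 0"
      have \<alpha>: "\<alpha> * e 0 * e 0 * e 0 = 1" using e True by (simp add: trilin_def \<alpha>_def)
      define b where "b = x 0 * h (inverse (e 0))"
      have "e 0 \<noteq> 0" using \<alpha> by auto
      then have "\<alpha> = inverse (e 0) * (inverse (e 0) * inverse (e 0))"
        using \<alpha> by (simp add: field_simps)
      then have "h \<alpha> = h (inverse (e 0)) * (h (inverse (e 0)) * h (inverse (e 0)))"
        by (simp only: h.hom_mult)
      then have val: "trilin h n (cubic_coeff \<phi>) x x x = b * (b * b)"
        using True by (simp add: trilin_def \<alpha>_def[symmetric] b_def ac_simps del: h.hom_inverse)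
      have K: "x \<in> K \<Longrightarrow> y \<in> K \<Longrightarrow> x * y \<in> K" "h c \<in> K" for x y c
        using fin by (auto simp: finite_extension_def field_extension_def)
      have bK: "b \<in> K" unfolding b_def by (intro K x(2))
      have "nrm (fscale (field_norm h K b) e) = field_norm h K (b * (b * b))"
        by (simp add: norm_fscale e field_norm_mult[OF fin] bK K(1) power3_eq_cube del: fscale_apply)
      then show ?thesis unfolding val by (intro bexI[of _ "fscale (field_norm h K b) e"]) auto
    next
      case False
      let ?c = "\<lambda>l i j. mul' (fbasis i) (fbasis j) l" and ?q = "\<lambda>l i j. A.polar_sharp (fbasis i) (fbasis j) l"
      have c: "bilin (\<lambda>c. c) n ?c u v = mul' u v" if "u \<in> fvecs n" "v \<in> fvecs n" for u v
        using that by (intro bilin_of_basis A.mul_V)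
          (rule A.mul_add_left A.mul_add_right A.mul_scale_left A.mul_scale_right)+
      have q: "bilin (\<lambda>c. c) n ?q u v = A.polar_sharp u v" if "u \<in> fvecs n" "v \<in> fvecs n" for u v
        using that by (intro bilin_of_basis A.polar_sharp_V) (rule A.polar_sharp_linear)+
      have "division_norm_algebra n ?c ?q (cubic_coeff \<phi>) e"
      proof (rule division_norm_algebra.intro)
        show "(2 :: 'f) \<noteq> 0" "(3 :: 'f) \<noteq> 0" by simp_all
        show "2 \<le> n" using n False by simp
        show "nrm e = 1" by (rule e)
        show "e \<in> fvecs n" by (rule A.e_V)
        fix u v w :: "nat \<Rightarrow> 'f" assume u: "u \<in> fvecs n"
        show "bilin (\<lambda>c. c) n ?c e u = u" using u by (simp add: c)
        show "nrm u = 0 \<Longrightarrow> u = 0" by (rule aniso[OF u])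
        assume v: "v \<in> fvecs n"
        show "nrm (bilin (\<lambda>c. c) n ?c u v) = nrm u * nrm v"
          using A.comp[OF u v] u v by (simp add: c \<theta>)
        assume w: "w \<in> fvecs n"
        have uvw: "u \<in> fvecs n" "v \<in> fvecs n" "w \<in> fvecs n" by fact+
        show "bilin (\<lambda>c. c) n ?c (bilin (\<lambda>c. c) n ?c u v) w = bilin (\<lambda>c. c) n ?c u (bilin (\<lambda>c. c) n ?c v w)"
          unfolding c[OF u v] c[OF v w] c[OF A.mul_V w] c[OF u A.mul_V]
          by (rule A.anisotropic_associative[OF _ uvw]) (simp add: N aniso)
        show "bilin (\<lambda>c. c) n ?c (bilin (\<lambda>c. c) n ?q u v) w + bilin (\<lambda>c. c) n ?c (bilin (\<lambda>c. c) n ?q v w) u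
            + bilin (\<lambda>c. c) n ?c (bilin (\<lambda>c. c) n ?q w u) v
          = fscale (trilin (\<lambda>c. c) n (cubic_coeff \<phi>) u v w + trilin (\<lambda>c. c) n (cubic_coeff \<phi>) u w v
            + trilin (\<lambda>c. c) n (cubic_coeff \<phi>) v u w + trilin (\<lambda>c. c) n (cubic_coeff \<phi>) v w u
            + trilin (\<lambda>c. c) n (cubic_coeff \<phi>) w u v + trilin (\<lambda>c. c) n (cubic_coeff \<phi>) w v u) e"
          unfolding q[OF u v] q[OF v w] q[OF w u] c[OF A.polar_sharp_V[OF u v] w]
            c[OF A.polar_sharp_V[OF v w] u] c[OF A.polar_sharp_V[OF w u] v]
          using A.polar_sharp_mul[OF uvw] \<theta>_permutations[OF uvw] by simp
      qed
      then interpret D: division_norm_algebra n ?c ?q "cubic_coeff \<phi>" e .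
      show ?thesis using D.field_norm_value[OF fin x] unfolding D.N_def .
    qed
  qed
qed

theorem norm_principle:
  fixes h :: "'f \<Rightarrow> 'k::field"
  assumes fin: "finite_extension h K"
  shows "scharlau_norm_principle h K n \<phi>"
  unfolding scharlau_norm_principle_def
proof (intro ballI impI)
  fix a assume a: "a \<in> K - {0}" and sim: "similarity_factor K n (scalar_ext h \<phi>) a"
  have ext: "field_hom h" "range h \<subseteq> K"
    using fin by (simp_all add: finite_extension_def field_extension_def)
  interpret h: field_hom h by (rule ext(1))
  have hK: "h c \<in> K" for c using ext(2) by blast
  show "similarity_factor UNIV n \<phi> (field_norm h K a)"
  proof (cases "n = 0")
    case True
    \<comment> \<open>On the zero space the form vanishes, and the identity is a similitude with any
      factor.\<close>
    then have "form_value \<phi> v = 0" for v by (simp add: form_value_trilin[OF cubic] trilin_def)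
    then show ?thesis
      unfolding similarity_factor_def isomorphic_forms_def by (intro exI[of _ id]) simp
  next
    case False
    then have n: "0 < n" by simp
    obtain e where e: "e \<in> fvecs n" "nrm e = 1" by (rule ex_norm_one[OF n])
    obtain f where f: "bij_betw f (vecs_over K n) (vecs_over K n)"
      "\<forall>v\<in>vecs_over K n. form_value (scalar_ext h \<phi>) (f v) = a * form_value (scalar_ext h \<phi>) v"
      using sim unfolding similarity_factor_def isomorphic_forms_def by blast
    \<comment> \<open>The vector \<open>e\<close> over \<open>K\<close> has value 1, so a similitude
      with factor \<open>a\<close> sends it to a vector of value \<open>a\<close>.\<close>
    define v where "v = vec n (\<lambda>i. h (e i))"
    have v: "v \<in> vecs_over K n" by (simp add: vecs_over_def v_def hK)
    have fv: "f v \<in> vecs_over K n" using f(1) v by (rule bij_betwE[THEN bspec])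
    have "trilin h n (cubic_coeff \<phi>) (unvec n v) (unvec n v) (unvec n v) = h (nrm e)"
      unfolding v_def unvec_vec[OF h.fvecs_hom[OF e(1)]] by (rule h.trilin_hom)
    then have norm_a: "trilin h n (cubic_coeff \<phi>) (unvec n (f v)) (unvec n (f v)) (unvec n (f v)) = a"
      using f(2) v by (simp add: form_value_scalar_ext[OF cubic ext(1)] e)
    have "unvec n (f v) i \<in> K" for i
      using fv hK[of 0] by (simp add: unvec_def vecs_over_def)
    from extension_norm_value[OF fin unvec_fvecs this n]
    obtain y where y: "y \<in> fvecs n" "nrm y = field_norm h K a" unfolding norm_a by blast
    show ?thesis
      by (rule represented_imp_similarity_factor[OF y]) (use a field_norm_nonzero[OF fin] in auto)
  qed
qed

end

section \<open>Compositions for the two kinds of forms in the theorem\<close>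

lemma (in comm_ring_hom) hom_subst_mpoly:
  "hom (subst_mpoly \<iota> r p) = subst_mpoly (\<lambda>c. hom (\<iota> c)) (\<lambda>i. hom (r i)) p"
  by (simp add: subst_mpoly_monom_value hom_sum hom_mult monom_value_subst[OF comm_ring_hom_axioms])

lemma comm_ring_hom_ident: "comm_ring_hom (\<lambda>c::'r::comm_ring_1. c)"
  by unfold_locales simp_all

lemma form_value_vec:
  assumes "cubic_form n \<phi>" "x \<in> fvecs n"
  shows "form_value \<phi> (vec n x) = trilin (\<lambda>c. c) n (cubic_coeff \<phi>) x x x"
  by (simp add: form_value_trilin[OF assms(1)] assms(2))

lemma subspace_fvecs: "module.subspace (fscale :: 'f::field \<Rightarrow> _) (fvecs n)"
proof -
  interpret vector_space "fscale :: 'f \<Rightarrow> _" by (rule vector_space_fscale)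
  show ?thesis by (auto simp: subspace_def)
qed

lemma permits_composition_imp_cubic_form_composition:
  fixes \<phi> :: "'f::field mpoly"
  assumes cubic: "cubic_form n \<phi>" and comp: "permits_composition n \<phi>"
    and char: "(2::'f) \<noteq> 0" "(3::'f) \<noteq> 0"
  shows "\<exists>mul \<theta>. cubic_form_composition n \<phi> mul \<theta>"
proof -
  obtain T where T: "symmetric_trilinear n T" "\<forall>v\<in>carrier_vec n. T v v v = form_value \<phi> v"
    "\<forall>v\<in>carrier_vec n. (\<forall>w\<in>carrier_vec n. \<forall>u\<in>carrier_vec n. T v w u = 0) \<longrightarrow> v = 0\<^sub>v n"
    using comp unfolding permits_composition_def nondegenerate_def by blast
  obtain b where b: "subst_mpoly mconst mvar \<phi> * subst_mpoly mconst (\<lambda>i. mvar (n + i)) \<phi> =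
    subst_mpoly mconst (\<lambda>l. \<Sum>i<n. \<Sum>j<n. mconst (b l i j) * mvar i * mvar (n + j)) \<phi>"
    using comp unfolding permits_composition_def by blast
  have T_sym: "T u v w = T v u w \<and> T u v w = T u w v"
    if "u \<in> carrier_vec n" "v \<in> carrier_vec n" "w \<in> carrier_vec n" for u v w
    using T(1) that unfolding symmetric_trilinear_def by blast
  have T_add: "T (u + u') v w = T u v w + T u' v w"
    if "u \<in> carrier_vec n" "u' \<in> carrier_vec n" "v \<in> carrier_vec n" "w \<in> carrier_vec n" for u u' v w
    using T(1) that unfolding symmetric_trilinear_def by blast
  have T_scale: "T (c \<cdot>\<^sub>v u) v w = c * T u v w"
    if "u \<in> carrier_vec n" "v \<in> carrier_vec n" "w \<in> carrier_vec n" for c u v w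
    using T(1) that unfolding symmetric_trilinear_def by blast
  let ?N = "\<lambda>x. trilin (\<lambda>c. c) n (cubic_coeff \<phi>) x x x"
  let ?mul = "bilin (\<lambda>c. c) n b"
  \<comment> \<open>The laws of \<open>T\<close> are assumed on \<open>carrier_vec n\<close> only.
    Truncating by \<open>vec n\<close> first makes them hold on all functions.\<close>
  define \<theta> where "\<theta> x y z = T (vec n x) (vec n y) (vec n z)" for x y z
  have diag: "\<theta> x x x = ?N x" if "x \<in> fvecs n" for x
    using T(2) form_value_vec[OF cubic that] by (simp add: \<theta>_def)
  have mult: "?N (?mul x y) = ?N x * ?N y" for x y
  proof -
    \<comment> \<open>The assignment that splits the \<open>2n\<close> indeterminates into the
      coordinates of \<open>x\<close> and of \<open>y\<close>.\<close>
    define r where "r i = (if i < n then x i else y (i - n))" for i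
    interpret id: comm_ring_hom "\<lambda>c::'f. c" by (rule comm_ring_hom_ident)
    interpret E: comm_ring_hom "subst_mpoly (\<lambda>c. c) r" by (rule id.comm_ring_hom_subst_mpoly)
    have E: "subst_mpoly (\<lambda>c. c) r (subst_mpoly mconst s \<phi>)
        = trilin (\<lambda>c. c) n (cubic_coeff \<phi>) (\<lambda>i. subst_mpoly (\<lambda>c. c) r (s i))
            (\<lambda>i. subst_mpoly (\<lambda>c. c) r (s i)) (\<lambda>i. subst_mpoly (\<lambda>c. c) r (s i))" for s
      unfolding E.hom_subst_mpoly id.subst_mpoly_mconst by (rule id.subst_cubic_form[OF cubic])
    have E_prod: "subst_mpoly (\<lambda>c. c) r (\<Sum>i<n. \<Sum>j<n. mconst (b l i j) * mvar i * mvar (n + j)) = ?mul x y l"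
      if "l < n" for l
      unfolding E.hom_sum E.hom_mult id.subst_mpoly_mvar id.subst_mpoly_mconst
      using that by (simp add: bilin_def r_def)
    have "?N x * ?N y = subst_mpoly (\<lambda>c. c) r (subst_mpoly mconst mvar \<phi> * subst_mpoly mconst (\<lambda>i. mvar (n + i)) \<phi>)"
      unfolding E.hom_mult E id.subst_mpoly_mvar
      by (intro arg_cong2[of _ _ _ _ "(*)"] trilin_cong) (simp_all add: r_def)
    also have "\<dots> = ?N (?mul x y)"
      unfolding b E by (intro trilin_cong E_prod)
    finally show ?thesis by simp
  qed
  have "cubic_composition fscale (fvecs n) ?mul \<theta>"
  proof (intro cubic_composition.intro vector_space_fscale cubic_composition_axioms.intro subspace_fvecs char)
    show "\<theta> x y z = \<theta> y x z" "\<theta> x y z = \<theta> x z y" for x y z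
      unfolding \<theta>_def by (rule conjunct1[OF T_sym] conjunct2[OF T_sym]; simp)+
    show "\<theta> (x + x') y z = \<theta> x y z + \<theta> x' y z" "\<theta> (fscale c x) y z = c * \<theta> x y z" for x x' y z c
      unfolding \<theta>_def vec_add vec_fscale by (rule T_add T_scale; simp)+
    show "v = 0" if v: "v \<in> fvecs n" "\<And>y z. y \<in> fvecs n \<Longrightarrow> z \<in> fvecs n \<Longrightarrow> \<theta> v y z = 0" for v
    proof -
      have "T (vec n v) w u = 0" if "w \<in> carrier_vec n" "u \<in> carrier_vec n" for w u
        using v(2)[of "unvec n w" "unvec n u"] that by (simp add: \<theta>_def)
      then have "vec n v = 0\<^sub>v n" using T(3) by simp
      then show ?thesis using unvec_vec[OF v(1)] by (simp only: unvec_zero)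
    qed
    show "\<theta> (?mul x y) (?mul x y) (?mul x y) = \<theta> x x x * \<theta> y y y" if "x \<in> fvecs n" "y \<in> fvecs n" for x y
      using mult[of x y] that by (simp add: diag)
  qed (simp_all add: bilin_linear del: fscale_apply plus_fun_apply)
  then show ?thesis using cubic diag by (intro exI cubic_form_composition.intro)
qed

text \<open>The product is field multiplication on \<open>L\<close> transported by the isomorphism.
  The field norm vanishes only at zero, so the form is anisotropic, and
  \<open>\<theta> v v v\<close> alone already witnesses nondegeneracy.\<close>

lemma norm_form_imp_cubic_form_composition:
  fixes \<phi> :: "'f::field mpoly" and j :: "'f \<Rightarrow> 'l::field"
  assumes cubic: "cubic_form n \<phi>" and fin: "finite_extension j L" and iso: "isomorphic_to_norm_form j L n \<phi>"
    and char: "(2::'f) \<noteq> 0" "(3::'f) \<noteq> 0"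
  shows "\<exists>mul \<theta>. cubic_form_composition n \<phi> mul \<theta>"
proof -
  obtain f where bij: "bij_betw f (carrier_vec n) L"
    and f: "\<forall>u\<in>carrier_vec n. \<forall>v\<in>carrier_vec n. f (u + v) = f u + f v"
      "\<forall>c. \<forall>v\<in>carrier_vec n. f (c \<cdot>\<^sub>v v) = j c * f v"
      "\<forall>v\<in>carrier_vec n. field_norm j L (f v) = form_value \<phi> v"
    using iso unfolding isomorphic_to_norm_form_def isomorphic_forms_def ext_scale_def by blast
  have fL: "f v \<in> L" if "v \<in> carrier_vec n" for v using bij that by (rule bij_betwE[THEN bspec])
  have L: "field_hom j" "range j \<subseteq> L" "\<And>a b. a \<in> L \<Longrightarrow> b \<in> L \<Longrightarrow> a * b \<in> L" "\<And>a b. a \<in> L \<Longrightarrow> b \<in> L \<Longrightarrow> a + b \<in> L"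
    using fin by (auto simp: finite_extension_def field_extension_def)
  then have jL: "j c \<in> L" for c by blast
  interpret j: field_hom j by (rule L(1))
  define g where "g = inv_into (carrier_vec n) f"
  have g: "f (g a) = a" "g a \<in> carrier_vec n" if "a \<in> L" for a
    using that bij unfolding g_def by (auto simp: bij_betw_def f_inv_into_f inv_into_into)
  have gf: "g (f v) = v" if "v \<in> carrier_vec n" for v
    using that bij unfolding g_def by (auto simp: bij_betw_def inv_into_f_f)
  have g_add: "g (a + b) = g a + g b" if "a \<in> L" "b \<in> L" for a b
    using gf[of "g a + g b"] f(1) g that by simp
  have g_scale: "g (j c * a) = c \<cdot>\<^sub>v g a" if "a \<in> L" for c a
    using gf[of "c \<cdot>\<^sub>v g a"] f(2) g that by simp
  define \<mu> where "\<mu> x y = f (vec n x) * f (vec n y)" for x y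
  have \<mu>L: "\<mu> x y \<in> L" for x y unfolding \<mu>_def by (intro L(3) fL) simp_all
  have \<mu>: "\<mu> (x + x') y = \<mu> x y + \<mu> x' y" "\<mu> y (x + x') = \<mu> y x + \<mu> y x'"
    "\<mu> (fscale c x) y = j c * \<mu> x y" "\<mu> y (fscale c x) = j c * \<mu> y x" for x x' y c
    using f(1,2) by (simp_all add: \<mu>_def vec_add vec_fscale algebra_simps)
  define mul where "mul x y = unvec n (g (\<mu> x y))" for x y
  let ?t = "trilin (\<lambda>c. c) n (cubic_coeff \<phi>)"
  have norm: "?t x x x = field_norm j L (f (vec n x))" if "x \<in> fvecs n" for x
    using f(3) form_value_vec[OF cubic that] by simp
  have f0: "f (0\<^sub>v n) = 0"
  proof -
    have "f (0 \<cdot>\<^sub>v 0\<^sub>v n) = j 0 * f (0\<^sub>v n)" using f(2) zero_carrier_vec by blast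
    moreover have "(0 :: 'f) \<cdot>\<^sub>v 0\<^sub>v n = 0\<^sub>v n" by (rule eq_vecI) simp_all
    ultimately show ?thesis by simp
  qed
  have aniso: "v = 0" if v: "v \<in> fvecs n" "?t v v v = 0" for v
  proof -
    have "f (vec n v) = 0"
      using norm[OF v(1)] v(2) field_norm_nonzero[OF fin fL[of "vec n v"]] by auto
    then have "vec n v = 0\<^sub>v n" using gf[of "vec n v"] gf[of "0\<^sub>v n"] f0 by simp
    then show ?thesis using unvec_vec[OF v(1)] by (simp only: unvec_zero)
  qed
  \<comment> \<open>The coefficient tensor is not symmetric; averaging over the six permutations
    makes it so and keeps the diagonal.\<close>
  define \<theta> where "\<theta> x y z = inverse 6 * (?t x y z + ?t x z y + ?t y x z + ?t y z x + ?t z x y + ?t z y x)" for x y z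
  have diag: "\<theta> x x x = ?t x x x" for x
  proof -
    have "(6::'f) = 2 * 3" by simp
    then have "(6::'f) \<noteq> 0" using char by (simp only: mult_eq_0_iff simp_thms)
    moreover have "\<theta> x x x = inverse 6 * (6 * ?t x x x)" by (simp add: \<theta>_def)
    ultimately show ?thesis by (simp only: mult.assoc[symmetric] left_inverse mult_1_left simp_thms)
  qed
  have "cubic_composition fscale (fvecs n) mul \<theta>"
  proof (intro cubic_composition.intro vector_space_fscale cubic_composition_axioms.intro subspace_fvecs char)
    show "\<theta> x y z = \<theta> y x z" "\<theta> x y z = \<theta> x z y" for x y z
      by (simp_all add: \<theta>_def add_ac)
    show "\<theta> (x + x') y z = \<theta> x y z + \<theta> x' y z" "\<theta> (fscale c x) y z = c * \<theta> x y z" for x x' y z c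
      unfolding \<theta>_def trilin_linear by (simp_all add: algebra_simps)
    show "v = 0" if "v \<in> fvecs n" "\<And>y z. y \<in> fvecs n \<Longrightarrow> z \<in> fvecs n \<Longrightarrow> \<theta> v y z = 0" for v
      using aniso[OF that(1)] that(2)[OF that(1) that(1)] by (simp add: diag)
    show "\<theta> (mul x y) (mul x y) (mul x y) = \<theta> x x x * \<theta> y y y" if "x \<in> fvecs n" "y \<in> fvecs n" for x y
    proof -
      have "?t (mul x y) (mul x y) (mul x y) = field_norm j L (\<mu> x y)"
        using norm[of "mul x y"] g[OF \<mu>L[of x y]] by (simp add: mul_def)
      then show ?thesis
        using that by (simp add: diag norm \<mu>_def field_norm_mult[OF fin] fL)
    qed
    show "mul (x + y) z = mul x z + mul y z" "mul x (y + z) = mul x y + mul x z" for x y z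
      unfolding mul_def \<mu> by (simp_all only: g_add \<mu>L unvec_add g(2))
    show "mul (fscale c x) y = fscale c (mul x y)" "mul x (fscale c y) = fscale c (mul x y)" for c x y
      unfolding mul_def \<mu> by (simp_all only: g_scale \<mu>L unvec_smult g(2))
    show "mul x y \<in> fvecs n" for x y by (simp add: mul_def)
  qed
  then show ?thesis using cubic diag by (intro exI cubic_form_composition.intro)
qed

theorem theorem8:
  fixes \<phi> :: "'f::field mpoly" and n :: nat
  assumes "CHAR('f) = 0 \<or> CHAR('f) > 3"
    and "cubic_form n \<phi>"
  shows "(nondegenerate n \<phi> \<and> permits_composition n \<phi> \<and> \<not> norm_of_some_cubic_extension n \<phi> \<longrightarrow>
           (\<forall>(h :: 'f \<Rightarrow> 'k::field) K.
              finite_extension h K \<and> separable_extension h K \<longrightarrow> scharlau_norm_principle h K n \<phi>)) \<and>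
         (\<forall>(j :: 'f \<Rightarrow> 'l::field) L.
           cubic_extension j L \<and> isomorphic_to_norm_form j L n \<phi> \<longrightarrow>
           (\<forall>(h :: 'f \<Rightarrow> 'k) K. finite_galois_extension h K \<longrightarrow> scharlau_norm_principle h K n \<phi>) \<and>
           (\<forall>(h :: 'f \<Rightarrow> 'k) K.
              finite_extension h K \<and> ((\<exists>m. ext_degree h K = 3 ^ m) \<or> coprime (ext_degree h K) 3) \<longrightarrow>
              scharlau_norm_principle h K n \<phi>))"
proof -
  \<comment> \<open>A characteristic 0 divides no nonzero number, and one above 3 is too large to
    divide 2 or 3.\<close>
  have "\<not> CHAR('f) dvd 2" "\<not> CHAR('f) dvd 3"
    using assms(1) by (auto dest: dvd_imp_le)
  then have char: "(2::'f) \<noteq> 0" "(3::'f) \<noteq> 0"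
    using of_nat_eq_0_iff_char_dvd[where ?'a = 'f, of 2] of_nat_eq_0_iff_char_dvd[where ?'a = 'f, of 3]
    by simp_all
  have principle: "scharlau_norm_principle h K n \<phi>"
    if "\<exists>mul \<theta>. cubic_form_composition n \<phi> mul \<theta>" "finite_extension h K" for h :: "'f \<Rightarrow> 'k" and K
    using that cubic_form_composition.norm_principle by blast
  have "\<forall>(h :: 'f \<Rightarrow> 'k) K. finite_extension h K \<longrightarrow> scharlau_norm_principle h K n \<phi>"
    if "permits_composition n \<phi>"
    using principle permits_composition_imp_cubic_form_composition[OF assms(2) that char] by blast
  moreover have "\<forall>(h :: 'f \<Rightarrow> 'k) K. finite_extension h K \<longrightarrow> scharlau_norm_principle h K n \<phi>"
    if "cubic_extension j L" "isomorphic_to_norm_form j L n \<phi>" for j :: "'f \<Rightarrow> 'l" and L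
    using principle norm_form_imp_cubic_form_composition[OF assms(2) _ that(2) char] that(1)
    unfolding cubic_extension_def by blast
  ultimately show ?thesis unfolding finite_galois_extension_def by blast
qed

end
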